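(* In the model of the context let $$f(x)=\frac{1}{1+\exp(-\theta(x-x^* ))},\qquad x^*\in(0,1),\ \theta>0 .$$ Assume that one of the following conditions holds: S1) $\theta/4\le 1/(1-\alpha-\beta)$; or S2) $\max\{f'(0),f'(1)\}\ge 1/(1-\alpha-\beta)$; or S3) $\max\{f'(0),f'(1)\}<1/(1-\alpha-\beta)<\theta/4$ and, letting $x_1^*\in(0,x^* )$ and $x_2^*=2x^*-x_1^*\in(x^*,1)$ be the solutions of $f'=1/(1-\alpha-\beta)$, either $f(x_1^* )\ge \frac{x_1^*}{1-\alpha-\beta}$ or $f(x_2^* )\le\frac{x_2^*}{1-\alpha-\beta}-\frac{\alpha+\beta}{1-\alpha-\beta}$. Then there is a random variable of the form $\mathbf{Z}_\infty=Z_\infty\mathbf{1}$ such that, almost surely, $$\mathbf{Z}_n\longrightarrow\mathbf{Z}_\infty\qquad\text{and}\qquad\frac1n\sum_{k=1}^n\mathbf{I}_k\longrightarrow\mathbf{Z}_\infty .$$ Moreover, $\mathbf{Z}_\infty$ takes values in the set of the stable zero points of $\mathbf{F}$, which is contained in $(0,1)^N$ and consists of at most two different points.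
   Context: Model. Let $N\ge 2$, $\alpha,\beta\in[0,1)$ with $\alpha+\beta\in(0,1)$, $q\in(0,1]$, and let $f:[0,1]\to[0,1]$ be the given strictly increasing $\mathcal{C}^1$ function. Let $(r_n)_{n\ge0}$ be a deterministic sequence in $[0,1]$ with $\lim_{n\to\infty} n r_n=1$. Let $Z_{0,h}$, $1\le h\le N$, be random variables with values in $[0,1]$. For $n\ge 0$ and $1\le h\le N$ set $Z_{n+1,h}=(1-r_n)Z_{n,h}+r_nI_{n+1,h}$, where the $I_{n+1,h}$ take values in $\{0,1\}$ and, given $\mathcal{F}_n=\sigma(Z_{0,h}:1\le h\le N)\vee\sigma(I_{k,h}:1\le k\le n,\,1\le h\le N)$, the variables $I_{n+1,1},\dots,I_{n+1,N}$ are conditionally independent with $$P(I_{n+1,h}=1\mid\mathcal{F}_n)=\alpha Z_n+\beta q+(1-\alpha-\beta)f(Z_{n,h}),\qquad Z_n=\frac1N\sum_{i=1}^N Z_{n,i}.$$ Write $\mathbf{Z}_n=(Z_{n,1},\dots,Z_{n,N})^\top$, $\mathbf{I}_n=(I_{n,1},\dots,I_{n,N})^\top$, and let $\mathbf{1}$ be the vector with all components equal to $1$. Define $\mathbf{F}=(F_1,\dots,F_N)^\top$ on $[0,1]^N$ by $$F_h(\mathbf{z})=\alpha\frac1N\sum_{i=1}^Nz_i+\beta q+(1-\alpha-\beta)f(z_h)-z_h .$$ A zero point of $\mathbf{F}$ is a $\mathbf{z}\in[0,1]^N$ with $\mathbf{F}(\mathbf{z})=\mathbf{0}$; it is stable if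 all eigenvalues of the Jacobian matrix of $\mathbf{F}$ at $\mathbf{z}$ (a symmetric matrix) are $\le 0$.
   Formalization: The case α=0, q=1 with equality f(x_2^* )=x_2^*/(1-α-β)-(α+β)/(1-α-β) in the second alternative of S3 is excluded: there the coordinates decouple and F has at least 2^N≥4 stable zero points, so the claim of at most two is false. *)

theory Defs
  imports "HOL-Probability.Probability"
begin

definition cond_prob :: "'a measure \<Rightarrow> 'a measure \<Rightarrow> 'a set \<Rightarrow> 'a \<Rightarrow> real" where
  "cond_prob M G A = real_cond_exp M G (indicator A)"

text \<open>Conditional version of \<^const>\<open>prob_space.indep_vars\<close>, given the sub-sigma-algebra \<open>G\<close> of \<open>M\<close>.\<close>

definition cond_indep_vars ::
  "'a measure \<Rightarrow> 'a measure \<Rightarrow> ('i \<Rightarrow> 'b measure) \<Rightarrow> ('i \<Rightarrow> 'a \<Rightarrow> 'b) \<Rightarrow> 'i set \<Rightarrow> bool" where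
  "cond_indep_vars M G M' X I \<longleftrightarrow>
    (\<forall>i\<in>I. X i \<in> measurable M (M' i)) \<and>
    (\<forall>J\<subseteq>I. J \<noteq> {} \<longrightarrow> finite J \<longrightarrow> (\<forall>A\<in>(\<Pi> j\<in>J. sets (M' j)).
      AE \<omega> in M. cond_prob M G (\<Inter>j\<in>J. X j -` A j \<inter> space M) \<omega> =
                  (\<Prod>j\<in>J. cond_prob M G (X j -` A j \<inter> space M) \<omega>)))"

definition mean :: "real ^ 'n \<Rightarrow> real" where
  "mean z = (1 / real CARD('n)) * (\<Sum>i\<in>UNIV. z $ i)"

text \<open>\<open>past M Z I n\<close> is \<open>\<F>\<^sub>n\<close>, generated by all \<open>Z\<^sub>0\<^sub>,\<^sub>h\<close> and all \<open>I\<^sub>k\<^sub>,\<^sub>h\<close> with \<open>1 \<le> k \<le> n\<close>.\<close>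

definition past ::
  "'a measure \<Rightarrow> (nat \<Rightarrow> 'a \<Rightarrow> real ^ 'n) \<Rightarrow> (nat \<Rightarrow> 'a \<Rightarrow> real ^ 'n) \<Rightarrow> nat \<Rightarrow> 'a measure" where
  "past M Z I n = sigma (space M)
    ({(\<lambda>\<omega>. Z 0 \<omega> $ h) -` A \<inter> space M | h A. A \<in> sets borel} \<union>
     {(\<lambda>\<omega>. I k \<omega> $ h) -` A \<inter> space M | k h A. k \<in> {1..n} \<and> A \<in> sets borel})"

text \<open>The index set \<open>{1..N}\<close> is the finite type \<open>'n\<close>, so \<open>N = CARD('n)\<close>. The function \<open>f\<close> is only
  constrained on \<open>[0,1]\<close>, and the value of \<open>I 0\<close> plays no role.\<close>

locale interacting_system = prob_space M
  for M :: "'a measure" +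
  fixes \<alpha> \<beta> q :: real and f :: "real \<Rightarrow> real" and r :: "nat \<Rightarrow> real"
    and Z I :: "nat \<Rightarrow> 'a \<Rightarrow> real ^ 'n"
  assumes N_ge_2: "CARD('n) \<ge> 2"
    and \<alpha>_range: "0 \<le> \<alpha>" "\<alpha> < 1"
    and \<beta>_range: "0 \<le> \<beta>" "\<beta> < 1"
    and \<alpha>\<beta>_range: "0 < \<alpha> + \<beta>" "\<alpha> + \<beta> < 1"
    and q_range: "0 < q" "q \<le> 1"
    and f_range: "f \<in> {0..1} \<rightarrow> {0..1}"
    and f_strict_mono: "strict_mono_on {0..1} f"
    and f_C1: "\<exists>f'. continuous_on {0..1} f' \<and>
                (\<forall>x\<in>{0..1}. (f has_real_derivative f' x) (at x within {0..1}))"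
    and r_range: "\<And>n. r n \<in> {0..1}"
    and r_lim: "(\<lambda>n. real n * r n) \<longlonglongrightarrow> 1"
    and Z0_measurable: "\<And>h. (\<lambda>\<omega>. Z 0 \<omega> $ h) \<in> borel_measurable M"
    and Z0_range: "\<And>h \<omega>. \<omega> \<in> space M \<Longrightarrow> Z 0 \<omega> $ h \<in> {0..1}"
    and Z_Suc: "\<And>n h \<omega>. \<omega> \<in> space M \<Longrightarrow>
                  Z (Suc n) \<omega> $ h = (1 - r n) * Z n \<omega> $ h + r n * I (Suc n) \<omega> $ h"
    and I_measurable: "\<And>n h. (\<lambda>\<omega>. I (Suc n) \<omega> $ h) \<in> borel_measurable M"
    and I_range: "\<And>n h \<omega>. \<omega> \<in> space M \<Longrightarrow> I (Suc n) \<omega> $ h \<in> {0, 1}"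
    and I_cond_indep: "\<And>n. cond_indep_vars M (past M Z I n) (\<lambda>_. borel)
                             (\<lambda>h \<omega>. I (Suc n) \<omega> $ h) UNIV"
    and I_cond_prob: "\<And>n h. AE \<omega> in M.
          cond_prob M (past M Z I n) {\<omega> \<in> space M. I (Suc n) \<omega> $ h = 1} \<omega> =
            \<alpha> * mean (Z n \<omega>) + \<beta> * q + (1 - \<alpha> - \<beta>) * f (Z n \<omega> $ h)"

definition drift ::
  "real \<Rightarrow> real \<Rightarrow> real \<Rightarrow> (real \<Rightarrow> real) \<Rightarrow> real ^ 'n \<Rightarrow> real ^ 'n" where
  "drift \<alpha> \<beta> q f z = (\<chi> h. \<alpha> * mean z + \<beta> * q + (1 - \<alpha> - \<beta>) * f (z $ h) - z $ h)"

definition zero_points ::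
  "real \<Rightarrow> real \<Rightarrow> real \<Rightarrow> (real \<Rightarrow> real) \<Rightarrow> (real ^ 'n) set" where
  "zero_points \<alpha> \<beta> q f = {z \<in> cbox 0 1. drift \<alpha> \<beta> q f z = 0}"

definition eigenvalue :: "real ^ 'n ^ 'n \<Rightarrow> real \<Rightarrow> bool" where
  "eigenvalue A l \<longleftrightarrow> (\<exists>v. v \<noteq> 0 \<and> A *v v = l *\<^sub>R v)"

text \<open>The Jacobian matrix is that of the map on the cube, hence taken within the cube. It is
  symmetric, so that real eigenvalues suffice.\<close>

definition stable_zero_points ::
  "real \<Rightarrow> real \<Rightarrow> real \<Rightarrow> (real \<Rightarrow> real) \<Rightarrow> (real ^ 'n) set" where
  "stable_zero_points \<alpha> \<beta> q f =
    {z \<in> zero_points \<alpha> \<beta> q f.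
      \<forall>l. eigenvalue (jacobian (drift \<alpha> \<beta> q f) (at z within cbox 0 1)) l \<longrightarrow> l \<le> 0}"

definition logistic :: "real \<Rightarrow> real \<Rightarrow> real \<Rightarrow> real" where
  "logistic \<theta> xs x = 1 / (1 + exp (- \<theta> * (x - xs)))"

text \<open>Degenerate situation without interaction (\<open>\<alpha> = 0\<close>, \<open>q = 1\<close>): at a point \<open>x > xs\<close> the function
  \<open>\<lambda>x. \<beta> + (1 - \<beta>) * f x - x\<close> vanishes together with its derivative. For the logistic \<open>f\<close> this
  function then has a second, smaller zero with negative derivative, and as the coordinates are
  decoupled the drift has \<open>2 ^ CARD('n)\<close> stable zero points, more than two of them.\<close>

definition decoupled_touching ::
  "real \<Rightarrow> real \<Rightarrow> real \<Rightarrow> (real \<Rightarrow> real) \<Rightarrow> real \<Rightarrow> bool" where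
  "decoupled_touching \<alpha> \<beta> q f xs \<longleftrightarrow> \<alpha> = 0 \<and> q = 1 \<and>
    (\<exists>x\<in>{xs<..<1}. deriv f x = 1 / (1 - \<alpha> - \<beta>) \<and>
        f x = x / (1 - \<alpha> - \<beta>) - (\<alpha> + \<beta>) / (1 - \<alpha> - \<beta>))"

end

theory Submission
  imports Defs
begin

text \<open>
The drift is the negative gradient of a function \<open>V\<close> with \<open>V - norm\<^sup>2 / 2\<close> concave, so the expectation of
\<open>V (Z n)\<close> decreases by \<open>r n * norm (drift)\<^sup>2\<close> up to a summable error; hence \<open>r n * norm (drift (Z n))\<^sup>2\<close> is
almost surely summable. Since the drift changes by \<open>O(r n)\<close> per step, its cubed components have bounded
variation, so the drift tends to 0, and the small steps of \<open>Z\<close> force convergence to one of its finitely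
many zeros. By unimodality of the derivative of the logistic function, each of the conditions makes every
zero synchronized, and an equilibrium lying between two others is unstable. The averages of \<open>I\<close> are
handled by summation by parts.

An unstable equilibrium is excluded by monotonicity: two ordered copies of the chain near it can be coupled
so that the drift increases their distance exponentially, and \<open>exp (- \<gamma> * distance)\<close> bounds the probability
that both stay nearby. One step of the chain may produce all ones or all zeros, which separates the two outcomes
by \<open>r n\<close>, enough for this bound to be a constant less than 1. So from every state the probability of leaving is
bounded below, and the chain cannot stay forever.
\<close>

section \<open>Deterministic sequences with harmonic step sizes\<close>

text \<open>Expectations suffice for the descent: the linear noise term averages out, and the
  quadratic one is at most \<open>r n\<close> squared per coordinate. Synchronization is a scalar
  matter, since all coordinates of a zero solve \<open>s * f x + c = x\<close> with the common
  constant \<open>c = \<alpha> * mean z + \<beta> * q\<close>; uniqueness is needed for every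
  constant that can occur. The delicate point of the instability argument is that one step separates
  two copies by only about \<open>1 / n\<close>, so the exponential weight \<open>\<gamma>\<close>
  has to be of order \<open>n\<close>. It may be: the supersolution property only asks that
  \<open>\<gamma> * r k\<close> stay below a fixed threshold at later times, and \<open>r k\<close>
  is of order \<open>1 / k\<close>. At the final time both copies may still be nearby, and the bound
  is corrected by \<open>exp (D * \<gamma>)\<close>, with \<open>D\<close> a bound for their
  distance. By then \<open>\<gamma>\<close> has been divided by a product that diverges with the
  horizon, as the step sizes are not summable, so the correction tends to 1.\<close>

lemma tendsto_0_of_summable_weighted_squares:
  fixes x r :: "nat \<Rightarrow> real"
  assumes r: "\<And>n. 0 \<le> r n" "\<And>n. r n \<le> 1" and r2: "summable (\<lambda>n. (r n)\<^sup>2)"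
    and r_div: "\<not> summable r" and C: "0 \<le> C"
    and step: "\<And>n. \<bar>x (Suc n) - x n\<bar> \<le> C * r n"
    and sq: "summable (\<lambda>n. r n * (x n)\<^sup>2)"
  shows "x \<longlonglongrightarrow> 0"
proof -
  \<comment> \<open>Cubes are taken because \<open>d * (d^2 + 3 * d * b + 3 * b^2)\<close> carries a
    factor \<open>d\<close> of size \<open>C * r n\<close>: next to it, \<open>b^2\<close> gives the
    summable \<open>r n * (x n)^2\<close> and \<open>d^2\<close> a multiple of
    \<open>(r n)^2\<close>. The mixed term is split between the two.\<close>
  have bd: "norm (x (Suc n) ^ 3 - x n ^ 3) \<le> (9/2 * C) * (r n * (x n)\<^sup>2) + 3 * C ^ 3 * (r n)\<^sup>2" for n
  proof -
    define a b d where "a = x (Suc n)" and "b = x n" and "d = a - b"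
    have d: "\<bar>d\<bar> \<le> C * r n" using step[of n] by (simp add: d_def a_def b_def)
    have d2: "d\<^sup>2 \<le> C\<^sup>2 * r n"
    proof -
      have "d\<^sup>2 \<le> (C * r n)\<^sup>2" using d by (metis abs_ge_zero power2_abs power_mono)
      also have "\<dots> = C\<^sup>2 * (r n * r n)" by (simp add: power2_eq_square algebra_simps)
      also have "\<dots> \<le> C\<^sup>2 * (r n * 1)" using r[of n] by (intro mult_left_mono) auto
      finally show ?thesis by simp
    qed
    have "a ^ 3 - b ^ 3 = d * (d\<^sup>2 + 3 * d * b + 3 * b\<^sup>2)"
      by (simp add: d_def power2_eq_square power3_eq_cube algebra_simps)
    then have "\<bar>a ^ 3 - b ^ 3\<bar> = \<bar>d\<bar> * \<bar>d\<^sup>2 + 3 * d * b + 3 * b\<^sup>2\<bar>" by (simp add: abs_mult)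
    also have "\<dots> \<le> (C * r n) * (3 * d\<^sup>2 + 9/2 * b\<^sup>2)"
    proof (intro mult_mono d)
      have "2 * \<bar>d * b\<bar> \<le> d\<^sup>2 + b\<^sup>2"
        using sum_squares_bound[of "\<bar>d\<bar>" "\<bar>b\<bar>"] by (simp add: abs_mult)
      moreover have "0 \<le> d\<^sup>2" "0 \<le> b\<^sup>2" by simp_all
      moreover have "3 * d * b = 3 * (d * b)" by simp
      ultimately show "\<bar>d\<^sup>2 + 3 * d * b + 3 * b\<^sup>2\<bar> \<le> 3 * d\<^sup>2 + 9/2 * b\<^sup>2"
        by linarith
    qed (use C r in auto)
    also have "\<dots> \<le> (C * r n) * (3 * (C\<^sup>2 * r n) + 9/2 * b\<^sup>2)"
      using d2 C r[of n] by (intro mult_left_mono) auto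
    also have "\<dots> = (9/2 * C) * (r n * (x n)\<^sup>2) + 3 * C ^ 3 * (r n)\<^sup>2"
      by (simp add: b_def power2_eq_square power3_eq_cube algebra_simps)
    finally show ?thesis by (simp add: a_def b_def)
  qed
  have "summable (\<lambda>n. x (Suc n) ^ 3 - x n ^ 3)"
    using summable_add[OF summable_mult[OF sq] summable_mult[OF r2]] bd
    by (rule summable_comparison_test')
  then have "convergent (\<lambda>n. \<Sum>k<n. x (Suc k) ^ 3 - x k ^ 3)"
    by (simp add: summable_iff_convergent)
  then have "convergent (\<lambda>n. x n ^ 3 - x 0 ^ 3)"
    using sum_lessThan_telescope[of "\<lambda>n. x n ^ 3"] by simp
  then have "convergent (\<lambda>n. (x n ^ 3 - x 0 ^ 3) + x 0 ^ 3)"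
    by (intro convergent_add convergent_const)
  then obtain L where L: "(\<lambda>n. x n ^ 3) \<longlonglongrightarrow> L" by (auto simp: convergent_def)
  have "L = 0"
  proof (rule ccontr)
    assume "L \<noteq> 0"
    \<comment> \<open>The lower bound for the square of \<open>x n\<close> that follows from
      \<open>|L| / 2 < |x n ^ 3|\<close>. It makes \<open>r n\<close> at most
      \<open>1 / \<delta>\<close> times a summable term, against \<open>r_div\<close>.\<close>
    define \<delta> where "\<delta> = (root 3 (\<bar>L\<bar> / 2))\<^sup>2"
    have \<delta>: "\<delta> > 0" using \<open>L \<noteq> 0\<close> by (simp add: \<delta>_def)
    have "(\<lambda>n. \<bar>x n ^ 3\<bar>) \<longlonglongrightarrow> \<bar>L\<bar>" using L by (rule tendsto_rabs)
    then have "\<forall>\<^sub>F n in sequentially. \<bar>L\<bar> / 2 < \<bar>x n ^ 3\<bar>"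
      using \<open>L \<noteq> 0\<close> by (intro order_tendstoD) auto
    then have "\<forall>\<^sub>F n in sequentially. norm (r n) \<le> (1 / \<delta>) * (r n * (x n)\<^sup>2)"
    proof eventually_elim
      case (elim n)
      have "root 3 (\<bar>L\<bar> / 2) \<le> root 3 (\<bar>x n\<bar> ^ 3)"
        using elim by (simp add: power_abs)
      also have "\<dots> = \<bar>x n\<bar>" by (rule real_root_power_cancel) auto
      finally have "\<delta> \<le> \<bar>x n\<bar>\<^sup>2" unfolding \<delta>_def by (intro power_mono) auto
      then have "r n * \<delta> \<le> r n * (x n)\<^sup>2" using r by (intro mult_left_mono) auto
      then show ?case using \<delta> r by (simp add: field_simps)
    qed
    then have "summable r"
      by (rule summable_comparison_test_ev) (rule summable_mult[OF sq])
    then show False using r_div by simp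
  qed
  then show ?thesis using L by (simp add: power_tendsto_0_iff)
qed

text \<open>By compactness the norm of \<open>F\<close> is bounded below away from small balls
  around the zeros, so the sequence ends up in these balls. Finitely many zeros are separated, and
  steps shorter than the gaps cannot lead from one ball to another.\<close>

lemma convergent_to_isolated_zero:
  fixes F :: "'a::metric_space \<Rightarrow> 'b::real_normed_vector" and x :: "nat \<Rightarrow> 'a"
  assumes K: "compact K" and F: "continuous_on K F" and fin: "finite {z\<in>K. F z = 0}"
    and x: "\<And>n. x n \<in> K" and Fx: "(\<lambda>n. F (x n)) \<longlonglongrightarrow> 0"
    and step: "(\<lambda>n. dist (x (Suc n)) (x n)) \<longlonglongrightarrow> 0"
  shows "\<exists>z\<in>K. F z = 0 \<and> x \<longlonglongrightarrow> z"
proof -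
  define A where "A = {z\<in>K. F z = 0}"
  have near: "\<forall>\<^sub>F n in sequentially. \<exists>z\<in>A. dist (x n) z < e" if "e > 0" for e
  proof -
    define K' where "K' = K - (\<Union>z\<in>A. ball z e)"
    have K': "compact K'" unfolding K'_def by (intro compact_diff K open_UN) auto
    show ?thesis
    proof (cases "K' = {}")
      case True
      have "\<exists>z\<in>A. dist (x n) z < e" for n
      proof -
        have "x n \<in> (\<Union>z\<in>A. ball z e)" using True x[of n] unfolding K'_def by blast
        then show ?thesis by (simp add: dist_commute)
      qed
      then show ?thesis by simp
    next
      case False
      have "continuous_on K' (\<lambda>z. norm (F z))"
        by (intro continuous_intros continuous_on_subset[OF F]) (auto simp: K'_def)
      from continuous_attains_inf[OF K' False this] obtain y
        where y: "y \<in> K'" "\<And>z. z \<in> K' \<Longrightarrow> norm (F y) \<le> norm (F z)" by auto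
      have "F y \<noteq> 0" using y(1) \<open>e > 0\<close> by (auto simp: K'_def A_def)
      moreover have "(\<lambda>n. norm (F (x n))) \<longlonglongrightarrow> 0" using Fx by (rule tendsto_norm_zero)
      ultimately have "\<forall>\<^sub>F n in sequentially. norm (F (x n)) < norm (F y)"
        by (intro order_tendstoD) auto
      then show ?thesis
      proof eventually_elim
        case (elim n)
        then have "x n \<notin> K'" using y(2)[of "x n"] by auto
        then show ?case using x[of n] by (auto simp: K'_def dist_commute)
      qed
    qed
  qed
  \<comment> \<open>Inserting 1 keeps \<open>Min P\<close> defined when there are fewer than two
    zeros. A third of the minimal gap leaves room for two radii and one step.\<close>
  define P where "P = insert 1 ((\<lambda>(y, z). dist y z) ` {(y, z). y \<in> A \<and> z \<in> A \<and> y \<noteq> z})"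
  have "finite {(y, z). y \<in> A \<and> z \<in> A \<and> y \<noteq> z}"
    by (rule finite_subset[of _ "A \<times> A"]) (use fin in \<open>auto simp: A_def\<close>)
  then have finP: "finite P" by (simp add: P_def)
  define \<delta> where "\<delta> = Min P / 3"
  have \<delta>: "\<delta> > 0" using finP by (auto simp: \<delta>_def P_def)
  have sep: "y = z" if "y \<in> A" "z \<in> A" "dist y z < 3 * \<delta>" for y z
  proof (rule ccontr)
    assume "y \<noteq> z"
    then have "dist y z \<in> P" using that by (auto simp: P_def)
    then show False using that(3) Min_le[OF finP] by (force simp: \<delta>_def)
  qed
  have "\<forall>\<^sub>F n in sequentially. dist (x (Suc n)) (x n) < \<delta>"
    using step \<delta> by (intro order_tendstoD) auto
  with near[OF \<delta>] have "\<forall>\<^sub>F n in sequentially. (\<exists>z\<in>A. dist (x n) z < \<delta>) \<and> dist (x (Suc n)) (x n) < \<delta>"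
    by (rule eventually_conj)
  then obtain n0 where n0: "\<And>n. n \<ge> n0 \<Longrightarrow> \<exists>z\<in>A. dist (x n) z < \<delta>"
    "\<And>n. n \<ge> n0 \<Longrightarrow> dist (x (Suc n)) (x n) < \<delta>"
    unfolding eventually_sequentially by auto
  from n0(1)[of n0] obtain z where z: "z \<in> A" "dist (x n0) z < \<delta>" by auto
  have stay: "dist (x n) z < \<delta>" if "n \<ge> n0" for n
    using that
  proof (induction n rule: dec_induct)
    case base
    then show ?case by (rule z)
  next
    case (step n)
    obtain z' where z': "z' \<in> A" "dist (x (Suc n)) z' < \<delta>" using n0(1)[of "Suc n"] step by auto
    have "dist z z' \<le> dist z (x n) + dist (x n) (x (Suc n)) + dist (x (Suc n)) z'"
      by metric
    also have "\<dots> < 3 * \<delta>" using step n0(2)[of n] z' by (simp add: dist_commute)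
    finally have "z = z'" using z z' by (intro sep) auto
    then show ?case using z' by simp
  qed
  have "x \<longlonglongrightarrow> z"
  proof (rule tendstoI)
    fix e :: real assume "e > 0"
    have "\<forall>\<^sub>F n in sequentially. \<exists>z\<in>A. dist (x n) z < min e \<delta>"
      using \<open>e > 0\<close> \<delta> by (intro near) simp
    moreover have "\<forall>\<^sub>F n in sequentially. dist (x n) z < \<delta>"
      using stay by (auto simp: eventually_sequentially)
    ultimately show "\<forall>\<^sub>F n in sequentially. dist (x n) z < e"
    proof eventually_elim
      case (elim n)
      then obtain z' where z': "z' \<in> A" "dist (x n) z' < min e \<delta>" by auto
      have "dist z z' \<le> dist (x n) z + dist (x n) z'" by metric
      also have "\<dots> < 3 * \<delta>" using elim z' \<delta> by simp
      finally have "z = z'" using z z' by (intro sep) auto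
      then show ?case using z' by simp
    qed
  qed
  then show ?thesis using z by (auto simp: A_def)
qed

lemma Cesaro_tendsto:
  fixes x :: "nat \<Rightarrow> real"
  assumes "x \<longlonglongrightarrow> l"
  shows "(\<lambda>n. (\<Sum>k<n. x k) / real n) \<longlonglongrightarrow> l"
proof (rule LIMSEQ_I)
  fix e :: real assume e: "e > 0"
  obtain m where m: "\<And>n. n \<ge> m \<Longrightarrow> \<bar>x n - l\<bar> < e / 2"
    using LIMSEQ_D[OF assms, of "e / 2"] e by auto
  define C where "C = (\<Sum>k<m. \<bar>x k - l\<bar>)"
  obtain n1 :: nat where n1: "2 * C / e < real n1" using reals_Archimedean2 by blast
  show "\<exists>no. \<forall>n\<ge>no. norm ((\<Sum>k<n. x k) / real n - l) < e"
  proof (intro exI allI impI)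
    fix n assume n: "n \<ge> Suc (max m n1)"
    have "(\<Sum>k<n. x k) / real n - l = (\<Sum>k<n. x k - l) / real n"
      using n by (simp add: sum_subtractf field_simps)
    moreover have "\<bar>\<Sum>k<n. x k - l\<bar> < e * real n"
    proof -
      have "\<bar>\<Sum>k<n. x k - l\<bar> \<le> (\<Sum>k<n. \<bar>x k - l\<bar>)" by (rule sum_abs)
      also have "\<dots> = C + (\<Sum>k\<in>{m..<n}. \<bar>x k - l\<bar>)"
        unfolding C_def using n by (simp add: lessThan_atLeast0 sum.atLeastLessThan_concat)
      also have "(\<Sum>k\<in>{m..<n}. \<bar>x k - l\<bar>) \<le> real (card {m..<n}) * (e / 2)"
        by (rule sum_bounded_above) (use m in \<open>auto intro: less_imp_le\<close>)
      also have "real (card {m..<n}) * (e / 2) \<le> real n * (e / 2)"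
        using e by (intro mult_right_mono) auto
      also have "C < real n * (e / 2)"
        using n1 n e by (simp add: field_simps) (smt (verit) mult_strict_left_mono of_nat_less_iff Suc_le_eq max.cobounded2 of_nat_le_iff mult_left_mono)
      finally show ?thesis by (simp add: field_simps)
    qed
    ultimately show "norm ((\<Sum>k<n. x k) / real n - l) < e"
      using n by (simp add: field_simps)
  qed
qed

text \<open>Solving the recursion for \<open>y\<close> and summing by parts.\<close>

lemma averages_tendsto_of_recursion:
  fixes x y r :: "nat \<Rightarrow> real"
  assumes r_lim: "(\<lambda>n. real n * r n) \<longlonglongrightarrow> 1"
    and rec: "\<And>n. x (Suc n) = (1 - r n) * x n + r n * y (Suc n)"
    and y: "\<And>n. \<bar>y (Suc n)\<bar> \<le> 1" and x: "x \<longlonglongrightarrow> l"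
  shows "(\<lambda>n. (1 / real n) * (\<Sum>k=1..n. y k)) \<longlonglongrightarrow> l"
proof -
  define \<rho> where "\<rho> n = real n * r n" for n
  have \<rho>: "\<rho> \<longlonglongrightarrow> 1" using r_lim by (simp add: \<rho>_def[abs_def])
  have sum_eq: "(\<Sum>k<n. \<rho> k * y (Suc k)) = real n * x n - (\<Sum>k<n. x (Suc k)) + (\<Sum>k<n. \<rho> k * x k)" for n
  proof (induction n)
    case (Suc n)
    have "\<rho> n * y (Suc n) = real n * (r n * y (Suc n))" by (simp add: \<rho>_def)
    also have "r n * y (Suc n) = x (Suc n) - (1 - r n) * x n" using rec[of n] by simp
    finally have "\<rho> n * y (Suc n) = real n * (x (Suc n) - x n) + \<rho> n * x n"
      by (simp add: \<rho>_def algebra_simps)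
    then show ?case using Suc by (simp add: algebra_simps)
  qed simp
  \<comment> \<open>\<open>sum_eq\<close> weights \<open>y\<close> by \<open>\<rho>\<close> instead
    of 1. As \<open>y\<close> is bounded and \<open>\<rho>\<close> tends to 1, the averages of the
    difference vanish.\<close>
  have "(\<lambda>n. (\<rho> n - 1) * y (Suc n)) \<longlonglongrightarrow> 0"
  proof (rule Lim_null_comparison)
    show "(\<lambda>n. \<bar>\<rho> n - 1\<bar>) \<longlonglongrightarrow> 0" using \<rho> by (simp add: LIM_zero tendsto_rabs_zero)
    show "\<forall>\<^sub>F n in sequentially. norm ((\<rho> n - 1) * y (Suc n)) \<le> \<bar>\<rho> n - 1\<bar>"
      using y by (auto simp: abs_mult mult_left_le)
  qed
  then have 1: "(\<lambda>n. (\<Sum>k<n. (\<rho> k - 1) * y (Suc k)) / real n) \<longlonglongrightarrow> 0" by (rule Cesaro_tendsto)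
  have 2: "(\<lambda>n. (\<Sum>k<n. x (Suc k)) / real n) \<longlonglongrightarrow> l" by (intro Cesaro_tendsto LIMSEQ_Suc x)
  have 3: "(\<lambda>n. (\<Sum>k<n. \<rho> k * x k) / real n) \<longlonglongrightarrow> 1 * l" by (intro Cesaro_tendsto tendsto_mult \<rho> x)
  have lim: "(\<lambda>n. x n - (\<Sum>k<n. x (Suc k)) / real n + (\<Sum>k<n. \<rho> k * x k) / real n
      - (\<Sum>k<n. (\<rho> k - 1) * y (Suc k)) / real n) \<longlonglongrightarrow> l - l + 1 * l - 0"
    by (intro tendsto_add tendsto_diff x 1 2 3)
  moreover have "\<forall>\<^sub>F n in sequentially. x n - (\<Sum>k<n. x (Suc k)) / real n + (\<Sum>k<n. \<rho> k * x k) / real n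
      - (\<Sum>k<n. (\<rho> k - 1) * y (Suc k)) / real n = (1 / real n) * (\<Sum>k=1..n. y k)"
    using eventually_gt_at_top[of 0]
  proof eventually_elim
    case (elim n)
    have "(\<Sum>k=1..n. y k) = (\<Sum>k<n. y (Suc k))"
      by (simp add: sum.atLeast1_atMost_eq)
    also have "\<dots> = (\<Sum>k<n. \<rho> k * y (Suc k)) - (\<Sum>k<n. (\<rho> k - 1) * y (Suc k))"
      by (simp add: sum_subtractf[symmetric] algebra_simps)
    finally show ?case using elim unfolding sum_eq by (simp add: diff_divide_distrib add_divide_distrib)
  qed
  ultimately show ?thesis by (simp add: tendsto_cong)
qed

section \<open>Summability of the step sizes and of their squares\<close>

lemma step_size_asymptotics:
  fixes r :: "nat \<Rightarrow> real"
  assumes "(\<lambda>n. real n * r n) \<longlonglongrightarrow> 1"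
  shows "\<exists>n0\<ge>1. \<forall>n\<ge>n0. 1 / (2 * real n) \<le> r n \<and> r n \<le> 2 / real n"
proof -
  have "\<forall>\<^sub>F n in sequentially. 1/2 < real n * r n" "\<forall>\<^sub>F n in sequentially. real n * r n < 2"
    using order_tendstoD(1)[OF assms, of "1/2"] order_tendstoD(2)[OF assms, of 2] by simp_all
  then have "\<forall>\<^sub>F n in sequentially. 1/2 < real n * r n \<and> real n * r n < 2 \<and> n \<ge> 1"
    using eventually_ge_at_top[of 1] by eventually_elim auto
  then obtain n0 where "\<And>n. n \<ge> n0 \<Longrightarrow> 1/2 < real n * r n \<and> real n * r n < 2 \<and> n \<ge> 1"
    by (auto simp: eventually_sequentially)
  then have "1 / (2 * real n) \<le> r n \<and> r n \<le> 2 / real n" if "n \<ge> max 1 n0" for n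
    using that by (fastforce simp: field_simps)
  then show ?thesis by (intro exI[of _ "max 1 n0"]) auto
qed

lemma not_summable_step_size:
  fixes r :: "nat \<Rightarrow> real"
  assumes "(\<lambda>n. real n * r n) \<longlonglongrightarrow> 1"
  shows "\<not> summable r"
proof
  assume "summable r"
  obtain n0 where n0: "\<And>n. n \<ge> n0 \<Longrightarrow> 1 / (2 * real n) \<le> r n" "n0 \<ge> 1"
    using step_size_asymptotics[OF assms] by auto
  have "summable (\<lambda>n. inverse (real n))"
    by (rule summable_comparison_test'[OF summable_mult[OF \<open>summable r\<close>, of 2], of n0])
      (use n0 in \<open>force simp: field_simps\<close>)
  then show False using not_summable_harmonic[where 'a = real] by simp
qed

lemma summable_step_size_squares:
  fixes r :: "nat \<Rightarrow> real"
  assumes "(\<lambda>n. real n * r n) \<longlonglongrightarrow> 1" "\<And>n. 0 \<le> r n"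
  shows "summable (\<lambda>n. (r n)\<^sup>2)"
proof -
  obtain n0 where n0: "\<And>n. n \<ge> n0 \<Longrightarrow> r n \<le> 2 / real n" "n0 \<ge> 1"
    using step_size_asymptotics[OF assms(1)] by auto
  have "summable (\<lambda>n. inverse (real n ^ 2))" by (rule inverse_power_summable) simp
  then show ?thesis
  proof (rule summable_comparison_test'[OF summable_mult[of _ 4], of _ n0])
    fix n assume "n \<ge> n0"
    then have "(r n)\<^sup>2 \<le> (2 / real n)\<^sup>2" using n0 assms(2) by (intro power_mono) auto
    then show "norm ((r n)\<^sup>2) \<le> 4 * inverse ((real n)\<^sup>2)"
      by (simp add: field_simps power2_eq_square)
  qed
qed

section \<open>The logistic function\<close>

lemma card_le_2_if_no_increasing_triple:
  fixes S :: "'a::linorder set"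
  assumes "\<And>a b c. \<lbrakk>a \<in> S; b \<in> S; c \<in> S; a < b; b < c\<rbrakk> \<Longrightarrow> False"
  shows "finite S \<and> card S \<le> 2"
proof (rule ccontr)
  assume "\<not> ?thesis"
  then obtain T where T: "T \<subseteq> S" "card T = 3"
    by (metis infinite_arbitrarily_large not_less_eq_eq numeral_3_eq_3 numeral_2_eq_2 obtain_subset_with_card_n)
  then obtain x y z where "T = {x, y, z}" "x \<noteq> y" "y \<noteq> z" "x \<noteq> z" by (auto simp: card_3_iff)
  with T have "x \<in> S" "y \<in> S" "z \<in> S" by auto
  with \<open>x \<noteq> y\<close> \<open>y \<noteq> z\<close> \<open>x \<noteq> z\<close> show False using assms by (metis linorder_neqE)
qed

definition logistic_deriv :: "real \<Rightarrow> real \<Rightarrow> real \<Rightarrow> real" where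
  "logistic_deriv \<theta> xs x = \<theta> * (logistic \<theta> xs x * (1 - logistic \<theta> xs x))"

lemma logistic_pos: "0 < logistic \<theta> xs x"
  by (simp add: logistic_def add_pos_pos)

lemma logistic_less_1: "logistic \<theta> xs x < 1"
  by (simp add: logistic_def add_pos_pos)

lemma has_real_derivative_logistic:
  "(logistic \<theta> xs has_real_derivative logistic_deriv \<theta> xs x) (at x within S)"
proof -
  have ne: "1 + exp (- \<theta> * (x - xs)) \<noteq> 0" by (smt (verit) exp_gt_zero)
  have "((\<lambda>x. 1 / (1 + exp (- \<theta> * (x - xs)))) has_real_derivative
      \<theta> * exp (- \<theta> * (x - xs)) / (1 + exp (- \<theta> * (x - xs)))\<^sup>2) (at x within S)"
    using ne by (auto intro!: derivative_eq_intros simp: power2_eq_square)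
  moreover have "\<theta> * exp (- \<theta> * (x - xs)) / (1 + exp (- \<theta> * (x - xs)))\<^sup>2 = logistic_deriv \<theta> xs x"
    using ne by (simp add: logistic_deriv_def logistic_def field_simps power2_eq_square)
  ultimately show ?thesis by (simp add: logistic_def[abs_def])
qed

lemma deriv_logistic: "deriv (logistic \<theta> xs) x = logistic_deriv \<theta> xs x"
  by (rule DERIV_imp_deriv[OF has_real_derivative_logistic])

lemma continuous_on_logistic: "continuous_on S (logistic \<theta> xs)"
  by (rule DERIV_continuous_on[OF has_real_derivative_logistic])

lemma continuous_on_logistic_deriv: "continuous_on S (logistic_deriv \<theta> xs)"
  unfolding logistic_deriv_def[abs_def] by (intro continuous_intros continuous_on_logistic)

lemma logistic_strict_mono:
  assumes "\<theta> > 0" "x < y" shows "logistic \<theta> xs x < logistic \<theta> xs y"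
proof -
  have "exp (- \<theta> * (y - xs)) < exp (- \<theta> * (x - xs))" using assms by simp
  then show ?thesis by (auto simp: logistic_def intro!: divide_strict_left_mono add_pos_pos mult_pos_pos)
qed

lemma logistic_mono: "\<theta> > 0 \<Longrightarrow> x \<le> y \<Longrightarrow> logistic \<theta> xs x \<le> logistic \<theta> xs y"
  using logistic_strict_mono[of \<theta> x y xs] by (cases "x = y") auto

lemma logistic_center: "logistic \<theta> xs xs = 1/2"
  by (simp add: logistic_def)

lemma logistic_deriv_pos: "\<theta> > 0 \<Longrightarrow> 0 < logistic_deriv \<theta> xs x"
  using logistic_pos[of \<theta> xs x] logistic_less_1[of \<theta> xs x] by (simp add: logistic_deriv_def)

text \<open>Completing the square shows the unimodality at once: the maximum
  \<open>\<theta> / 4\<close> is attained only where the logistic function is \<open>1/2\<close>,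
  and monotonicity on either side of \<open>xs\<close> is that of the square.\<close>

lemma logistic_deriv_eq: "logistic_deriv \<theta> xs x = \<theta> / 4 - \<theta> * (logistic \<theta> xs x - 1/2)\<^sup>2"
  by (simp add: logistic_deriv_def power2_eq_square algebra_simps)

lemma logistic_deriv_le: "\<theta> > 0 \<Longrightarrow> logistic_deriv \<theta> xs x \<le> \<theta> / 4"
  by (simp add: logistic_deriv_eq)

lemma logistic_deriv_eq_max_imp:
  assumes "\<theta> > 0" "logistic_deriv \<theta> xs x \<ge> \<theta> / 4" shows "x = xs"
proof -
  have "\<theta> * (logistic \<theta> xs x - 1/2)\<^sup>2 \<le> 0" using assms by (simp add: logistic_deriv_eq)
  then have "logistic \<theta> xs x = logistic \<theta> xs xs"
    using assms by (simp add: mult_le_0_iff logistic_center)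
  then show ?thesis using logistic_strict_mono[OF assms(1)] by (metis linorder_neqE less_irrefl)
qed

lemma logistic_deriv_increasing:
  assumes "\<theta> > 0" "x < y" "y \<le> xs" shows "logistic_deriv \<theta> xs x < logistic_deriv \<theta> xs y"
proof -
  have "logistic \<theta> xs x < logistic \<theta> xs y" "logistic \<theta> xs y \<le> 1/2"
    using assms logistic_strict_mono[OF assms(1), of x y xs] logistic_strict_mono[OF assms(1), of y xs xs]
      logistic_center[of \<theta> xs] by (cases "y = xs"; simp)+
  then have "(1/2 - logistic \<theta> xs y)\<^sup>2 < (1/2 - logistic \<theta> xs x)\<^sup>2"
    by (intro power_strict_mono) auto
  then show ?thesis using assms(1) by (simp add: logistic_deriv_eq power2_commute)
qed

lemma logistic_deriv_decreasing:
  assumes "\<theta> > 0" "x < y" "xs \<le> x" shows "logistic_deriv \<theta> xs y < logistic_deriv \<theta> xs x"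
proof -
  have "logistic \<theta> xs x < logistic \<theta> xs y" "logistic \<theta> xs x \<ge> 1/2"
    using assms logistic_strict_mono[OF assms(1), of x y xs] logistic_strict_mono[OF assms(1), of xs x xs]
      logistic_center[of \<theta> xs] by (cases "x = xs"; simp)+
  then have "(logistic \<theta> xs x - 1/2)\<^sup>2 < (logistic \<theta> xs y - 1/2)\<^sup>2"
    by (intro power_strict_mono) auto
  then show ?thesis using assms(1) by (simp add: logistic_deriv_eq)
qed

lemma logistic_Lipschitz:
  assumes "\<theta> > 0" shows "\<bar>logistic \<theta> xs x - logistic \<theta> xs y\<bar> \<le> \<theta> / 4 * \<bar>x - y\<bar>"
proof -
  have "norm (logistic \<theta> xs x - logistic \<theta> xs y) \<le> \<theta> / 4 * norm (x - y)"
  proof (rule field_differentiable_bound[of UNIV])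
    show "norm (logistic_deriv \<theta> xs z) \<le> \<theta> / 4" for z
      using logistic_deriv_pos[OF assms, of xs z] logistic_deriv_le[OF assms, of xs z] by simp
  qed (auto intro: has_real_derivative_logistic)
  then show ?thesis by simp
qed

text \<open>The softplus function, shifted and scaled: an antiderivative of the logistic function,
  needed for the potential of the drift.\<close>

definition logistic_primitive :: "real \<Rightarrow> real \<Rightarrow> real \<Rightarrow> real" where
  "logistic_primitive \<theta> xs x = ln (1 + exp (\<theta> * (x - xs))) / \<theta>"

lemma has_real_derivative_logistic_primitive:
  assumes "\<theta> > 0"
  shows "(logistic_primitive \<theta> xs has_real_derivative logistic \<theta> xs x) (at x within S)"
proof -
  have pos: "1 + exp (\<theta> * (x - xs)) > 0" by (simp add: add_pos_pos)
  have "((\<lambda>x. ln (1 + exp (\<theta> * (x - xs))) / \<theta>) has_real_derivative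
      exp (\<theta> * (x - xs)) / (1 + exp (\<theta> * (x - xs)))) (at x within S)"
    using assms pos by (auto intro!: derivative_eq_intros)
  moreover have "exp (\<theta> * (x - xs)) / (1 + exp (\<theta> * (x - xs))) = logistic \<theta> xs x"
  proof -
    have "exp (- \<theta> * (x - xs)) = 1 / exp (\<theta> * (x - xs))" by (simp add: exp_minus divide_inverse)
    moreover have "e / (1 + e) = 1 / (1 + 1 / e)" if "e > 0" for e :: real
      using that by (simp add: field_simps)
    ultimately show ?thesis by (simp add: logistic_def)
  qed
  ultimately show ?thesis by (simp add: logistic_primitive_def[abs_def])
qed

text \<open>The second derivative \<open>logistic_deriv\<close> is positive. Convexity makes the
  second-order remainder of the potential one-sided, with a bound free of
  \<open>\<theta>\<close>.\<close>

lemma logistic_primitive_above_tangent: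
  assumes "\<theta> > 0"
  shows "logistic_primitive \<theta> xs x + logistic \<theta> xs x * (y - x) \<le> logistic_primitive \<theta> xs y"
proof -
  have "convex_on UNIV (logistic_primitive \<theta> xs)"
  proof (rule f''_ge0_imp_convex)
    show "0 \<le> logistic_deriv \<theta> xs z" for z using logistic_deriv_pos[OF assms, of xs z] by simp
  qed (auto intro: has_real_derivative_logistic has_real_derivative_logistic_primitive[OF assms])
  from convex_on_imp_above_tangent[OF this, of x y] show ?thesis
    using has_real_derivative_logistic_primitive[OF assms] by (fastforce simp: algebra_simps)
qed

section \<open>Zeros of the scalar equilibrium equations\<close>

text \<open>Here \<open>s\<close> stands for \<open>1 - \<alpha> - \<beta>\<close>. Slope
  \<open>a\<close> and offset \<open>c\<close> of the line stay free in most lemmas: a coordinate of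
  a zero leads to \<open>a = 1\<close>, a synchronized zero to
  \<open>a = 1 - \<alpha>\<close>.\<close>

locale logistic_equation =
  fixes \<theta> xs s :: real
  assumes \<theta>: "\<theta> > 0" and s: "0 < s" "s < 1"
begin

abbreviation "lf \<equiv> logistic \<theta> xs"
abbreviation "lf' \<equiv> logistic_deriv \<theta> xs"

lemma mvt:
  assumes "x < y"
  obtains t where "x < t" "t < y" "s * lf y - a * y - (s * lf x - a * x) = (y - x) * (s * lf' t - a)"
proof -
  have "\<exists>t>x. t < y \<and> (s * lf y - a * y) - (s * lf x - a * x) = (y - x) * (s * lf' t - a)"
    by (rule MVT2[OF assms]) (auto intro!: derivative_eq_intros has_real_derivative_logistic)
  then show thesis using that by blast
qed

lemma rolle:
  assumes "x < y" "s * lf x + c = a * x" "s * lf y + c = a * y"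
  obtains t where "x < t" "t < y" "s * lf' t = a"
proof -
  obtain t where t: "x < t" "t < y" "s * lf y - a * y - (s * lf x - a * x) = (y - x) * (s * lf' t - a)"
    using mvt[OF \<open>x < y\<close>] by blast
  have "s * lf y - a * y - (s * lf x - a * x) = 0" using assms by linarith
  then have "s * lf' t = a" using t \<open>x < y\<close> by simp
  then show thesis using that t by blast
qed

text \<open>Rolle gives critical points on both sides of the middle zero, and \<open>lf'\<close> is unimodal.\<close>

lemma middle_zero_unstable:
  assumes "x < y" "y < z" and
    eq: "s * lf x + c = a * x" "s * lf y + c = a * y" "s * lf z + c = a * z"
  shows "s * lf' y > a"
proof -
  obtain t where t: "x < t" "t < y" "s * lf' t = a" using rolle[OF \<open>x < y\<close> eq(1,2)] by blast
  obtain u where u: "y < u" "u < z" "s * lf' u = a" using rolle[OF \<open>y < z\<close> eq(2,3)] by blast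
  show ?thesis
  proof (cases "y \<le> xs")
    case True
    then show ?thesis using logistic_deriv_increasing[OF \<theta> t(2)] t s by force
  next
    case False
    then show ?thesis using logistic_deriv_decreasing[OF \<theta> u(1)] u s by force
  qed
qed

lemma slope_neg: "0 < d \<Longrightarrow> d * (s * lf' t - 1) < 0 \<Longrightarrow> lf' t < 1 / s"
  using s by (simp add: mult_less_0_iff pos_less_divide_eq mult.commute)

lemma slope_pos: "0 < d \<Longrightarrow> 0 < d * (s * lf' t - 1) \<Longrightarrow> 1 / s < lf' t"
  using s by (simp add: zero_less_mult_iff pos_divide_less_eq mult.commute)

text \<open>On either side of \<open>xs\<close> the derivative is injective, while three zeros there
  would by Rolle give two distinct points where \<open>s * lf'\<close> equals
  \<open>a\<close>.\<close>

lemma finite_zeros: "finite {x. s * lf x + c = a * x}"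
proof -
  have "finite ({x. s * lf x + c = a * x} \<inter> A)" if A: "A = {..xs} \<or> A = {xs..}" for A
  proof (rule conjunct1[OF card_le_2_if_no_increasing_triple])
    fix x y z assume *: "x \<in> {x. s * lf x + c = a * x} \<inter> A" "y \<in> {x. s * lf x + c = a * x} \<inter> A"
      "z \<in> {x. s * lf x + c = a * x} \<inter> A" "x < y" "y < z"
    obtain t where t: "x < t" "t < y" "s * lf' t = a" using rolle[OF \<open>x < y\<close>] * by blast
    obtain u where u: "y < u" "u < z" "s * lf' u = a" using rolle[OF \<open>y < z\<close>] * by blast
    have "lf' t = lf' u" using t u s by auto
    with A show False
      using logistic_deriv_increasing[OF \<theta>, of t u xs] logistic_deriv_decreasing[OF \<theta>, of t u xs] t u * by auto
  qed
  then have "finite ({x. s * lf x + c = a * x} \<inter> {..xs} \<union> {x. s * lf x + c = a * x} \<inter> {xs..})"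
    by auto
  moreover have "{x. s * lf x + c = a * x} \<subseteq>
      {x. s * lf x + c = a * x} \<inter> {..xs} \<union> {x. s * lf x + c = a * x} \<inter> {xs..}" by auto
  ultimately show ?thesis by (rule finite_subset[rotated])
qed

text \<open>Let \<open>g t = s * lf t + c - t\<close>. The range of \<open>c\<close> forces
  \<open>g 0 > 0\<close> and \<open>g 1 < 0\<close>, so two zeros \<open>x < y\<close> produce
  points \<open>u < x < t < y < w\<close> at which the slope of \<open>g\<close> is negative, zero
  and negative in turn for \<open>u\<close>, \<open>t\<close> and \<open>w\<close>. As
  \<open>lf'\<close> is unimodal, each alternative of \<open>cond\<close> contradicts this
  pattern.\<close>

lemma unique_zero:
  assumes xy: "x \<in> {0..1}" "y \<in> {0..1}" "s * lf x + c = x" "s * lf y + c = y"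
    and c: "0 < c" "c \<le> 1 - s"
    and cond: "\<theta> / 4 \<le> 1 / s \<or> lf' 0 \<ge> 1 / s \<or> lf' 1 \<ge> 1 / s \<or>
      (\<exists>x1 x2. x1 < xs \<and> xs < x2 \<and> lf' x1 = 1 / s \<and> lf' x2 = 1 / s \<and>
        (lf x1 \<ge> x1 / s \<or> s * lf x2 + c < x2))"
  shows "x = y"
proof -
  have False if "x < y" "x \<in> {0..1}" "y \<in> {0..1}" "s * lf x + c = x" "s * lf y + c = y" for x y
  proof -
    have "0 < s * lf 0" using s logistic_pos by simp
    have "0 < x" using that c s logistic_pos[of \<theta> xs x] by (smt (verit) mult_pos_pos)
    have "s * lf 1 < s" using s logistic_less_1[of \<theta> xs 1] by simp
    have "s * lf y < s" using s logistic_less_1[of \<theta> xs y] by simp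
    then have "y < 1" using that c by simp
    obtain u where u: "0 < u" "u < x" "s * lf x - 1 * x - (s * lf 0 - 1 * 0) = (x - 0) * (s * lf' u - 1)"
      using mvt[OF \<open>0 < x\<close>] by blast
    obtain w where w: "y < w" "w < 1" "s * lf 1 - 1 * 1 - (s * lf y - 1 * y) = (1 - y) * (s * lf' w - 1)"
      using mvt[OF \<open>y < 1\<close>] by blast
    have eqs: "s * lf x + c = 1 * x" "s * lf y + c = 1 * y" using that by simp_all
    obtain t where t: "x < t" "t < y" "s * lf' t = 1" using rolle[OF \<open>x < y\<close> eqs] by blast
    have "x * (s * lf' u - 1) < 0" using u that c \<open>0 < s * lf 0\<close> by simp
    then have u': "lf' u < 1 / s" by (rule slope_neg[rotated]) (use \<open>0 < x\<close> in simp)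
    have "(1 - y) * (s * lf' w - 1) < 0" using w that c \<open>s * lf 1 < s\<close> by simp
    then have w': "lf' w < 1 / s" by (rule slope_neg[rotated]) (use \<open>y < 1\<close> in simp)
    have t': "lf' t = 1 / s" using t that s by (simp add: field_simps)
    note inc = logistic_deriv_increasing[OF \<theta>, of _ _ xs]
    note dec = logistic_deriv_decreasing[OF \<theta>, of _ _ xs]
    from cond consider "\<theta> / 4 \<le> 1 / s" | "lf' 0 \<ge> 1 / s" | "lf' 1 \<ge> 1 / s"
      | x1 x2 where "x1 < xs" "xs < x2" "lf' x1 = 1 / s" "lf' x2 = 1 / s" "lf x1 \<ge> x1 / s"
      | x1 x2 where "x1 < xs" "xs < x2" "lf' x1 = 1 / s" "lf' x2 = 1 / s" "s * lf x2 + c < x2"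
      by blast
    then show False
    proof cases
      case 1
      \<comment> \<open>The value \<open>1 / s\<close>, attained at \<open>t\<close>, must be the
        maximum of \<open>lf'\<close>. Then \<open>g\<close> is strictly decreasing on both sides of
        \<open>t\<close> and cannot vanish at both \<open>x\<close> and \<open>y\<close>.\<close>
      then have "t = xs" using t' by (intro logistic_deriv_eq_max_imp[OF \<theta>]) auto
      obtain t1 where t1: "x < t1" "t1 < t" "s * lf t - 1 * t - (s * lf x - 1 * x) = (t - x) * (s * lf' t1 - 1)"
        using mvt[OF t(1)] by blast
      obtain t2 where t2: "t < t2" "t2 < y" "s * lf y - 1 * y - (s * lf t - 1 * t) = (y - t) * (s * lf' t2 - 1)"
        using mvt[OF t(2)] by blast
      have "lf' t1 < 1 / s" "lf' t2 < 1 / s" using inc[of t1 t] dec[of t t2] t1 t2 t' \<open>t = xs\<close> by auto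
      then have "s * lf' t1 - 1 < 0" "s * lf' t2 - 1 < 0" using s by (simp_all add: field_simps)
      then have "(t - x) * (s * lf' t1 - 1) < 0" "(y - t) * (s * lf' t2 - 1) < 0"
        using t by (simp_all add: mult_less_0_iff)
      then show False using t1 t2 that by simp
    next
      case 2
      \<comment> \<open>Left of \<open>xs\<close> the derivative would exceed \<open>lf' 0\<close>.
        So \<open>u\<close> lies on the falling branch, and \<open>t\<close>, further right, has a
        still smaller derivative.\<close>
      then have "u > xs" using inc[of 0 u] u u' by force
      then show False using dec[of u t] u t u' t' by auto
    next
      case 3
      then have "w < xs" using dec[of w 1] w w' by force
      then show False using inc[of t w] w t w' t' by auto
    next
      case 4
      \<comment> \<open>\<open>x1\<close> is the minimum point of \<open>g\<close> on the half-line
        up to \<open>x2\<close>. As \<open>g x1 > 0\<close>, every zero lies beyond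
        \<open>x2\<close>, where \<open>lf'\<close> is below \<open>1 / s\<close>, and
        \<open>t\<close> has no place.\<close>
      have h1: "s * lf x1 + c > x1" using 4(5) c s by (simp add: field_simps)
      have "x > x2"
      proof (rule ccontr)
        assume "\<not> x > x2"
        consider "x < x1" | "x = x1" | "x1 < x" by linarith
        then show False
        proof cases
          case 1
          obtain v where v: "x < v" "v < x1" "s * lf x1 - 1 * x1 - (s * lf x - 1 * x) = (x1 - x) * (s * lf' v - 1)"
            using mvt[OF 1] by blast
          then have "(x1 - x) * (s * lf' v - 1) > 0" using h1 that by simp
          then have "lf' v > 1 / s" by (rule slope_pos[rotated]) (use 1 in simp)
          then show False using inc[of v x1] v 4 by auto
        next
          case 2
          then show False using h1 that by simp
        next
          case 3
          obtain v where v: "x1 < v" "v < x" "s * lf x - 1 * x - (s * lf x1 - 1 * x1) = (x - x1) * (s * lf' v - 1)"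
            using mvt[OF 3] by blast
          then have "(x - x1) * (s * lf' v - 1) < 0" using h1 that by simp
          then have "lf' v < 1 / s" by (rule slope_neg[rotated]) (use 3 in simp)
          then show False using inc[of x1 v] dec[of v x2] v 4 \<open>\<not> x > x2\<close> by force
        qed
      qed
      then show False using dec[of x2 t] 4 t t' by auto
    next
      case 5
      \<comment> \<open>Mirror image: \<open>x2\<close> is the maximum point of \<open>g\<close>
        from \<open>x1\<close> onwards and \<open>g x2 < 0\<close>, so every zero lies left of
        \<open>x1\<close>.\<close>
      have "y < x1"
      proof (rule ccontr)
        assume "\<not> y < x1"
        consider "y < x2" | "y = x2" | "x2 < y" by linarith
        then show False
        proof cases
          case 1
          obtain v where v: "y < v" "v < x2" "s * lf x2 - 1 * x2 - (s * lf y - 1 * y) = (x2 - y) * (s * lf' v - 1)"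
            using mvt[OF 1] by blast
          then have "(x2 - y) * (s * lf' v - 1) < 0" using 5 that by simp
          then have "lf' v < 1 / s" by (rule slope_neg[rotated]) (use 1 in simp)
          then show False using inc[of x1 v] dec[of v x2] v 5 \<open>\<not> y < x1\<close> by force
        next
          case 2
          then show False using 5 that by simp
        next
          case 3
          obtain v where v: "x2 < v" "v < y" "s * lf y - 1 * y - (s * lf x2 - 1 * x2) = (y - x2) * (s * lf' v - 1)"
            using mvt[OF 3] by blast
          then have "(y - x2) * (s * lf' v - 1) > 0" using 5 that by simp
          then have "lf' v > 1 / s" by (rule slope_pos[rotated]) (use 3 in simp)
          then show False using dec[of x2 v] v 5 by auto
        qed
      qed
      then show False using inc[of t x1] 5 t t' by auto
    qed
  qed
  from this[of x y] this[of y x] xy show ?thesis by force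
qed

end

section \<open>Monotone coupling of expanding chains\<close>

text \<open>The law of the random set of successes among independent Bernoulli variables with
  parameters \<open>p h\<close>. The index set is a parameter so that coordinates can be split off
  by induction.\<close>

definition bernoulli_weight :: "'n set \<Rightarrow> ('n \<Rightarrow> real) \<Rightarrow> 'n set \<Rightarrow> real" where
  "bernoulli_weight A p S = (\<Prod>h\<in>S. p h) * (\<Prod>h\<in>A - S. 1 - p h)"

definition bernoulli_expectation :: "'n set \<Rightarrow> ('n \<Rightarrow> real) \<Rightarrow> ('n set \<Rightarrow> real) \<Rightarrow> real" where
  "bernoulli_expectation A p g = (\<Sum>S\<in>Pow A. bernoulli_weight A p S * g S)"

lemma bernoulli_expectation_insert:
  assumes "finite A" "h \<notin> A"
  shows "bernoulli_expectation (insert h A) p g =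
    p h * bernoulli_expectation A p (\<lambda>S. g (insert h S)) + (1 - p h) * bernoulli_expectation A p g"
proof -
  have in_S: "bernoulli_weight (insert h A) p (insert h S) = p h * bernoulli_weight A p S" if "S \<subseteq> A" for S
  proof -
    have "h \<notin> S" "finite S" "insert h A - insert h S = A - S"
      using that assms finite_subset by auto
    then show ?thesis by (simp add: bernoulli_weight_def)
  qed
  have out_S: "bernoulli_weight (insert h A) p S = (1 - p h) * bernoulli_weight A p S" if "S \<subseteq> A" for S
  proof -
    have "insert h A - S = insert h (A - S)" "h \<notin> A - S" "finite (A - S)" using that assms by auto
    then show ?thesis by (simp add: bernoulli_weight_def)
  qed
  have "inj_on (insert h) (Pow A)" using assms(2) by (auto simp: inj_on_def)
  then have eq: "bernoulli_expectation (insert h A) p g =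
      (\<Sum>S\<in>Pow A. bernoulli_weight (insert h A) p S * g S)
      + (\<Sum>S\<in>Pow A. bernoulli_weight (insert h A) p (insert h S) * g (insert h S))"
    unfolding bernoulli_expectation_def Pow_insert using assms
    by (subst sum.union_disjoint) (auto simp: sum.reindex)
  show ?thesis
    unfolding eq by (simp add: bernoulli_expectation_def in_S out_S sum_distrib_left mult.assoc)
qed

lemma bernoulli_weight_nonneg:
  assumes "\<And>h. h \<in> A \<Longrightarrow> 0 \<le> p h" "\<And>h. h \<in> A \<Longrightarrow> p h \<le> 1" "S \<subseteq> A"
  shows "0 \<le> bernoulli_weight A p S"
  unfolding bernoulli_weight_def using assms by (intro mult_nonneg_nonneg prod_nonneg) auto

lemma sum_bernoulli_weight:
  assumes "finite A" shows "(\<Sum>S\<in>Pow A. bernoulli_weight A p S) = 1"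
proof -
  have "bernoulli_expectation A p (\<lambda>_. 1) = 1"
    using assms
  proof (induction A rule: finite_induct)
    case empty
    then show ?case by (simp add: bernoulli_expectation_def bernoulli_weight_def)
  qed (simp add: bernoulli_expectation_insert)
  then show ?thesis by (simp add: bernoulli_expectation_def)
qed

lemma bernoulli_expectation_nonneg:
  assumes "\<And>h. h \<in> A \<Longrightarrow> 0 \<le> p h" "\<And>h. h \<in> A \<Longrightarrow> p h \<le> 1" "\<And>S. S \<subseteq> A \<Longrightarrow> 0 \<le> g S"
  shows "0 \<le> bernoulli_expectation A p g"
  unfolding bernoulli_expectation_def
  using bernoulli_weight_nonneg[of A p] assms by (intro sum_nonneg mult_nonneg_nonneg) auto

lemma bernoulli_expectation_le_1:
  assumes "finite A" "\<And>h. h \<in> A \<Longrightarrow> 0 \<le> p h" "\<And>h. h \<in> A \<Longrightarrow> p h \<le> 1" "\<And>S. S \<subseteq> A \<Longrightarrow> g S \<le> 1"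
  shows "bernoulli_expectation A p g \<le> 1"
proof -
  have "bernoulli_expectation A p g \<le> (\<Sum>S\<in>Pow A. bernoulli_weight A p S * 1)"
    unfolding bernoulli_expectation_def
    using bernoulli_weight_nonneg[of A p] assms by (intro sum_mono mult_left_mono) auto
  then show ?thesis using sum_bernoulli_weight[OF assms(1)] by simp
qed

text \<open>The induction splits off one coordinate and couples its two Bernoulli variables
  monotonically: both are 1 with probability \<open>p h\<close>, only the second with probability \<open>p' h - p h\<close>.\<close>

lemma bernoulli_expectation_monotone_coupling:
  assumes "finite A" "\<And>h. h \<in> A \<Longrightarrow> 0 \<le> p h" "\<And>h. h \<in> A \<Longrightarrow> p h \<le> p' h" "\<And>h. h \<in> A \<Longrightarrow> p' h \<le> 1"
    and "\<And>S S'. \<lbrakk>S \<subseteq> S'; S' \<subseteq> A\<rbrakk> \<Longrightarrow> g S + g' S' \<le> 1 + e * exp (- a * real (card (S' - S)))"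
  shows "bernoulli_expectation A p g + bernoulli_expectation A p' g'
    \<le> 1 + e * (\<Prod>h\<in>A. 1 - (p' h - p h) * (1 - exp (- a)))"
  using assms
proof (induction A arbitrary: g g' e rule: finite_induct)
  case empty
  then show ?case by (simp add: bernoulli_expectation_def bernoulli_weight_def)
next
  case (insert h A)
  define Q where "Q = (\<Prod>h\<in>A. 1 - (p' h - p h) * (1 - exp (- a)))"
  let ?E = "bernoulli_expectation A p" and ?E' = "bernoulli_expectation A p'"
  have 1: "?E (\<lambda>S. g (insert h S)) + ?E' (\<lambda>S. g' (insert h S)) \<le> 1 + e * Q"
    unfolding Q_def
  proof (rule insert.IH)
    fix S S' assume *: "S \<subseteq> S'" "S' \<subseteq> A"
    then have "insert h S' - insert h S = S' - S" using insert.hyps by auto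
    then show "g (insert h S) + g' (insert h S') \<le> 1 + e * exp (- a * real (card (S' - S)))"
      using insert.prems(4)[of "insert h S" "insert h S'"] * by auto
  qed (use insert.prems in auto)
  \<comment> \<open>Only the second copy succeeds at \<open>h\<close>. The discordance grows by one,
    and the extra factor \<open>exp (- a)\<close> is absorbed into the constant, which is why
    \<open>e\<close> is generalized in the induction.\<close>
  have 2: "?E g + ?E' (\<lambda>S. g' (insert h S)) \<le> 1 + (e * exp (- a)) * Q"
    unfolding Q_def
  proof (rule insert.IH)
    fix S S' assume *: "S \<subseteq> S'" "S' \<subseteq> A"
    then have "insert h S' - S = insert h (S' - S)" "h \<notin> S' - S" "finite (S' - S)"
      using insert.hyps by (auto intro: rev_finite_subset)
    then have "real (card (insert h S' - S)) = 1 + real (card (S' - S))" by simp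
    then have "exp (- a * real (card (insert h S' - S))) = exp (- a) * exp (- a * real (card (S' - S)))"
      by (simp add: exp_add[symmetric] algebra_simps)
    then show "g S + g' (insert h S') \<le> 1 + e * exp (- a) * exp (- a * real (card (S' - S)))"
      using insert.prems(4)[of S "insert h S'"] * by (auto simp: mult.assoc)
  qed (use insert.prems in auto)
  have 3: "?E g + ?E' g' \<le> 1 + e * Q"
    unfolding Q_def
  proof (rule insert.IH)
    fix S S' assume "S \<subseteq> S'" "S' \<subseteq> A"
    then show "g S + g' S' \<le> 1 + e * exp (- a * real (card (S' - S)))"
      by (intro insert.prems(4)) auto
  qed (use insert.prems in auto)
  have "bernoulli_expectation (insert h A) p g + bernoulli_expectation (insert h A) p' g'
     = p h * (?E (\<lambda>S. g (insert h S)) + ?E' (\<lambda>S. g' (insert h S)))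
     + (p' h - p h) * (?E g + ?E' (\<lambda>S. g' (insert h S))) + (1 - p' h) * (?E g + ?E' g')"
    using insert.hyps by (simp add: bernoulli_expectation_insert algebra_simps)
  also have "\<dots> \<le> p h * (1 + e * Q) + (p' h - p h) * (1 + (e * exp (- a)) * Q) + (1 - p' h) * (1 + e * Q)"
    by (intro add_mono mult_left_mono 1 2 3) (use insert.prems in auto)
  also have "\<dots> = 1 + e * ((1 - (p' h - p h) * (1 - exp (- a))) * Q)"
    by (simp add: algebra_simps)
  finally show ?case using insert.hyps by (simp add: Q_def)
qed

section \<open>Probabilities of staying in a set\<close>

definition after_step :: "real \<Rightarrow> real ^ 'n \<Rightarrow> 'n set \<Rightarrow> real ^ 'n" where
  "after_step \<rho> z S = (\<chi> h. (1 - \<rho>) * z $ h + \<rho> * indicator S h)"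

text \<open>The probability that the chain with step sizes \<open>r\<close> and success probabilities \<open>P\<close> which is
  at \<open>z\<close> at time \<open>n\<close> is in \<open>B\<close> at all times from \<open>n\<close> to \<open>n + j\<close>.\<close>

primrec stay_prob :: "(real ^ 'n) set \<Rightarrow> (real ^ 'n \<Rightarrow> 'n \<Rightarrow> real) \<Rightarrow> (nat \<Rightarrow> real) \<Rightarrow>
    nat \<Rightarrow> nat \<Rightarrow> real ^ 'n \<Rightarrow> real" where
  "stay_prob B P r 0 n z = indicator B z"
| "stay_prob B P r (Suc j) n z = indicator B z *
    bernoulli_expectation UNIV (P z) (\<lambda>S. stay_prob B P r j (Suc n) (after_step (r n) z S))"

lemma stay_prob_outside: "z \<notin> B \<Longrightarrow> stay_prob B P r j n z = 0"
  by (cases j) auto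

lemma borel_measurable_after_step:
  "(\<lambda>z. after_step \<rho> z S) \<in> borel_measurable borel"
  unfolding after_step_def
  by (intro borel_measurable_continuous_onI continuous_on_vec_lambda continuous_intros)

lemma borel_measurable_stay_prob:
  assumes "B \<in> sets borel" "\<And>h. (\<lambda>z. P z h) \<in> borel_measurable borel"
  shows "stay_prob B P r j n \<in> borel_measurable borel"
proof (induction j arbitrary: n)
  case 0
  show ?case using assms(1) by simp
next
  case (Suc j)
  have "(\<lambda>z. stay_prob B P r j (Suc n) (after_step (r n) z S)) \<in> borel_measurable borel" for S
    using measurable_compose[OF borel_measurable_after_step Suc.IH] .
  then show ?case using assms
    by (simp add: bernoulli_expectation_def bernoulli_weight_def[abs_def])
qed

text \<open>What holds near an unstable equilibrium. With \<open>W\<close> the total distance of an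
  ordered pair, its conditional mean after one step is \<open>(1 - r n) * W\<close> plus
  \<open>r n\<close> times the sum in \<open>expand\<close>, hence at least
  \<open>(1 + lam * r n) * W\<close>. The constant \<open>\<delta>\<close> gives every outcome of a
  step a probability bounded below.\<close>

locale expanding_kernel =
  fixes B :: "(real ^ 'n) set" and P :: "real ^ 'n \<Rightarrow> 'n \<Rightarrow> real" and r :: "nat \<Rightarrow> real"
    and lam D \<delta> :: real
  assumes r: "\<And>n. 0 \<le> r n" "\<And>n. r n \<le> 1" and lam: "0 < lam"
    and \<delta>: "0 < \<delta>" "\<And>z h. z \<in> B \<Longrightarrow> \<delta> \<le> P z h" "\<And>z h. z \<in> B \<Longrightarrow> P z h \<le> 1 - \<delta>"
    and mono: "\<And>z z' h. \<lbrakk>z \<in> B; z' \<in> B; \<And>i. z $ i \<le> z' $ i\<rbrakk> \<Longrightarrow> P z h \<le> P z' h"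
    and expand: "\<And>z z'. \<lbrakk>z \<in> B; z' \<in> B; \<And>i. z $ i \<le> z' $ i\<rbrakk> \<Longrightarrow>
      (1 + lam) * (\<Sum>h\<in>UNIV. z' $ h - z $ h) \<le> (\<Sum>h\<in>UNIV. P z' h - P z h)"
    and diam: "\<And>z z'. \<lbrakk>z \<in> B; z' \<in> B; \<And>i. z $ i \<le> z' $ i\<rbrakk> \<Longrightarrow> (\<Sum>h\<in>UNIV. z' $ h - z $ h) \<le> D"
begin

lemma P_01: assumes "z \<in> B" shows "0 \<le> P z h" "P z h \<le> 1"
  using \<delta>(1) \<delta>(2,3)[OF assms, of h] by auto

lemma stay_prob_nonneg: "0 \<le> stay_prob B P r j n z"
proof (induction j arbitrary: n z)
  case (Suc j)
  then show ?case by (cases "z \<in> B") (auto intro!: bernoulli_expectation_nonneg P_01)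
qed simp

lemma stay_prob_le_1: "stay_prob B P r j n z \<le> 1"
proof (induction j arbitrary: n z)
  case (Suc j)
  then show ?case by (cases "z \<in> B") (auto intro!: bernoulli_expectation_le_1 P_01)
qed (auto simp: indicator_def)

text \<open>\<open>exp (- \<gamma> * W)\<close> is a supersolution for the distance \<open>W\<close> of two monotonically coupled
  chains as long as both are in \<open>B\<close>, provided \<open>\<gamma>\<close> is divided by \<open>1 + lam / 2 * r n\<close> in every step.\<close>

lemma stay_prob_pair:
  assumes "\<And>i. z $ i \<le> z' $ i" "0 \<le> \<gamma>" "\<And>k. k \<ge> n \<Longrightarrow> \<gamma> * r k \<le> lam / (2 * (1 + lam))"
  shows "stay_prob B P r j n z + stay_prob B P r j n z' \<le>
    1 + exp (D * \<gamma> / (\<Prod>k<j. 1 + lam / 2 * r (n + k)) - \<gamma> * (\<Sum>h\<in>UNIV. z' $ h - z $ h))"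
  using assms
proof (induction j arbitrary: n z z' \<gamma>)
  case 0
  show ?case
  proof (cases "z \<in> B \<and> z' \<in> B")
    case True
    \<comment> \<open>The term with \<open>D\<close> exists for this case: with both points in
      \<open>B\<close> the left side is 2, and the exponent has to be nonnegative.\<close>
    then have "\<gamma> * (\<Sum>h\<in>UNIV. z' $ h - z $ h) \<le> \<gamma> * D" using diam 0 by (intro mult_left_mono) auto
    then show ?thesis using True by (simp add: mult.commute)
  next
    case False
    then show ?thesis by (auto simp: indicator_def add_increasing2)
  qed
next
  case (Suc j)
  show ?case
  proof (cases "z \<in> B \<and> z' \<in> B")
    case False
    then show ?thesis
      using stay_prob_outside[of z B P r "Suc j" n] stay_prob_outside[of z' B P r "Suc j" n]
        stay_prob_le_1[of "Suc j" n z] stay_prob_le_1[of "Suc j" n z']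
      by (auto simp del: stay_prob.simps simp: add_increasing2)
  next
    case True
    define W where "W = (\<Sum>h\<in>UNIV. z' $ h - z $ h)"
    define u where "u = 1 + lam / 2 * r n"
    define \<gamma>' where "\<gamma>' = \<gamma> / u"
    define a where "a = \<gamma>' * r n"
    define pr where "pr = (\<Prod>k<j. 1 + lam / 2 * r (Suc n + k))"
    \<comment> \<open>The exponential bound at time \<open>Suc n\<close> if no coordinate is
      discordant. Each discordant coordinate adds \<open>r n\<close> to the distance and thus
      contributes a factor \<open>exp (- a)\<close>, the form required by the coupling
      lemma.\<close>
    define e where "e = exp (D * \<gamma>' / pr - \<gamma>' * (1 - r n) * W)"
    have W: "0 \<le> W" unfolding W_def using Suc.prems(1) by (intro sum_nonneg) auto
    have u: "1 \<le> u" using lam r[of n] by (simp add: u_def)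
    have \<gamma>': "0 \<le> \<gamma>'" "\<gamma>' \<le> \<gamma>" using Suc.prems(2) u by (auto simp: \<gamma>'_def divide_le_eq mult_le_cancel_left1)
    have \<gamma>'r: "\<gamma>' * r k \<le> lam / (2 * (1 + lam))" if "k \<ge> n" for k
      using Suc.prems(3)[OF that] mult_right_mono[OF \<gamma>'(2) r(1)[of k]] by linarith
    have a: "0 \<le> a" "a \<le> lam / (2 * (1 + lam))" using \<gamma>' r \<gamma>'r[of n] by (auto simp: a_def)
    have prod_eq: "(\<Prod>k<Suc j. 1 + lam / 2 * r (n + k)) = u * pr"
      unfolding u_def pr_def prod.lessThan_Suc_shift by simp
    have W_next: "(\<Sum>h\<in>UNIV. after_step (r n) z' S' $ h - after_step (r n) z S $ h)
        = (1 - r n) * W + r n * real (card (S' - S))" if "S \<subseteq> S'" for S S'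
    proof -
      have "(\<Sum>h\<in>UNIV. after_step (r n) z' S' $ h - after_step (r n) z S $ h)
        = (\<Sum>h\<in>UNIV. (1 - r n) * (z' $ h - z $ h) + r n * indicator (S' - S) h)"
        using that by (intro sum.cong) (auto simp: after_step_def indicator_def algebra_simps)
      also have "\<dots> = (1 - r n) * W + r n * (\<Sum>h\<in>UNIV. indicator (S' - S) h)"
        by (simp add: sum.distrib sum_distrib_left W_def)
      also have "(\<Sum>h\<in>UNIV. indicator (S' - S) h :: real) = real (card (S' - S))"
        by (simp add: indicator_def sum.If_cases set_diff_eq)
      finally show ?thesis .
    qed
    have "bernoulli_expectation UNIV (P z) (\<lambda>S. stay_prob B P r j (Suc n) (after_step (r n) z S))
      + bernoulli_expectation UNIV (P z') (\<lambda>S. stay_prob B P r j (Suc n) (after_step (r n) z' S))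
      \<le> 1 + e * (\<Prod>h\<in>UNIV. 1 - (P z' h - P z h) * (1 - exp (- a)))"
    proof (rule bernoulli_expectation_monotone_coupling)
      fix S S' :: "'n set" assume SS: "S \<subseteq> S'"
      have "stay_prob B P r j (Suc n) (after_step (r n) z S) + stay_prob B P r j (Suc n) (after_step (r n) z' S')
        \<le> 1 + exp (D * \<gamma>' / pr - \<gamma>' * ((1 - r n) * W + r n * real (card (S' - S))))"
        unfolding W_next[OF SS, symmetric] pr_def
      proof (rule Suc.IH)
        show "after_step (r n) z S $ i \<le> after_step (r n) z' S' $ i" for i
        proof -
          have "(1 - r n) * z $ i \<le> (1 - r n) * z' $ i" "r n * indicator S i \<le> r n * indicator S' i"
            using SS r[of n] Suc.prems(1) by (auto intro!: mult_left_mono simp: indicator_def)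
          then show ?thesis by (simp add: after_step_def)
        qed
      qed (use \<gamma>' \<gamma>'r in auto)
      also have "exp (D * \<gamma>' / pr - \<gamma>' * ((1 - r n) * W + r n * real (card (S' - S))))
        = e * exp (- a * real (card (S' - S)))"
        by (simp add: e_def a_def exp_add[symmetric] algebra_simps)
      finally show "stay_prob B P r j (Suc n) (after_step (r n) z S)
          + stay_prob B P r j (Suc n) (after_step (r n) z' S') \<le> 1 + e * exp (- a * real (card (S' - S)))" .
    qed (use True P_01 mono Suc.prems(1) in auto)
    also have "e * (\<Prod>h\<in>UNIV. 1 - (P z' h - P z h) * (1 - exp (- a)))
      \<le> exp (D * \<gamma> / (u * pr) - \<gamma> * W)"
    proof -
      define d where "d = 1 - exp (- a)"
      have d: "0 \<le> d" "d \<le> 1" "a * (1 - a) \<le> d"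
      proof -
        show "0 \<le> d" "d \<le> 1" using a by (auto simp: d_def)
        have "exp (- a) \<le> 1 / (1 + a)"
          using exp_ge_add_one_self[of a] a by (simp add: exp_minus field_simps)
        moreover have "1 / (1 + a) \<le> 1 - a * (1 - a)"
        proof -
          have "1 \<le> (1 - a * (1 - a)) * (1 + a)" using a by (simp add: algebra_simps)
          then show ?thesis using a by (simp add: divide_le_eq)
        qed
        ultimately show "a * (1 - a) \<le> d" by (simp add: d_def)
      qed
      have diff01: "0 \<le> P z' h - P z h" "P z' h - P z h \<le> 1" for h
        using mono[of z z' h] True Suc.prems(1) P_01[of z' h] P_01[of z h] by auto
      have "(\<Prod>h\<in>UNIV. 1 - (P z' h - P z h) * d) \<le> (\<Prod>h\<in>UNIV. exp (- ((P z' h - P z h) * d)))"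
      proof (intro prod_mono conjI)
        show "0 \<le> 1 - (P z' h - P z h) * d" for h
          using mult_mono[OF diff01(2)[of h] d(2)] diff01 d by auto
        show "1 - (P z' h - P z h) * d \<le> exp (- ((P z' h - P z h) * d))" for h
          using exp_ge_add_one_self[of "- ((P z' h - P z h) * d)"] by simp
      qed
      also have "\<dots> = exp (- ((\<Sum>h\<in>UNIV. P z' h - P z h) * d))"
        by (simp add: exp_sum[symmetric] sum_negf sum_distrib_right)
      also have "\<dots> \<le> exp (- (\<gamma> * W - \<gamma>' * (1 - r n) * W))"
      proof -
        \<comment> \<open>Origin of the threshold \<open>lam / (2 * (1 + lam))\<close>: the
          second-order loss \<open>a * a\<close> in \<open>1 - exp (- a)\<close> may consume half of
          the surplus \<open>lam\<close>. The other half pays for dividing \<open>\<gamma>\<close>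
          by \<open>u\<close>.\<close>
        have "(1 + lam) * a \<le> lam / 2" using a lam by (simp add: field_simps)
        then have "1 + lam / 2 \<le> (1 + lam) * (1 - a)" by (simp add: algebra_simps)
        then have "(a * W) * (1 + lam / 2) \<le> (a * W) * ((1 + lam) * (1 - a))"
          using a W by (intro mult_left_mono) auto
        also have "\<dots> = ((1 + lam) * W) * (a * (1 - a))" by (simp add: algebra_simps)
        also have "\<dots> \<le> ((1 + lam) * W) * d" using d lam W by (intro mult_left_mono) auto
        also have "\<dots> \<le> (\<Sum>h\<in>UNIV. P z' h - P z h) * d"
          unfolding W_def using expand True Suc.prems(1) d by (intro mult_right_mono) auto
        finally have "(a * W) * (1 + lam / 2) \<le> (\<Sum>h\<in>UNIV. P z' h - P z h) * d" .
        moreover have "\<gamma> = \<gamma>' * u" using u by (simp add: \<gamma>'_def)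
        then have "\<gamma> * W - \<gamma>' * (1 - r n) * W = (a * W) * (1 + lam / 2)"
          by (simp add: a_def u_def algebra_simps)
        ultimately show ?thesis by simp
      qed
      finally have "e * (\<Prod>h\<in>UNIV. 1 - (P z' h - P z h) * d) \<le> e * exp (- (\<gamma> * W - \<gamma>' * (1 - r n) * W))"
        by (intro mult_left_mono) (auto simp: e_def)
      also have "\<dots> = exp (D * \<gamma>' / pr - \<gamma> * W)"
        by (simp add: e_def exp_add[symmetric])
      also have "D * \<gamma>' / pr = D * \<gamma> / (u * pr)" by (simp add: \<gamma>'_def)
      finally show ?thesis by (simp add: d_def)
    qed
    finally show ?thesis unfolding prod_eq using True by (simp add: W_def)
  qed
qed

text \<open>The outcomes \<open>{}\<close> and \<open>UNIV\<close> each have weight at least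
  \<open>\<delta> ^ CARD('n)\<close>. For all other outcomes the staying probability is bounded by
  1.\<close>

lemma stay_prob_Suc_le:
  assumes "z \<in> B"
  shows "stay_prob B P r (Suc j) n z \<le> 1 - \<delta> ^ CARD('n) *
    (2 - stay_prob B P r j (Suc n) (after_step (r n) z {}) - stay_prob B P r j (Suc n) (after_step (r n) z UNIV))"
proof -
  define g where "g S = stay_prob B P r j (Suc n) (after_step (r n) z S)" for S
  define w where "w = bernoulli_weight UNIV (P z)"
  have w: "0 \<le> w S" for S unfolding w_def using P_01[OF assms] by (intro bernoulli_weight_nonneg) auto
  have g: "g S \<le> 1" for S by (simp add: g_def stay_prob_le_1)
  have "\<delta> ^ CARD('n) = (\<Prod>h\<in>(UNIV :: 'n set). \<delta>)" by simp
  also have "\<dots> \<le> (\<Prod>h\<in>(UNIV :: 'n set). P z h)"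
    using \<delta>(1) \<delta>(2)[OF assms] by (intro prod_mono conjI) auto
  also have "\<dots> = w UNIV" by (simp add: w_def bernoulli_weight_def)
  finally have wU: "\<delta> ^ CARD('n) \<le> w UNIV" .
  have "\<delta> ^ CARD('n) = (\<Prod>h\<in>(UNIV :: 'n set). \<delta>)" by simp
  also have "\<dots> \<le> (\<Prod>h\<in>(UNIV :: 'n set). 1 - P z h)"
  proof (intro prod_mono conjI)
    show "\<delta> \<le> 1 - P z h" for h using \<delta>(3)[OF assms, of h] by simp
  qed (use \<delta>(1) in auto)
  also have "\<dots> = w {}" by (simp add: w_def bernoulli_weight_def)
  finally have w0: "\<delta> ^ CARD('n) \<le> w {}" .
  have "\<delta> ^ CARD('n) * (2 - g {} - g UNIV) = \<delta> ^ CARD('n) * (1 - g {}) + \<delta> ^ CARD('n) * (1 - g UNIV)"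
    by (simp add: algebra_simps)
  also have "\<dots> \<le> w {} * (1 - g {}) + w UNIV * (1 - g UNIV)"
    using w0 wU g by (intro add_mono mult_right_mono) auto
  also have "\<dots> = (\<Sum>S\<in>{{}, UNIV}. w S * (1 - g S))"
    using UNIV_not_empty by (subst sum.insert) auto
  also have "\<dots> \<le> (\<Sum>S\<in>Pow UNIV. w S * (1 - g S))"
    using w g by (intro sum_mono2) auto
  also have "\<dots> = 1 - bernoulli_expectation UNIV (P z) g"
    using sum_bernoulli_weight[of "UNIV :: 'n set" "P z"]
    by (simp add: bernoulli_expectation_def w_def right_diff_distrib sum_subtractf)
  finally show ?thesis using assms by (simp add: g_def[abs_def])
qed

text \<open>The first step separates the outcomes \<open>{}\<close> and \<open>UNIV\<close>; for the
  remaining \<open>j\<close> steps \<open>stay_prob_pair\<close> keeps the sum of the two staying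
  probabilities below 2 by a fixed amount. Only the horizon depends on \<open>n\<close>, not the
  gain.\<close>

lemma uniform_exit:
  assumes r_div: "\<not> summable r"
    and n0: "n0 \<ge> 1" "\<And>n. n \<ge> n0 \<Longrightarrow> 1 / (2 * real n) \<le> r n \<and> r n \<le> 2 / real n"
  shows "\<exists>\<eta>>0. \<forall>n\<ge>n0. \<exists>j. \<forall>z. stay_prob B P r j n z \<le> 1 - \<eta>"
proof -
  define x where "x = lam / (2 * (1 + lam))"
  have x: "0 < x" using lam by (simp add: x_def)
  define \<eta>0 where "\<eta>0 = \<delta> ^ CARD('n) * (1 - exp (- x / 8))"
  \<comment> \<open>The minimum with 1 keeps \<open>1 - \<eta>\<close> nonnegative, as required for
    states outside \<open>B\<close>.\<close>
  define \<eta> where "\<eta> = min \<eta>0 1"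
  have "\<eta> > 0" using \<delta>(1) x by (simp add: \<eta>_def \<eta>0_def)
  moreover have "\<exists>j. \<forall>z. stay_prob B P r j n z \<le> 1 - \<eta>" if n: "n \<ge> n0" for n
  proof -
    \<comment> \<open>With \<open>r k \<le> 2 / k\<close> this keeps \<open>\<gamma> * r k\<close>
      below the threshold \<open>x\<close> from time \<open>Suc n\<close> on. With
      \<open>r n \<ge> 1 / (2 * n)\<close> it still makes \<open>\<gamma> * r n\<close> at least
      \<open>x / 4\<close>.\<close>
    define \<gamma> where "\<gamma> = x * real (Suc n) / 2"
    have \<gamma>: "0 < \<gamma>" using x by (simp add: \<gamma>_def)
    have \<gamma>r: "\<gamma> * r k \<le> x" if "k \<ge> Suc n" for k
    proof -
      have "\<gamma> * r k \<le> \<gamma> * (2 / real k)" using n0 n that \<gamma> by (intro mult_left_mono) auto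
      also have "\<dots> = x * (real (Suc n) / real k)" by (simp add: \<gamma>_def)
      also have "\<dots> \<le> x * 1" using that x by (intro mult_left_mono) (auto simp: divide_le_eq)
      finally show ?thesis by simp
    qed
    have sep: "x / 4 \<le> \<gamma> * r n"
    proof -
      have "x / 4 \<le> \<gamma> * (1 / (2 * real n))" using x n n0(1) by (simp add: \<gamma>_def field_simps)
      also have "\<dots> \<le> \<gamma> * r n" using n0(2)[OF n] \<gamma> by (intro mult_left_mono) auto
      finally show ?thesis .
    qed
    \<comment> \<open>The product dominates the sum of its increments, which diverges. The horizon
      is taken so long that the correction with \<open>D\<close> is at most \<open>x / 8\<close>,
      half of the separation \<open>x / 4\<close>.\<close>
    obtain j where j: "8 * \<bar>D\<bar> * \<gamma> / x \<le> (\<Prod>k<j. 1 + lam / 2 * r (Suc n + k))"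
    proof -
      have "\<not> summable (\<lambda>k. r (Suc n + k))"
        using r_div summable_iff_shift[of r "Suc n"] by (simp add: add.commute)
      then have "\<exists>j. C < (\<Sum>k<j. r (Suc n + k))" for C
        using summableI_nonneg_bounded[of "\<lambda>k. r (Suc n + k)" C] r(1) by (force simp: not_less)
      then obtain j where "(8 * \<bar>D\<bar> * \<gamma> / x) * (2 / lam) < (\<Sum>k<j. r (Suc n + k))" by blast
      then have "(8 * \<bar>D\<bar> * \<gamma> / x) * (2 / lam) * (lam / 2) < (\<Sum>k<j. r (Suc n + k)) * (lam / 2)"
        using lam by (intro mult_strict_right_mono) auto
      then have "8 * \<bar>D\<bar> * \<gamma> / x < (\<Sum>k<j. lam / 2 * r (Suc n + k))"
        using lam by (simp add: sum_distrib_left mult.commute)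
      also have "\<dots> \<le> (\<Prod>k<j. 1 + lam / 2 * r (Suc n + k))"
        using lam r by (intro sum_le_prod) auto
      finally show thesis by (intro that less_imp_le)
    qed
    have prod1: "1 \<le> (\<Prod>k<j. 1 + lam / 2 * r (Suc n + k))"
      using lam r by (intro prod_ge_1) auto
    have small: "D * \<gamma> / (\<Prod>k<j. 1 + lam / 2 * r (Suc n + k)) \<le> x / 8"
    proof -
      have "D * \<gamma> \<le> \<bar>D\<bar> * \<gamma>" using \<gamma> by (intro mult_right_mono) auto
      also have "\<dots> \<le> x / 8 * (\<Prod>k<j. 1 + lam / 2 * r (Suc n + k))"
        using j x by (simp add: field_simps)
      finally show ?thesis using prod1 by (simp add: divide_le_eq)
    qed
    have "stay_prob B P r (Suc j) n z \<le> 1 - \<eta>" for z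
    proof (cases "z \<in> B")
      case True
      let ?z0 = "after_step (r n) z {}" and ?z1 = "after_step (r n) z UNIV"
      have W: "(\<Sum>h\<in>UNIV. ?z1 $ h - ?z0 $ h) = real CARD('n) * r n"
        by (simp add: after_step_def)
      have "stay_prob B P r j (Suc n) ?z0 + stay_prob B P r j (Suc n) ?z1 \<le>
        1 + exp (D * \<gamma> / (\<Prod>k<j. 1 + lam / 2 * r (Suc n + k)) - \<gamma> * (\<Sum>h\<in>UNIV. ?z1 $ h - ?z0 $ h))"
      proof (rule stay_prob_pair)
        show "?z0 $ i \<le> ?z1 $ i" for i using r(1)[of n] by (simp add: after_step_def)
        show "\<gamma> * r k \<le> lam / (2 * (1 + lam))" if "k \<ge> Suc n" for k
          using \<gamma>r[OF that] by (simp add: x_def)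
      qed (use \<gamma> in auto)
      also have "D * \<gamma> / (\<Prod>k<j. 1 + lam / 2 * r (Suc n + k)) - \<gamma> * (\<Sum>h\<in>UNIV. ?z1 $ h - ?z0 $ h) \<le> - x / 8"
      proof -
        have "1 * (\<gamma> * r n) \<le> real CARD('n) * (\<gamma> * r n)"
          using \<gamma> r(1)[of n] by (intro mult_right_mono) (auto simp: Suc_leI)
        moreover have "real CARD('n) * (\<gamma> * r n) = \<gamma> * (real CARD('n) * r n)" by simp
          ultimately show ?thesis using small sep unfolding W by linarith
      qed
      finally have "\<delta> ^ CARD('n) * (1 - exp (- x / 8)) \<le> \<delta> ^ CARD('n) *
          (2 - stay_prob B P r j (Suc n) ?z0 - stay_prob B P r j (Suc n) ?z1)"
        using \<delta>(1) by (intro mult_left_mono) auto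
      then show ?thesis using stay_prob_Suc_le[OF True, of j n] by (simp add: \<eta>_def \<eta>0_def)
    next
      case False
      then show ?thesis by (simp add: \<eta>_def)
    qed
    then show ?thesis by blast
  qed
  ultimately show ?thesis by blast
qed

end

section \<open>The Markov property of the interacting system\<close>

text \<open>By monotone convergence the series has finite expectation, hence is almost surely
  finite. This carries the descent in expectation over to single trajectories.\<close>

lemma AE_summable_of_summable_integral:
  fixes f :: "nat \<Rightarrow> 'a \<Rightarrow> real"
  assumes int: "\<And>n. integrable M (f n)" and nonneg: "\<And>n \<omega>. \<omega> \<in> space M \<Longrightarrow> 0 \<le> f n \<omega>"
    and sum: "summable (\<lambda>n. \<integral>\<omega>. f n \<omega> \<partial>M)"
  shows "AE \<omega> in M. summable (\<lambda>n. f n \<omega>)"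
proof -
  have [measurable]: "f n \<in> borel_measurable M" for n using int by (rule borel_measurable_integrable)
  have "(\<integral>\<^sup>+\<omega>. (\<Sum>n. ennreal (f n \<omega>)) \<partial>M) = (\<Sum>n. \<integral>\<^sup>+\<omega>. ennreal (f n \<omega>) \<partial>M)"
    by (rule nn_integral_suminf) measurable
  also have "\<dots> = (\<Sum>n. ennreal (\<integral>\<omega>. f n \<omega> \<partial>M))"
    using nn_integral_eq_integral[OF int] nonneg by simp
  also have "\<dots> = ennreal (\<Sum>n. \<integral>\<omega>. f n \<omega> \<partial>M)"
    using sum nonneg by (intro suminf_ennreal2) (auto intro: integral_nonneg_AE)
  finally have "(\<integral>\<^sup>+\<omega>. (\<Sum>n. ennreal (f n \<omega>)) \<partial>M) \<noteq> \<infinity>" by simp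
  then have "AE \<omega> in M. (\<Sum>n. ennreal (f n \<omega>)) \<noteq> \<infinity>"
    by (intro nn_integral_PInf_AE) measurable
  then show ?thesis
    by (rule AE_mp) (rule AE_I2, auto intro: summable_suminf_not_top nonneg)
qed

lemma borel_measurable_vec_componentwise:
  fixes X :: "'a \<Rightarrow> real ^ 'n"
  assumes "\<And>h. (\<lambda>\<omega>. X \<omega> $ h) \<in> borel_measurable M"
  shows "X \<in> borel_measurable M"
  unfolding borel_measurable_euclidean_space[of X]
  using assms by (auto simp: Basis_vec_def inner_axis)

lemma mean_eq: "mean (z :: real ^ 'n) = (\<Sum>h\<in>UNIV. z $ h) / real CARD('n)"
  by (simp add: mean_def)

lemma mean_diff: "mean z' - mean z = (\<Sum>h\<in>UNIV. z' $ h - z $ h) / real CARD('n)"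
  for z z' :: "real ^ 'n"
  by (simp add: mean_eq sum_subtractf diff_divide_distrib)

lemma mean_mono: "(\<And>h. z $ h \<le> z' $ h) \<Longrightarrow> mean z \<le> mean z'"
  by (simp add: mean_eq divide_right_mono sum_mono)

lemma mean_scaleR_1: "mean (x *\<^sub>R (1 :: real ^ 'n)) = x"
  by (simp add: mean_eq)

lemma mean_nonneg: "(\<And>h. 0 \<le> z $ h) \<Longrightarrow> 0 \<le> mean z"
  by (simp add: mean_eq sum_nonneg)

lemma mean_le: "(\<And>h. z $ h \<le> c) \<Longrightarrow> mean z \<le> c"
  using mean_mono[of z "c *\<^sub>R 1"] by (simp add: mean_scaleR_1)

lemma continuous_on_mean: "continuous_on S mean"
  unfolding mean_def[abs_def] by (intro continuous_intros)

section \<open>The chain, its filtration and its one-step law\<close>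

locale logistic_system = interacting_system M \<alpha> \<beta> q f r Z I
  for M :: "'a measure" and \<alpha> \<beta> q :: real and f :: "real \<Rightarrow> real" and r :: "nat \<Rightarrow> real"
    and Z I :: "nat \<Rightarrow> 'a \<Rightarrow> real ^ 'n" +
  fixes \<theta> xs :: real
  assumes f_def: "f = logistic \<theta> xs" and \<theta>_pos: "0 < \<theta>"
begin

abbreviation \<F> :: "nat \<Rightarrow> 'a measure" where "\<F> \<equiv> past M Z I"
abbreviation s :: real where "s \<equiv> 1 - \<alpha> - \<beta>"

lemma s_pos: "0 < s" and s_less_1: "s < 1"
  using \<alpha>\<beta>_range by auto

sublocale logistic_equation \<theta> xs s
  by unfold_locales (use \<theta>_pos s_pos s_less_1 in auto)

definition succ_prob :: "real ^ 'n \<Rightarrow> 'n \<Rightarrow> real" where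
  "succ_prob z h = \<alpha> * mean z + \<beta> * q + s * f (z $ h)"

definition successes :: "nat \<Rightarrow> 'a \<Rightarrow> 'n set" where
  "successes n \<omega> = {h. I (Suc n) \<omega> $ h = 1}"

lemma drift_nth: "drift \<alpha> \<beta> q f z $ h = succ_prob z h - z $ h"
  by (simp add: drift_def succ_prob_def)

lemma continuous_on_f: "continuous_on S f"
  by (simp add: f_def continuous_on_logistic)

lemma continuous_on_f_nth: "continuous_on S (\<lambda>z :: real ^ 'n. f (z $ h))"
  by (rule continuous_on_compose2[OF continuous_on_f[of UNIV]]) (auto intro!: continuous_intros)

lemma continuous_on_succ_prob: "continuous_on S (\<lambda>z. succ_prob z h)"
  unfolding succ_prob_def by (intro continuous_intros continuous_on_mean continuous_on_f_nth)

lemma borel_measurable_succ_prob: "(\<lambda>z. succ_prob z h) \<in> borel_measurable borel"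
  by (intro borel_measurable_continuous_onI continuous_on_succ_prob)

text \<open>The interaction and forcing terms together range in \<open>[0, 1 - s]\<close>, while
  \<open>f\<close> stays between \<open>f 0\<close> and \<open>f 1\<close>, which are not 0 and 1.
  These bounds supply \<open>\<delta>\<close> for the expanding kernel and keep all zeros off the
  boundary of the cube.\<close>

lemma succ_prob_bounds:
  assumes "\<And>h. 0 \<le> z $ h" "\<And>h. z $ h \<le> 1"
  shows "s * f 0 \<le> succ_prob z h" "succ_prob z h \<le> 1 - s * (1 - f 1)"
proof -
  have "0 \<le> mean z" "mean z \<le> 1" using assms by (auto intro: mean_nonneg mean_le)
  then have m: "0 \<le> \<alpha> * mean z" "\<alpha> * mean z \<le> \<alpha>" using \<alpha>_range by (auto simp: mult_left_le)
  have q: "0 \<le> \<beta> * q" "\<beta> * q \<le> \<beta>" using \<beta>_range q_range by (auto simp: mult_left_le)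
  have "f 0 \<le> f (z $ h)" "f (z $ h) \<le> f 1"
    using assms[of h] by (simp_all add: f_def logistic_mono[OF \<theta>_pos])
  then have "s * f 0 \<le> s * f (z $ h)" "s * f (z $ h) \<le> s * f 1"
    using s_pos by (auto intro: mult_left_mono)
  then show "s * f 0 \<le> succ_prob z h" "succ_prob z h \<le> 1 - s * (1 - f 1)"
    using m q by (auto simp: succ_prob_def algebra_simps)
qed

lemma f_0_pos: "0 < f 0" and f_1_less: "f 1 < 1"
  by (simp_all add: f_def logistic_pos logistic_less_1)

lemma succ_prob_01:
  assumes "\<And>h. 0 \<le> z $ h" "\<And>h. z $ h \<le> 1"
  shows "0 < succ_prob z h" "succ_prob z h < 1"
  using succ_prob_bounds[OF assms, of h] mult_pos_pos[OF s_pos f_0_pos] mult_pos_pos[OF s_pos, of "1 - f 1"] f_1_less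
  by auto

lemma space_past [simp]: "space (\<F> n) = space M"
  by (simp add: past_def space_measure_of_conv)

lemma past_generators:
  "{(\<lambda>\<omega>. Z 0 \<omega> $ h) -` A \<inter> space M | h A. A \<in> sets borel} \<union>
   {(\<lambda>\<omega>. I k \<omega> $ h) -` A \<inter> space M | k h A. k \<in> {1..n} \<and> A \<in> sets borel} \<subseteq> sets M" (is "?G \<subseteq> _")
proof
  fix E assume "E \<in> ?G"
  then consider h A where "E = (\<lambda>\<omega>. Z 0 \<omega> $ h) -` A \<inter> space M" "A \<in> sets borel"
    | k h A where "E = (\<lambda>\<omega>. I k \<omega> $ h) -` A \<inter> space M" "k \<in> {1..n}" "A \<in> sets borel" by blast
  then show "E \<in> sets M"
  proof cases
    case 1
    then show ?thesis using measurable_sets[OF Z0_measurable] by simp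
  next
    case 2
    then obtain k' where "k = Suc k'" by (cases k) auto
    then show ?thesis using 2 measurable_sets[OF I_measurable] by simp
  qed
qed

lemma sets_past: "sets (\<F> n) = sigma_sets (space M)
    ({(\<lambda>\<omega>. Z 0 \<omega> $ h) -` A \<inter> space M | h A. A \<in> sets borel} \<union>
     {(\<lambda>\<omega>. I k \<omega> $ h) -` A \<inter> space M | k h A. k \<in> {1..n} \<and> A \<in> sets borel})"
  unfolding past_def by (rule sets_measure_of) auto

lemma sets_past_subset: "sets (\<F> n) \<subseteq> sets M"
  unfolding sets_past by (rule sets.sigma_sets_subset[OF past_generators])

lemma sets_past_mono: "sets (\<F> n) \<subseteq> sets (\<F> (Suc n))"
proof -
  have "k \<in> {1..n} \<Longrightarrow> k \<in> {1..Suc n}" for k by simp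
  then show ?thesis unfolding sets_past by (intro sigma_sets_mono' Un_mono subset_refl) blast
qed

lemma measurable_past_Suc: "X \<in> measurable (\<F> n) N \<Longrightarrow> X \<in> measurable (\<F> (Suc n)) N"
  using sets_past_mono[of n] by (auto simp: measurable_def)

lemma measurable_past_M: "X \<in> measurable (\<F> n) N \<Longrightarrow> X \<in> measurable M N"
  using sets_past_subset[of n] by (auto simp: measurable_def)

lemma sigma_finite_past: "sigma_finite_subalgebra M (\<F> n)"
proof (rule finite_measure_subalgebra_is_sigma_finite)
  show "finite_measure_subalgebra M (\<F> n)"
    by unfold_locales (auto simp: subalgebra_def sets_past_subset)
qed

lemma borel_measurable_Z_nth: "(\<lambda>\<omega>. Z n \<omega> $ h) \<in> borel_measurable (\<F> n)"
proof (induction n)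
  case 0
  show ?case
  proof (rule measurableI)
    fix A :: "real set" assume "A \<in> sets borel"
    then show "(\<lambda>\<omega>. Z 0 \<omega> $ h) -` A \<inter> space (\<F> 0) \<in> sets (\<F> 0)"
      unfolding sets_past space_past by (intro sigma_sets.Basic) blast
  qed simp
next
  case (Suc n)
  have [measurable]: "(\<lambda>\<omega>. I (Suc n) \<omega> $ h) \<in> borel_measurable (\<F> (Suc n))"
  proof (rule measurableI)
    fix A :: "real set" assume A: "A \<in> sets borel"
    have "Suc n \<in> {1..Suc n}" by simp
    with A show "(\<lambda>\<omega>. I (Suc n) \<omega> $ h) -` A \<inter> space (\<F> (Suc n)) \<in> sets (\<F> (Suc n))"
      unfolding sets_past space_past by (intro sigma_sets.Basic) blast
  qed simp
  note [measurable] = measurable_past_Suc[OF Suc]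
  have "(\<lambda>\<omega>. (1 - r n) * Z n \<omega> $ h + r n * I (Suc n) \<omega> $ h) \<in> borel_measurable (\<F> (Suc n))"
    by measurable
  then show ?case by (rule measurable_cong[THEN iffD1, rotated]) (simp add: Z_Suc)
qed

lemma borel_measurable_Z: "Z n \<in> borel_measurable (\<F> n)"
  by (intro borel_measurable_vec_componentwise borel_measurable_Z_nth)

lemma Z_range: assumes "\<omega> \<in> space M" shows "0 \<le> Z n \<omega> $ h" "Z n \<omega> $ h \<le> 1"
proof -
  have "Z n \<omega> $ h \<in> {0..1}"
  proof (induction n)
    case 0
    show ?case by (rule Z0_range[OF assms])
  next
    case (Suc n)
    have r: "0 \<le> r n" "r n \<le> 1" using r_range[of n] by auto
    have "I (Suc n) \<omega> $ h \<in> {0..1}" using I_range[OF assms, of n h] by auto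
    then show ?case unfolding Z_Suc[OF assms]
      using Suc r convex_bound_le[of "Z n \<omega> $ h" 1 "I (Suc n) \<omega> $ h" "1 - r n" "r n"] by auto
  qed
  then show "0 \<le> Z n \<omega> $ h" "Z n \<omega> $ h \<le> 1" by auto
qed

lemma Z_Suc_after_step:
  assumes "\<omega> \<in> space M" shows "Z (Suc n) \<omega> = after_step (r n) (Z n \<omega>) (successes n \<omega>)"
proof (rule vec_eq_iff[THEN iffD2, rule_format])
  fix h
  have "I (Suc n) \<omega> $ h = indicator (successes n \<omega>) h"
    using I_range[OF assms, of n h] by (auto simp: successes_def)
  then show "Z (Suc n) \<omega> $ h = after_step (r n) (Z n \<omega>) (successes n \<omega>) $ h"
    by (simp add: after_step_def Z_Suc[OF assms])
qed

lemma I_eq_1_measurable: "{\<omega> \<in> space M. I (Suc n) \<omega> $ h = 1} \<in> sets M"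
  using measurable_sets[OF I_measurable[of n h], of "{1}"] by (simp add: vimage_def Int_def conj_commute)

text \<open>The model prescribes the conditional probability of the value 1. That of the value 0
  comes from the complement, by linearity of the conditional expectation.\<close>

lemma cond_prob_single:
  "AE \<omega> in M. cond_prob M (\<F> n) ((\<lambda>\<omega>. I (Suc n) \<omega> $ h) -` {if h \<in> S then 1 else 0} \<inter> space M) \<omega>
    = (if h \<in> S then succ_prob (Z n \<omega>) h else 1 - succ_prob (Z n \<omega>) h)"
proof -
  interpret sigma_finite_subalgebra M "\<F> n" by (rule sigma_finite_past)
  let ?E = "{\<omega> \<in> space M. I (Suc n) \<omega> $ h = 1}" and ?E' = "(\<lambda>\<omega>. I (Suc n) \<omega> $ h) -` {0} \<inter> space M"
  have E: "?E \<in> sets M" by (rule I_eq_1_measurable)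
  have E': "?E' \<in> sets M" using measurable_sets[OF I_measurable[of n h], of "{0}"] by simp
  have 1: "AE \<omega> in M. cond_prob M (\<F> n) ?E \<omega> = succ_prob (Z n \<omega>) h"
    using I_cond_prob[of n h] by (simp add: succ_prob_def)
  show ?thesis
  proof (cases "h \<in> S")
    case True
    have "(\<lambda>\<omega>. I (Suc n) \<omega> $ h) -` {1} \<inter> space M = ?E" by auto
    then show ?thesis using 1 True by simp
  next
    case False
    have int: "integrable M (indicator ?E :: 'a \<Rightarrow> real)" using E by (simp add: emeasure_eq_measure)
    have "AE \<omega> in M. cond_prob M (\<F> n) ?E' \<omega> = real_cond_exp M (\<F> n) (\<lambda>\<omega>. 1 - indicator ?E \<omega>) \<omega>"
      unfolding cond_prob_def
    proof (rule real_cond_exp_cong)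
      show "AE \<omega> in M. indicat_real ?E' \<omega> = 1 - indicator ?E \<omega>"
        using I_range[of _ n h] by (auto simp: indicator_def)
    qed (use E E' in measurable)
    moreover have "AE \<omega> in M. real_cond_exp M (\<F> n) (\<lambda>\<omega>. 1 - indicator ?E \<omega>) \<omega>
        = real_cond_exp M (\<F> n) (\<lambda>_. 1) \<omega> - real_cond_exp M (\<F> n) (indicator ?E) \<omega>"
      by (intro real_cond_exp_diff int) simp
    moreover have "AE \<omega> in M. real_cond_exp M (\<F> n) (\<lambda>_. 1) \<omega> = 1"
      by (intro real_cond_exp_F_meas) auto
    ultimately show ?thesis using 1 unfolding cond_prob_def
      by eventually_elim (use False in simp)
  qed
qed

text \<open>Fixing the set of successes fixes every coordinate, so the event is an intersection over
  all coordinates and conditional independence factorizes it.\<close>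

lemma cond_prob_successes:
  "AE \<omega> in M. cond_prob M (\<F> n) {\<omega> \<in> space M. successes n \<omega> = S} \<omega> =
    bernoulli_weight UNIV (succ_prob (Z n \<omega>)) S"
proof -
  define A where "A h = {if h \<in> S then 1 else 0 :: real}" for h
  have "A \<in> (\<Pi> h\<in>UNIV. sets borel)" by (auto simp: A_def)
  with I_cond_indep[of n] have "AE \<omega> in M. cond_prob M (\<F> n) (\<Inter>h\<in>UNIV. (\<lambda>\<omega>. I (Suc n) \<omega> $ h) -` A h \<inter> space M) \<omega> =
      (\<Prod>h\<in>UNIV. cond_prob M (\<F> n) ((\<lambda>\<omega>. I (Suc n) \<omega> $ h) -` A h \<inter> space M) \<omega>)"
    unfolding cond_indep_vars_def by simp
  moreover have "(\<Inter>h\<in>UNIV. (\<lambda>\<omega>. I (Suc n) \<omega> $ h) -` A h \<inter> space M) = {\<omega> \<in> space M. successes n \<omega> = S}"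
  proof (intro set_eqI iffI)
    fix \<omega> assume "\<omega> \<in> (\<Inter>h\<in>UNIV. (\<lambda>\<omega>. I (Suc n) \<omega> $ h) -` A h \<inter> space M)"
    then have "\<omega> \<in> space M" "\<And>h. I (Suc n) \<omega> $ h = (if h \<in> S then 1 else 0)" by (auto simp: A_def)
    then show "\<omega> \<in> {\<omega> \<in> space M. successes n \<omega> = S}" by (auto simp: successes_def split: if_splits)
  next
    fix \<omega> assume *: "\<omega> \<in> {\<omega> \<in> space M. successes n \<omega> = S}"
    then have "I (Suc n) \<omega> $ h = (if h \<in> S then 1 else 0)" for h
      using I_range[of \<omega> n h] by (auto simp: successes_def)
    then show "\<omega> \<in> (\<Inter>h\<in>UNIV. (\<lambda>\<omega>. I (Suc n) \<omega> $ h) -` A h \<inter> space M)"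
      using * by (simp add: A_def)
  qed
  moreover have "AE \<omega> in M. \<forall>h\<in>UNIV. cond_prob M (\<F> n) ((\<lambda>\<omega>. I (Suc n) \<omega> $ h) -` A h \<inter> space M) \<omega>
      = (if h \<in> S then succ_prob (Z n \<omega>) h else 1 - succ_prob (Z n \<omega>) h)"
    unfolding A_def by (intro AE_finite_allI finite_class.finite_UNIV cond_prob_single)
  moreover have "(\<Prod>h\<in>UNIV. if h \<in> S then p h else 1 - p h) = bernoulli_weight UNIV p S" for p :: "'n \<Rightarrow> real"
    by (simp add: bernoulli_weight_def prod.If_cases Compl_eq_Diff_UNIV)
  ultimately show ?thesis by auto
qed

lemma successes_measurable: "{\<omega> \<in> space M. successes n \<omega> = S} \<in> sets M"
proof -
  note [measurable] = I_measurable
  have "{\<omega> \<in> space M. \<forall>h. (I (Suc n) \<omega> $ h = 1) = (h \<in> S)} \<in> sets M" by measurable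
  moreover have "{\<omega> \<in> space M. \<forall>h. (I (Suc n) \<omega> $ h = 1) = (h \<in> S)} = {\<omega> \<in> space M. successes n \<omega> = S}"
    by (auto simp: successes_def)
  ultimately show ?thesis by simp
qed

text \<open>One-step Markov property in integrated form. There are finitely many outcomes
  \<open>S\<close>; on each of them \<open>g S\<close> belongs to the past and the indicator of the
  outcome can be replaced by its conditional probability.\<close>

lemma expectation_successes:
  fixes g :: "'n set \<Rightarrow> 'a \<Rightarrow> real"
  assumes g: "\<And>S. g S \<in> borel_measurable (\<F> n)" and bd: "\<And>S \<omega>. \<omega> \<in> space M \<Longrightarrow> \<bar>g S \<omega>\<bar> \<le> C"
  shows "(\<integral>\<omega>. g (successes n \<omega>) \<omega> \<partial>M) =
    (\<integral>\<omega>. bernoulli_expectation UNIV (succ_prob (Z n \<omega>)) (\<lambda>S. g S \<omega>) \<partial>M)"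
proof -
  interpret sigma_finite_subalgebra M "\<F> n" by (rule sigma_finite_past)
  define E where "E S = {\<omega> \<in> space M. successes n \<omega> = S}" for S
  have E[measurable]: "E S \<in> sets M" for S unfolding E_def by (rule successes_measurable)
  note [measurable] = g measurable_past_M[OF g] measurable_past_M[OF borel_measurable_Z]
    measurable_compose[OF borel_measurable_Z borel_measurable_succ_prob]
    measurable_past_M[OF measurable_compose[OF borel_measurable_Z borel_measurable_succ_prob]]
  have C: "0 \<le> C" using bd not_empty by fastforce
  have int: "integrable M (\<lambda>\<omega>. g S \<omega> * indicator (E S) \<omega>)" for S
    by (rule integrable_const_bound[of _ C]) (use bd C in \<open>auto simp: abs_mult indicator_def\<close>)
  have single: "(\<integral>\<omega>. g S \<omega> * indicator (E S) \<omega> \<partial>M) =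
      (\<integral>\<omega>. g S \<omega> * bernoulli_weight UNIV (succ_prob (Z n \<omega>)) S \<partial>M)" for S
  proof -
    have "(\<integral>\<omega>. g S \<omega> * indicator (E S) \<omega> \<partial>M) = (\<integral>\<omega>. g S \<omega> * real_cond_exp M (\<F> n) (indicator (E S)) \<omega> \<partial>M)"
      by (rule real_cond_exp_intg(2)[symmetric, OF int]) measurable
    also have "\<dots> = (\<integral>\<omega>. g S \<omega> * bernoulli_weight UNIV (succ_prob (Z n \<omega>)) S \<partial>M)"
    proof (rule integral_cong_AE)
      show "AE \<omega> in M. g S \<omega> * real_cond_exp M (\<F> n) (indicator (E S)) \<omega> =
          g S \<omega> * bernoulli_weight UNIV (succ_prob (Z n \<omega>)) S"
        using cond_prob_successes[of n S] by (auto simp: cond_prob_def E_def)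
    qed (auto simp: bernoulli_weight_def)
    finally show ?thesis .
  qed
  have w01: "0 \<le> bernoulli_weight UNIV (succ_prob (Z n \<omega>)) S \<and> bernoulli_weight UNIV (succ_prob (Z n \<omega>)) S \<le> 1"
    if "\<omega> \<in> space M" for \<omega> S
  proof -
    have "0 \<le> bernoulli_weight UNIV (succ_prob (Z n \<omega>)) S'" for S'
      using succ_prob_01[OF Z_range[OF that]] by (intro bernoulli_weight_nonneg) (auto intro: less_imp_le)
    moreover from this have "bernoulli_weight UNIV (succ_prob (Z n \<omega>)) S \<le> (\<Sum>S\<in>Pow UNIV. bernoulli_weight UNIV (succ_prob (Z n \<omega>)) S)"
      by (intro member_le_sum) auto
    ultimately show ?thesis using sum_bernoulli_weight[of "UNIV :: 'n set" "succ_prob (Z n \<omega>)"] by simp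
  qed
  have "(\<integral>\<omega>. g (successes n \<omega>) \<omega> \<partial>M) = (\<integral>\<omega>. (\<Sum>S\<in>Pow UNIV. g S \<omega> * indicator (E S) \<omega>) \<partial>M)"
  proof (rule Bochner_Integration.integral_cong)
    fix \<omega> assume "\<omega> \<in> space M"
    then have "(\<Sum>S\<in>Pow UNIV. g S \<omega> * indicator (E S) \<omega>) = (\<Sum>S\<in>Pow UNIV. if S = successes n \<omega> then g S \<omega> else 0)"
      by (intro sum.cong) (auto simp: E_def indicator_def)
    then show "g (successes n \<omega>) \<omega> = (\<Sum>S\<in>Pow UNIV. g S \<omega> * indicator (E S) \<omega>)" by simp
  qed simp
  also have "\<dots> = (\<Sum>S\<in>Pow UNIV. \<integral>\<omega>. g S \<omega> * indicator (E S) \<omega> \<partial>M)"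
    by (rule Bochner_Integration.integral_sum) (rule int)
  also have "\<dots> = (\<Sum>S\<in>Pow UNIV. \<integral>\<omega>. g S \<omega> * bernoulli_weight UNIV (succ_prob (Z n \<omega>)) S \<partial>M)"
    by (simp only: single)
  also have "\<dots> = (\<integral>\<omega>. (\<Sum>S\<in>Pow UNIV. g S \<omega> * bernoulli_weight UNIV (succ_prob (Z n \<omega>)) S) \<partial>M)"
  proof (rule Bochner_Integration.integral_sum[symmetric])
    fix S
    show "integrable M (\<lambda>\<omega>. g S \<omega> * bernoulli_weight UNIV (succ_prob (Z n \<omega>)) S)"
    proof (rule integrable_const_bound[of _ C])
      show "AE \<omega> in M. norm (g S \<omega> * bernoulli_weight UNIV (succ_prob (Z n \<omega>)) S) \<le> C"
      proof (rule AE_I2)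
        fix \<omega> assume \<omega>: "\<omega> \<in> space M"
        have "\<bar>g S \<omega>\<bar> * \<bar>bernoulli_weight UNIV (succ_prob (Z n \<omega>)) S\<bar> \<le> C * 1"
          using bd[OF \<omega>] w01[OF \<omega>] C by (intro mult_mono) auto
        then show "norm (g S \<omega> * bernoulli_weight UNIV (succ_prob (Z n \<omega>)) S) \<le> C" by (simp add: abs_mult)
      qed
    qed (unfold bernoulli_weight_def, measurable)
  qed
  finally show ?thesis by (simp add: bernoulli_expectation_def mult.commute)
qed

text \<open>\<open>I (Suc n) - succ_prob (Z n)\<close> is a martingale difference; this is that
  property, tested against a bounded variable of the past.\<close>

lemma expectation_I:
  assumes X: "X \<in> borel_measurable (\<F> n)" and bd: "\<And>\<omega>. \<omega> \<in> space M \<Longrightarrow> \<bar>X \<omega>\<bar> \<le> C"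
  shows "(\<integral>\<omega>. X \<omega> * I (Suc n) \<omega> $ h \<partial>M) = (\<integral>\<omega>. X \<omega> * succ_prob (Z n \<omega>) h \<partial>M)"
proof -
  interpret sigma_finite_subalgebra M "\<F> n" by (rule sigma_finite_past)
  let ?E = "{\<omega> \<in> space M. I (Suc n) \<omega> $ h = 1}"
  have E[measurable]: "?E \<in> sets M" by (rule I_eq_1_measurable)
  note [measurable] = X measurable_past_M[OF X]
    measurable_past_M[OF measurable_compose[OF borel_measurable_Z borel_measurable_succ_prob]]
  have C: "0 \<le> C" using bd not_empty by fastforce
  have int: "integrable M (\<lambda>\<omega>. X \<omega> * indicator ?E \<omega>)"
    by (rule integrable_const_bound[of _ C]) (use bd C in \<open>auto simp: abs_mult indicator_def\<close>)
  have "(\<integral>\<omega>. X \<omega> * I (Suc n) \<omega> $ h \<partial>M) = (\<integral>\<omega>. X \<omega> * indicator ?E \<omega> \<partial>M)"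
    using I_range[of _ n h] by (intro Bochner_Integration.integral_cong) (auto simp: indicator_def)
  also have "\<dots> = (\<integral>\<omega>. X \<omega> * real_cond_exp M (\<F> n) (indicator ?E) \<omega> \<partial>M)"
    by (rule real_cond_exp_intg(2)[symmetric, OF int]) measurable
  also have "\<dots> = (\<integral>\<omega>. X \<omega> * succ_prob (Z n \<omega>) h \<partial>M)"
  proof (rule integral_cong_AE)
    show "AE \<omega> in M. X \<omega> * real_cond_exp M (\<F> n) (indicator ?E) \<omega> = X \<omega> * succ_prob (Z n \<omega>) h"
      using I_cond_prob[of n h] by (auto simp: cond_prob_def succ_prob_def)
  qed auto
  finally show ?thesis .
qed

section \<open>Unstable equilibria\<close>

lemma r_01: "0 \<le> r n" "r n \<le> 1"
  using r_range[of n] by auto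

lemma measurable_past_mono:
  assumes "k \<le> m" "X \<in> measurable (\<F> k) N" shows "X \<in> measurable (\<F> m) N"
  using assms(1) by (induction m rule: dec_induct) (auto intro: assms(2) measurable_past_Suc)

text \<open>The Markov property iterated over \<open>j\<close> steps. The factor \<open>X\<close> is
  arbitrary because the indicator of the current state is moved into it (\<open>Y\<close>) before
  the induction hypothesis is applied one time step later.\<close>

lemma expectation_stay_prob:
  assumes kernel: "expanding_kernel B succ_prob r lam D \<delta>" and B: "B \<in> sets borel"
    and X: "X \<in> borel_measurable (\<F> n)" and bd: "\<And>\<omega>. \<omega> \<in> space M \<Longrightarrow> \<bar>X \<omega>\<bar> \<le> C"
  shows "(\<integral>\<omega>. X \<omega> * (\<Prod>k\<le>j. indicator B (Z (n + k) \<omega>)) \<partial>M) =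
    (\<integral>\<omega>. X \<omega> * stay_prob B succ_prob r j n (Z n \<omega>) \<partial>M)"
  using X bd
proof (induction j arbitrary: X n)
  case 0
  then show ?case by simp
next
  case (Suc j)
  interpret K: expanding_kernel B succ_prob r lam D \<delta> by (rule kernel)
  note [measurable] = B Suc.prems(1) borel_measurable_Z
    measurable_compose[OF borel_measurable_after_step borel_measurable_stay_prob[OF B borel_measurable_succ_prob]]
  define Y where "Y \<omega> = X \<omega> * indicator B (Z n \<omega>)" for \<omega>
  have Y[measurable]: "Y \<in> borel_measurable (\<F> n)" unfolding Y_def by measurable
  have Y_bd: "\<bar>Y \<omega>\<bar> \<le> C" if "\<omega> \<in> space M" for \<omega>
    using Suc.prems(2)[OF that] by (auto simp: Y_def indicator_def)
  have "(\<integral>\<omega>. X \<omega> * (\<Prod>k\<le>Suc j. indicator B (Z (n + k) \<omega>)) \<partial>M) =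
      (\<integral>\<omega>. Y \<omega> * (\<Prod>k\<le>j. indicator B (Z (Suc n + k) \<omega>)) \<partial>M)"
    by (simp add: Y_def prod.atMost_Suc_shift mult.assoc del: prod.atMost_Suc)
  also have "\<dots> = (\<integral>\<omega>. Y \<omega> * stay_prob B succ_prob r j (Suc n) (Z (Suc n) \<omega>) \<partial>M)"
    by (intro Suc.IH measurable_past_Suc Y Y_bd)
  also have "\<dots> = (\<integral>\<omega>. Y \<omega> * stay_prob B succ_prob r j (Suc n) (after_step (r n) (Z n \<omega>) (successes n \<omega>)) \<partial>M)"
    by (intro Bochner_Integration.integral_cong refl) (simp add: Z_Suc_after_step)
  also have "\<dots> = (\<integral>\<omega>. bernoulli_expectation UNIV (succ_prob (Z n \<omega>))
      (\<lambda>S. Y \<omega> * stay_prob B succ_prob r j (Suc n) (after_step (r n) (Z n \<omega>) S)) \<partial>M)"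
  proof (rule expectation_successes)
    fix S
    show "(\<lambda>\<omega>. Y \<omega> * stay_prob B succ_prob r j (Suc n) (after_step (r n) (Z n \<omega>) S)) \<in> borel_measurable (\<F> n)"
      by measurable
    show "\<bar>Y \<omega> * stay_prob B succ_prob r j (Suc n) (after_step (r n) (Z n \<omega>) S)\<bar> \<le> C" if "\<omega> \<in> space M" for \<omega>
    proof -
      have "\<bar>Y \<omega>\<bar> * \<bar>stay_prob B succ_prob r j (Suc n) (after_step (r n) (Z n \<omega>) S)\<bar> \<le> C * 1"
        using Y_bd[OF that] K.stay_prob_nonneg K.stay_prob_le_1 by (intro mult_mono) auto
      then show ?thesis by (simp add: abs_mult)
    qed
  qed
  also have "\<dots> = (\<integral>\<omega>. X \<omega> * stay_prob B succ_prob r (Suc j) n (Z n \<omega>) \<partial>M)"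
  proof (intro Bochner_Integration.integral_cong refl)
    show "bernoulli_expectation UNIV (succ_prob (Z n \<omega>))
        (\<lambda>S. Y \<omega> * stay_prob B succ_prob r j (Suc n) (after_step (r n) (Z n \<omega>) S)) =
      X \<omega> * stay_prob B succ_prob r (Suc j) n (Z n \<omega>)" for \<omega>
      by (cases "Z n \<omega> \<in> B") (simp_all add: Y_def bernoulli_expectation_def sum_distrib_left ac_simps)
  qed
  finally show ?case .
qed

text \<open>The event \<open>A\<close> of staying forever is the decreasing limit of the events
  \<open>G i\<close> of having stayed so far. Since \<open>prob A\<close> is at most
  \<open>1 - \<eta>\<close> times each \<open>prob (G i)\<close>, it is at most
  \<open>1 - \<eta>\<close> times itself. Starting the horizons at \<open>n + n0 + i\<close> makes
  the uniform bound applicable.\<close>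

lemma AE_not_eventually_in:
  assumes kernel: "expanding_kernel B succ_prob r lam D \<delta>" and B[measurable]: "B \<in> sets borel"
  shows "AE \<omega> in M. \<not> (\<forall>\<^sub>F k in sequentially. Z k \<omega> \<in> B)"
proof -
  interpret K: expanding_kernel B succ_prob r lam D \<delta> by (rule kernel)
  note [measurable] = measurable_past_M[OF borel_measurable_Z]
  obtain n0 where n0: "n0 \<ge> 1" "\<And>n. n \<ge> n0 \<Longrightarrow> 1 / (2 * real n) \<le> r n \<and> r n \<le> 2 / real n"
    using step_size_asymptotics[OF r_lim] by blast
  from K.uniform_exit[OF not_summable_step_size[OF r_lim] n0] obtain \<eta>
    where \<eta>: "\<eta> > 0" "\<And>n. n \<ge> n0 \<Longrightarrow> \<exists>j. \<forall>z. stay_prob B succ_prob r j n z \<le> 1 - \<eta>" by blast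
  have "AE \<omega> in M. \<not> (\<forall>k\<ge>n. Z k \<omega> \<in> B)" for n
  proof -
    define A where "A = {\<omega> \<in> space M. \<forall>k\<ge>n. Z k \<omega> \<in> B}"
    define G where "G i = {\<omega> \<in> space M. \<forall>k\<in>{n..n + n0 + i}. Z k \<omega> \<in> B}" for i
    have A[measurable]: "A \<in> sets M" unfolding A_def by measurable
    have G_past: "G i \<in> sets (\<F> (n + n0 + i))" for i
    proof -
      have "{\<omega> \<in> space (\<F> (n + n0 + i)). Z k \<omega> \<in> B} \<in> sets (\<F> (n + n0 + i))" if "k \<in> {n..n + n0 + i}" for k
      proof -
        have [measurable]: "Z k \<in> borel_measurable (\<F> (n + n0 + i))"
          using that by (intro measurable_past_mono[OF _ borel_measurable_Z]) auto
        show ?thesis by measurable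
      qed
      then have "{\<omega> \<in> space (\<F> (n + n0 + i)). \<forall>k\<in>{n..n + n0 + i}. Z k \<omega> \<in> B} \<in> sets (\<F> (n + n0 + i))"
        by (intro sets.sets_Collect_finite_All) auto
      then show ?thesis by (simp add: G_def)
    qed
    then have G[measurable]: "G i \<in> sets M" for i using sets_past_subset by blast
    have le: "prob A \<le> (1 - \<eta>) * prob (G i)" for i
    proof -
      let ?m = "n + n0 + i"
      obtain j where j: "\<And>z. stay_prob B succ_prob r j ?m z \<le> 1 - \<eta>" using \<eta>(2)[of ?m] by auto
      have stay_meas[measurable]: "stay_prob B succ_prob r j ?m \<in> borel_measurable borel"
        by (rule borel_measurable_stay_prob[OF B borel_measurable_succ_prob])
      have "prob A = (\<integral>\<omega>. indicator A \<omega> \<partial>M)" by simp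
      also have "\<dots> \<le> (\<integral>\<omega>. indicator (G i) \<omega> * (\<Prod>k\<le>j. indicator B (Z (?m + k) \<omega>)) \<partial>M)"
      proof (rule integral_mono)
        show "integrable M (\<lambda>\<omega>. indicator (G i) \<omega> * (\<Prod>k\<le>j. indicat_real B (Z (?m + k) \<omega>)))"
        proof (rule integrable_const_bound[of _ 1])
          show "AE \<omega> in M. norm (indicator (G i) \<omega> * (\<Prod>k\<le>j. indicat_real B (Z (?m + k) \<omega>))) \<le> 1"
            by (auto simp: abs_mult abs_prod indicator_def intro!: mult_le_one prod_le_1)
        qed measurable
        show "indicat_real A \<omega> \<le> indicator (G i) \<omega> * (\<Prod>k\<le>j. indicator B (Z (?m + k) \<omega>))" for \<omega>
        proof (cases "\<omega> \<in> A")
          case True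
          then have "\<omega> \<in> G i" "\<And>k. Z (?m + k) \<omega> \<in> B" by (auto simp: A_def G_def)
          then show ?thesis by simp
        qed (auto intro!: mult_nonneg_nonneg prod_nonneg)
      qed (simp add: emeasure_eq_measure)
      also have "\<dots> = (\<integral>\<omega>. indicator (G i) \<omega> * stay_prob B succ_prob r j ?m (Z ?m \<omega>) \<partial>M)"
        by (rule expectation_stay_prob[OF kernel B, of _ _ 1])
          (use G_past in \<open>auto simp: indicator_def\<close>)
      also have "\<dots> \<le> (\<integral>\<omega>. indicator (G i) \<omega> * (1 - \<eta>) \<partial>M)"
      proof (rule integral_mono)
        show "integrable M (\<lambda>\<omega>. indicator (G i) \<omega> * stay_prob B succ_prob r j ?m (Z ?m \<omega>))"
          by (rule integrable_const_bound[of _ 1])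
            (use K.stay_prob_nonneg K.stay_prob_le_1 in \<open>auto simp: indicator_def\<close>)
        show "indicator (G i) \<omega> * stay_prob B succ_prob r j ?m (Z ?m \<omega>) \<le> indicator (G i) \<omega> * (1 - \<eta>)" for \<omega>
          using j by (intro mult_left_mono) auto
      qed (simp add: emeasure_eq_measure)
      finally show ?thesis by (simp add: mult.commute)
    qed
    have "(\<lambda>i. prob (G i)) \<longlonglongrightarrow> prob (\<Inter>i. G i)"
      by (rule finite_Lim_measure_decseq) (auto simp: decseq_def G_def)
    moreover have "(\<Inter>i. G i) = A"
    proof (intro set_eqI iffI)
      fix \<omega> assume *: "\<omega> \<in> (\<Inter>i. G i)"
      have "Z k \<omega> \<in> B" if "k \<ge> n" for k
      proof -
        have "\<omega> \<in> G k" using * by blast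
        then show ?thesis using that by (auto simp: G_def)
      qed
      then show "\<omega> \<in> A" using * by (auto simp: A_def G_def)
    qed (auto simp: A_def G_def)
    ultimately have "(\<lambda>i. (1 - \<eta>) * prob (G i)) \<longlonglongrightarrow> (1 - \<eta>) * prob A" by (auto intro: tendsto_mult)
    then have "prob A \<le> (1 - \<eta>) * prob A" by (rule LIMSEQ_le_const) (use le in auto)
    then have "\<eta> * prob A \<le> 0" by (simp add: algebra_simps)
    then have "prob A = 0" using \<eta>(1) measure_nonneg[of M A] by (simp add: mult_le_0_iff)
    then have "A \<in> null_sets M" by (simp add: null_sets_def emeasure_eq_measure)
    then show ?thesis by (rule AE_I') (auto simp: A_def)
  qed
  then have "AE \<omega> in M. \<forall>n. \<not> (\<forall>k\<ge>n. Z k \<omega> \<in> B)" by (simp add: AE_all_countable)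
  then show ?thesis by (simp add: eventually_sequentially)
qed

lemma succ_prob_diff:
  "succ_prob z' h - succ_prob z h = \<alpha> * (mean z' - mean z) + s * (f (z' $ h) - f (z $ h))"
  by (simp add: succ_prob_def algebra_simps)

text \<open>Along an ordered pair only the sum of the coordinates matters: the mean contributes
  \<open>\<alpha>\<close> times the distance and the logistic part at least \<open>s\<close> times
  the smallest slope on the cube. Near \<open>b\<close> these add up to more than 1.\<close>

lemma expanding_kernel_near_unstable:
  assumes b: "0 < b" "b < 1" and unstable: "s * lf' b + \<alpha> > 1"
  obtains \<epsilon> lam D \<delta> where "\<epsilon> > 0"
    "expanding_kernel (cbox ((b - \<epsilon>) *\<^sub>R 1) ((b + \<epsilon>) *\<^sub>R 1)) succ_prob r lam D \<delta>"
proof -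
  \<comment> \<open>Half of the surplus at \<open>b\<close>, so that by continuity the whole of
    \<open>lam\<close> is available on a small cube.\<close>
  define lam where "lam = (s * lf' b + \<alpha> - 1) / 2"
  have lam: "0 < lam" using unstable by (simp add: lam_def)
  have "isCont lf' b" using continuous_on_logistic_deriv[of UNIV] by (simp add: continuous_on_eq_continuous_at)
  then have "isCont (\<lambda>x. s * lf' x + \<alpha>) b" by (intro continuous_intros)
  then have "\<forall>\<^sub>F x in at b. 1 + lam < s * lf' x + \<alpha>"
    unfolding isCont_def using lam by (intro order_tendstoD(1)) (auto simp: lam_def field_simps)
  then obtain d where d: "d > 0" "\<And>x. x \<noteq> b \<Longrightarrow> dist x b < d \<Longrightarrow> 1 + lam < s * lf' x + \<alpha>"
    by (auto simp: eventually_at)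
  \<comment> \<open>Besides controlling the slope, \<open>\<epsilon>\<close> keeps the cube inside
    the unit cube, where the bounds on \<open>succ_prob\<close> hold.\<close>
  define \<epsilon> where "\<epsilon> = min (d / 2) (min b (1 - b))"
  have \<epsilon>: "0 < \<epsilon>" "\<epsilon> < d" "\<epsilon> \<le> b" "\<epsilon> \<le> 1 - b" using d b by (auto simp: \<epsilon>_def)
  have slope: "1 + lam \<le> s * lf' x + \<alpha>" if "b - \<epsilon> \<le> x" "x \<le> b + \<epsilon>" for x
  proof (cases "x = b")
    case True
    then show ?thesis using lam by (simp add: lam_def field_simps)
  next
    case False
    moreover have "dist x b < d" using that \<epsilon> by (auto simp: dist_real_def abs_less_iff)
    ultimately show ?thesis using d(2)[of x] by simp
  qed
  define B where "B = cbox ((b - \<epsilon>) *\<^sub>R 1) ((b + \<epsilon>) *\<^sub>R (1 :: real ^ 'n))"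
  have B: "b - \<epsilon> \<le> z $ h \<and> z $ h \<le> b + \<epsilon>" "0 \<le> z $ h" "z $ h \<le> 1" if "z \<in> B" for z h
  proof -
    show "b - \<epsilon> \<le> z $ h \<and> z $ h \<le> b + \<epsilon>" using that by (simp add: B_def mem_box_cart)
    then show "0 \<le> z $ h" "z $ h \<le> 1" using \<epsilon> by auto
  qed
  define \<delta> where "\<delta> = min (s * f 0) (s * (1 - f 1))"
  have "expanding_kernel B succ_prob r lam (real CARD('n) * (2 * \<epsilon>)) \<delta>"
  proof
    show "0 < \<delta>" using s_pos f_0_pos f_1_less by (simp add: \<delta>_def)
    fix z h assume "z \<in> B"
    then show "\<delta> \<le> succ_prob z h" "succ_prob z h \<le> 1 - \<delta>"
      using succ_prob_bounds[OF B(2,3), of z h] by (auto simp: \<delta>_def)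
  next
    fix z z' and h :: 'n assume *: "z \<in> B" "z' \<in> B" "\<And>i. z $ i \<le> z' $ i"
    have "f (z $ h) \<le> f (z' $ h)" using *(3) by (simp add: f_def logistic_mono[OF \<theta>_pos])
    then show "succ_prob z h \<le> succ_prob z' h"
      unfolding succ_prob_def using \<alpha>_range \<beta>_range s_pos mean_mono[OF *(3)] by (intro add_mono mult_left_mono) auto
  next
    fix z z' assume *: "z \<in> B" "z' \<in> B" "\<And>i. z $ i \<le> z' $ i"
    let ?W = "\<Sum>h\<in>UNIV. z' $ h - z $ h"
    have f_diff: "(1 + lam - \<alpha>) * (z' $ h - z $ h) \<le> s * (f (z' $ h) - f (z $ h))" for h
    proof (cases "z $ h = z' $ h")
      case False
      then have "z $ h < z' $ h" using *(3)[of h] by simp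
      then obtain t where t: "z $ h < t" "t < z' $ h"
        "s * lf (z' $ h) - 0 * z' $ h - (s * lf (z $ h) - 0 * z $ h) = (z' $ h - z $ h) * (s * lf' t - 0)"
        using mvt by blast
      have "1 + lam - \<alpha> \<le> s * lf' t" using slope[of t] t B(1)[OF *(1), of h] B(1)[OF *(2), of h] by simp
      then have "(z' $ h - z $ h) * (1 + lam - \<alpha>) \<le> (z' $ h - z $ h) * (s * lf' t)"
        using t by (intro mult_left_mono) auto
      then show ?thesis using t by (simp add: f_def algebra_simps)
    qed simp
    have "(\<Sum>h\<in>UNIV. succ_prob z' h - succ_prob z h) = \<alpha> * ?W + (\<Sum>h\<in>UNIV. s * (f (z' $ h) - f (z $ h)))"
      by (simp add: succ_prob_diff sum.distrib mean_diff)
    also have "\<dots> \<ge> \<alpha> * ?W + (\<Sum>h\<in>UNIV. (1 + lam - \<alpha>) * (z' $ h - z $ h))"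
      by (intro add_left_mono sum_mono f_diff)
    also have "\<alpha> * ?W + (\<Sum>h\<in>UNIV. (1 + lam - \<alpha>) * (z' $ h - z $ h)) = (1 + lam) * ?W"
      unfolding sum_distrib_left[symmetric] by (simp add: distrib_right left_diff_distrib)
    finally show "(1 + lam) * ?W \<le> (\<Sum>h\<in>UNIV. succ_prob z' h - succ_prob z h)" .
    have "?W \<le> (\<Sum>h\<in>(UNIV :: 'n set). 2 * \<epsilon>)"
    proof (rule sum_mono)
      show "z' $ h - z $ h \<le> 2 * \<epsilon>" for h using B(1)[OF *(1), of h] B(1)[OF *(2), of h] by simp
    qed
    then show "?W \<le> real CARD('n) * (2 * \<epsilon>)" by simp
  qed (use r_01 lam in auto)
  then show thesis using that \<epsilon>(1) unfolding B_def by blast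
qed

lemma AE_not_tendsto_unstable:
  assumes "0 < b" "b < 1" "s * lf' b + \<alpha> > 1"
  shows "AE \<omega> in M. \<not> (\<lambda>n. Z n \<omega>) \<longlonglongrightarrow> b *\<^sub>R 1"
proof -
  obtain \<epsilon> lam D \<delta> where \<epsilon>: "\<epsilon> > 0" and
    K: "expanding_kernel (cbox ((b - \<epsilon>) *\<^sub>R 1) ((b + \<epsilon>) *\<^sub>R 1)) succ_prob r lam D \<delta>"
    using expanding_kernel_near_unstable[OF assms] by blast
  have "AE \<omega> in M. \<not> (\<forall>\<^sub>F k in sequentially. Z k \<omega> \<in> cbox ((b - \<epsilon>) *\<^sub>R 1) ((b + \<epsilon>) *\<^sub>R 1))"
    by (rule AE_not_eventually_in[OF K]) simp
  then show ?thesis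
  proof (rule AE_mp, intro AE_I2 impI notI)
    fix \<omega> assume nev: "\<not> (\<forall>\<^sub>F k in sequentially. Z k \<omega> \<in> cbox ((b - \<epsilon>) *\<^sub>R 1) ((b + \<epsilon>) *\<^sub>R 1))"
      and lim: "(\<lambda>n. Z n \<omega>) \<longlonglongrightarrow> b *\<^sub>R 1"
    have "b *\<^sub>R 1 \<in> box ((b - \<epsilon>) *\<^sub>R 1) ((b + \<epsilon>) *\<^sub>R (1 :: real ^ 'n))"
      using \<epsilon> by (simp add: mem_box_cart)
    with lim have "\<forall>\<^sub>F k in sequentially. Z k \<omega> \<in> box ((b - \<epsilon>) *\<^sub>R 1) ((b + \<epsilon>) *\<^sub>R 1)"
      by (intro topological_tendstoD) auto
    then have "\<forall>\<^sub>F k in sequentially. Z k \<omega> \<in> cbox ((b - \<epsilon>) *\<^sub>R 1) ((b + \<epsilon>) *\<^sub>R 1)"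
      by (rule eventually_mono) (use box_subset_cbox in blast)
    then show False using nev by simp
  qed
qed

section \<open>Convergence\<close>

text \<open>A potential exists because the interaction through the mean is symmetric. The factor
  \<open>CARD('n)\<close> is due to \<open>mean\<close> having partial derivatives
  \<open>1 / CARD('n)\<close>, so that the last term has partial derivatives
  \<open>- \<alpha> * mean z\<close>.\<close>

definition lyapunov :: "real ^ 'n \<Rightarrow> real" where
  "lyapunov z = (\<Sum>h\<in>UNIV. (z $ h)\<^sup>2 / 2 - \<beta> * q * z $ h - s * logistic_primitive \<theta> xs (z $ h))
    - \<alpha> * real CARD('n) / 2 * (mean z)\<^sup>2"

text \<open>The gradient of \<open>lyapunov\<close> is minus the drift, and \<open>lyapunov z - norm z ^ 2 / 2\<close> is concave.\<close>

lemma lyapunov_step: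
  "lyapunov y - lyapunov x \<le>
    (\<Sum>h\<in>UNIV. (y $ h - x $ h)\<^sup>2 / 2 - drift \<alpha> \<beta> q f x $ h * (y $ h - x $ h))"
proof -
  define A where "A = (\<lambda>t. t\<^sup>2 / 2 - \<beta> * q * t - s * logistic_primitive \<theta> xs t)"
  \<comment> \<open>The quadratic part is expanded exactly; the tangent inequality is the only
    estimate.\<close>
  have A: "A u - A t \<le> (u - t)\<^sup>2 / 2 - (\<beta> * q + s * f t - t) * (u - t)" for t u
  proof -
    have "s * (logistic_primitive \<theta> xs t + f t * (u - t)) \<le> s * logistic_primitive \<theta> xs u"
      using logistic_primitive_above_tangent[OF \<theta>_pos, of xs t u] s_pos
      by (intro mult_left_mono) (auto simp: f_def)
    moreover have "s * (logistic_primitive \<theta> xs t + f t * (u - t)) = s * logistic_primitive \<theta> xs t + s * f t * (u - t)"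
      by (simp add: distrib_left)
    moreover have "u\<^sup>2 / 2 - t\<^sup>2 / 2 = (u - t)\<^sup>2 / 2 + t * (u - t)"
      by (simp add: power2_eq_square field_simps)
    moreover have "(\<beta> * q + s * f t - t) * (u - t) = \<beta> * q * u - \<beta> * q * t + s * f t * (u - t) - t * (u - t)"
      by (simp add: distrib_right left_diff_distrib right_diff_distrib[of "\<beta> * q"])
    ultimately show ?thesis unfolding A_def by linarith
  qed
  have "mean x * (\<Sum>h\<in>UNIV. y $ h - x $ h) = real CARD('n) * (mean x * (mean y - mean x))"
    by (simp add: mean_diff)
  also have "\<dots> \<le> real CARD('n) * (((mean y)\<^sup>2 - (mean x)\<^sup>2) / 2)"
  proof (intro mult_left_mono)
    have "0 \<le> (mean y - mean x)\<^sup>2" by simp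
    then show "mean x * (mean y - mean x) \<le> ((mean y)\<^sup>2 - (mean x)\<^sup>2) / 2"
      by (simp add: power2_eq_square algebra_simps)
  qed simp
  finally have "mean x * (\<Sum>h\<in>UNIV. y $ h - x $ h) \<le> real CARD('n) * (((mean y)\<^sup>2 - (mean x)\<^sup>2) / 2)" .
  then have *: "\<alpha> * (mean x * (\<Sum>h\<in>UNIV. y $ h - x $ h)) \<le> \<alpha> * (real CARD('n) * (((mean y)\<^sup>2 - (mean x)\<^sup>2) / 2))"
    using \<alpha>_range by (intro mult_left_mono) auto
  have m: "- (\<alpha> * real CARD('n) / 2 * (mean y)\<^sup>2 - \<alpha> * real CARD('n) / 2 * (mean x)\<^sup>2)
      \<le> (\<Sum>h\<in>UNIV. - (\<alpha> * mean x * (y $ h - x $ h)))"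
  proof -
    have "(\<Sum>h\<in>UNIV. - (\<alpha> * mean x * (y $ h - x $ h))) = - (\<alpha> * (mean x * (\<Sum>h\<in>UNIV. y $ h - x $ h)))"
      by (simp only: sum_negf sum_distrib_left mult.assoc)
    moreover have "\<alpha> * (real CARD('n) * (((mean y)\<^sup>2 - (mean x)\<^sup>2) / 2)) =
        \<alpha> * real CARD('n) / 2 * (mean y)\<^sup>2 - \<alpha> * real CARD('n) / 2 * (mean x)\<^sup>2"
      by (simp add: field_simps)
    ultimately show ?thesis using * by linarith
  qed
  have "lyapunov y - lyapunov x = (\<Sum>h\<in>UNIV. A (y $ h) - A (x $ h))
      - (\<alpha> * real CARD('n) / 2 * (mean y)\<^sup>2 - \<alpha> * real CARD('n) / 2 * (mean x)\<^sup>2)"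
    by (simp add: lyapunov_def A_def sum_subtractf)
  also have "\<dots> \<le> (\<Sum>h\<in>UNIV. (y $ h - x $ h)\<^sup>2 / 2 - (\<beta> * q + s * f (x $ h) - x $ h) * (y $ h - x $ h))
      + (\<Sum>h\<in>UNIV. - (\<alpha> * mean x * (y $ h - x $ h)))"
    unfolding diff_conv_add_uminus[of "sum _ _"] by (intro add_mono sum_mono A m)
  also have "\<dots> = (\<Sum>h\<in>UNIV. (y $ h - x $ h)\<^sup>2 / 2 - drift \<alpha> \<beta> q f x $ h * (y $ h - x $ h))"
    unfolding sum.distrib[symmetric] by (intro sum.cong refl) (simp add: drift_def algebra_simps)
  finally show ?thesis .
qed

lemma continuous_on_lyapunov: "continuous_on S lyapunov"
proof -
  have "continuous_on UNIV (logistic_primitive \<theta> xs)"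
    by (rule DERIV_continuous_on[OF has_real_derivative_logistic_primitive[OF \<theta>_pos]])
  then have "continuous_on S (\<lambda>z :: real ^ 'n. logistic_primitive \<theta> xs (z $ h))" for h
    by (rule continuous_on_compose2) (auto intro!: continuous_intros)
  then show ?thesis unfolding lyapunov_def by (intro continuous_intros continuous_on_mean) auto
qed

lemma continuous_on_drift: "continuous_on S (drift \<alpha> \<beta> q f :: real ^ 'n \<Rightarrow> real ^ 'n)"
  unfolding drift_def by (intro continuous_on_vec_lambda continuous_intros continuous_on_mean continuous_on_f_nth)

lemma Z_in_cbox: "\<omega> \<in> space M \<Longrightarrow> Z n \<omega> \<in> cbox 0 1"
  using Z_range[of \<omega> n] by (simp add: mem_box_cart)

lemma drift_bound:
  assumes "\<omega> \<in> space M" shows "\<bar>drift \<alpha> \<beta> q f (Z n \<omega>) $ h\<bar> \<le> 1"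
  using succ_prob_01[OF Z_range[OF assms], of n h] Z_range[OF assms, of n h]
  by (simp add: drift_nth abs_le_iff)

lemma borel_measurable_drift_Z: "(\<lambda>\<omega>. drift \<alpha> \<beta> q f (Z n \<omega>) $ h) \<in> borel_measurable (\<F> n)"
  unfolding drift_nth
  by (intro borel_measurable_diff borel_measurable_Z_nth
      measurable_compose[OF borel_measurable_Z borel_measurable_succ_prob])

lemma Z_step: assumes "\<omega> \<in> space M" shows "\<bar>Z (Suc n) \<omega> $ h - Z n \<omega> $ h\<bar> \<le> r n"
proof -
  have "Z (Suc n) \<omega> $ h - Z n \<omega> $ h = r n * (I (Suc n) \<omega> $ h - Z n \<omega> $ h)"
    by (simp add: Z_Suc[OF assms] algebra_simps)
  moreover have "\<bar>I (Suc n) \<omega> $ h - Z n \<omega> $ h\<bar> \<le> 1"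
    using I_range[OF assms, of n h] Z_range[OF assms, of n h] by auto
  ultimately show ?thesis using r_01[of n] by (simp add: abs_mult mult_left_le)
qed

text \<open>The increment of \<open>Z\<close> is \<open>r n * (I (Suc n) - Z n)\<close> and the
  drift belongs to the past. Hence, under the integral, \<open>I (Suc n)\<close> may be replaced by
  \<open>succ_prob (Z n)\<close>, and the linear term becomes the square of the drift.\<close>

lemma expected_descent:
  "(\<integral>\<omega>. lyapunov (Z (Suc n) \<omega>) \<partial>M) \<le> (\<integral>\<omega>. lyapunov (Z n \<omega>) \<partial>M)
    - (\<Sum>h\<in>UNIV. \<integral>\<omega>. r n * (drift \<alpha> \<beta> q f (Z n \<omega>) $ h)\<^sup>2 \<partial>M) + real CARD('n) / 2 * (r n)\<^sup>2"
  and integrable_lyapunov: "integrable M (\<lambda>\<omega>. lyapunov (Z n \<omega>))"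
proof -
  have "bounded (lyapunov ` cbox 0 1)"
    by (intro compact_imp_bounded compact_continuous_image continuous_on_lyapunov compact_cbox)
  then obtain C where C: "\<And>z. z \<in> cbox 0 1 \<Longrightarrow> \<bar>lyapunov z\<bar> \<le> C" by (auto simp: bounded_iff)
  have [measurable]: "lyapunov \<in> borel_measurable borel"
    by (intro borel_measurable_continuous_onI continuous_on_lyapunov)
  note [measurable] = measurable_past_M[OF borel_measurable_Z] I_measurable
    measurable_past_M[OF borel_measurable_Z_nth] measurable_past_M[OF borel_measurable_drift_Z]
  show int: "integrable M (\<lambda>\<omega>. lyapunov (Z n \<omega>))" for n
    by (rule integrable_const_bound[of _ C]) (auto intro!: C Z_in_cbox)
  let ?F = "\<lambda>\<omega> h. drift \<alpha> \<beta> q f (Z n \<omega>) $ h"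
  have int_F: "integrable M (\<lambda>\<omega>. ?F \<omega> h * X \<omega>)"
    if [measurable]: "X \<in> borel_measurable M" and X: "\<And>\<omega>. \<omega> \<in> space M \<Longrightarrow> \<bar>X \<omega>\<bar> \<le> 1" for X h
  proof (rule integrable_const_bound[of _ 1])
    show "AE \<omega> in M. norm (?F \<omega> h * X \<omega>) \<le> 1"
      using drift_bound X by (auto simp: abs_mult intro!: mult_le_one)
  qed measurable
  have Z1: "\<bar>Z n \<omega> $ h\<bar> \<le> 1" if "\<omega> \<in> space M" for \<omega> h using Z_range[OF that, of n h] by simp
  have I1: "\<bar>I (Suc n) \<omega> $ h\<bar> \<le> 1" if "\<omega> \<in> space M" for \<omega> h using I_range[OF that, of n h] by auto
  have int_FI: "integrable M (\<lambda>\<omega>. ?F \<omega> h * I (Suc n) \<omega> $ h)" and int_FZ: "integrable M (\<lambda>\<omega>. ?F \<omega> h * Z n \<omega> $ h)"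
    and int_FF: "integrable M (\<lambda>\<omega>. ?F \<omega> h * ?F \<omega> h)" for h
    by (auto intro!: int_F I1 Z1 drift_bound)
  have descent: "(\<integral>\<omega>. ?F \<omega> h * (I (Suc n) \<omega> $ h - Z n \<omega> $ h) \<partial>M) = (\<integral>\<omega>. (?F \<omega> h)\<^sup>2 \<partial>M)" for h
  proof -
    have "(\<integral>\<omega>. ?F \<omega> h * (I (Suc n) \<omega> $ h - Z n \<omega> $ h) \<partial>M) =
        (\<integral>\<omega>. ?F \<omega> h * I (Suc n) \<omega> $ h \<partial>M) - (\<integral>\<omega>. ?F \<omega> h * Z n \<omega> $ h \<partial>M)"
      using int_FI int_FZ by (simp add: right_diff_distrib)
    also have "(\<integral>\<omega>. ?F \<omega> h * I (Suc n) \<omega> $ h \<partial>M) = (\<integral>\<omega>. ?F \<omega> h * succ_prob (Z n \<omega>) h \<partial>M)"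
      by (rule expectation_I[OF borel_measurable_drift_Z drift_bound])
    also have "\<dots> = (\<integral>\<omega>. ?F \<omega> h * ?F \<omega> h + ?F \<omega> h * Z n \<omega> $ h \<partial>M)"
      by (intro Bochner_Integration.integral_cong refl) (simp add: drift_nth algebra_simps)
    finally show ?thesis using int_FF int_FZ by (simp add: power2_eq_square)
  qed
  have "(\<integral>\<omega>. lyapunov (Z (Suc n) \<omega>) \<partial>M) - (\<integral>\<omega>. lyapunov (Z n \<omega>) \<partial>M)
      = (\<integral>\<omega>. lyapunov (Z (Suc n) \<omega>) - lyapunov (Z n \<omega>) \<partial>M)"
    by (rule Bochner_Integration.integral_diff[symmetric]) (rule int)+
  also have "\<dots> \<le> (\<integral>\<omega>. (\<Sum>h\<in>UNIV. (r n)\<^sup>2 / 2 - r n * (?F \<omega> h * (I (Suc n) \<omega> $ h - Z n \<omega> $ h))) \<partial>M)"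
  proof (rule integral_mono)
    show "integrable M (\<lambda>\<omega>. lyapunov (Z (Suc n) \<omega>) - lyapunov (Z n \<omega>))"
      by (intro Bochner_Integration.integrable_diff int)
    show "integrable M (\<lambda>\<omega>. \<Sum>h\<in>UNIV. (r n)\<^sup>2 / 2 - r n * (?F \<omega> h * (I (Suc n) \<omega> $ h - Z n \<omega> $ h)))"
      unfolding right_diff_distrib[of "?F _ _"]
      by (intro Bochner_Integration.integrable_sum Bochner_Integration.integrable_diff integrable_mult_right int_FI int_FZ) simp
    fix \<omega> assume \<omega>: "\<omega> \<in> space M"
    have "lyapunov (Z (Suc n) \<omega>) - lyapunov (Z n \<omega>) \<le> (\<Sum>h\<in>UNIV. (Z (Suc n) \<omega> $ h - Z n \<omega> $ h)\<^sup>2 / 2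
        - ?F \<omega> h * (Z (Suc n) \<omega> $ h - Z n \<omega> $ h))" by (rule lyapunov_step)
    also have "\<dots> \<le> (\<Sum>h\<in>UNIV. (r n)\<^sup>2 / 2 - r n * (?F \<omega> h * (I (Suc n) \<omega> $ h - Z n \<omega> $ h)))"
    proof (rule sum_mono)
      fix h
      have "(Z (Suc n) \<omega> $ h - Z n \<omega> $ h)\<^sup>2 \<le> (r n)\<^sup>2"
        using Z_step[OF \<omega>, of n h] by (metis abs_ge_zero power2_abs power_mono)
      moreover have "Z (Suc n) \<omega> $ h - Z n \<omega> $ h = r n * (I (Suc n) \<omega> $ h - Z n \<omega> $ h)"
        by (simp add: Z_Suc[OF \<omega>] algebra_simps)
      ultimately show "(Z (Suc n) \<omega> $ h - Z n \<omega> $ h)\<^sup>2 / 2 - ?F \<omega> h * (Z (Suc n) \<omega> $ h - Z n \<omega> $ h)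
          \<le> (r n)\<^sup>2 / 2 - r n * (?F \<omega> h * (I (Suc n) \<omega> $ h - Z n \<omega> $ h))"
        by (simp add: mult.left_commute)
    qed
    finally show "lyapunov (Z (Suc n) \<omega>) - lyapunov (Z n \<omega>) \<le>
      (\<Sum>h\<in>UNIV. (r n)\<^sup>2 / 2 - r n * (?F \<omega> h * (I (Suc n) \<omega> $ h - Z n \<omega> $ h)))" .
  qed
  also have "\<dots> = (\<Sum>h\<in>UNIV. \<integral>\<omega>. (r n)\<^sup>2 / 2 - r n * (?F \<omega> h * (I (Suc n) \<omega> $ h - Z n \<omega> $ h)) \<partial>M)"
    unfolding right_diff_distrib[of "?F _ _"]
    by (intro Bochner_Integration.integral_sum Bochner_Integration.integrable_diff integrable_mult_right int_FI int_FZ) simp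
  also have "\<dots> = (\<Sum>h\<in>(UNIV :: 'n set). (r n)\<^sup>2 / 2 - r n * (\<integral>\<omega>. (?F \<omega> h)\<^sup>2 \<partial>M))"
  proof (intro sum.cong refl)
    fix h
    have "integrable M (\<lambda>\<omega>. ?F \<omega> h * (I (Suc n) \<omega> $ h - Z n \<omega> $ h))"
      unfolding right_diff_distrib by (intro Bochner_Integration.integrable_diff int_FI int_FZ)
    then show "(\<integral>\<omega>. (r n)\<^sup>2 / 2 - r n * (?F \<omega> h * (I (Suc n) \<omega> $ h - Z n \<omega> $ h)) \<partial>M)
        = (r n)\<^sup>2 / 2 - r n * (\<integral>\<omega>. (?F \<omega> h)\<^sup>2 \<partial>M)"
      by (simp add: descent prob_space)
  qed
  also have "\<dots> = real CARD('n) / 2 * (r n)\<^sup>2 - (\<Sum>h\<in>UNIV. \<integral>\<omega>. r n * (?F \<omega> h)\<^sup>2 \<partial>M)"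
    by (simp add: sum_subtractf)
  finally show "(\<integral>\<omega>. lyapunov (Z (Suc n) \<omega>) \<partial>M) \<le> (\<integral>\<omega>. lyapunov (Z n \<omega>) \<partial>M)
    - (\<Sum>h\<in>UNIV. \<integral>\<omega>. r n * (?F \<omega> h)\<^sup>2 \<partial>M) + real CARD('n) / 2 * (r n)\<^sup>2" by simp
qed

text \<open>The descent telescopes: \<open>lyapunov\<close> is bounded on the cube and the squares
  of the step sizes are summable, so the expected squares have bounded partial sums.\<close>

lemma AE_summable_drift_squares:
  "AE \<omega> in M. \<forall>h. summable (\<lambda>n. r n * (drift \<alpha> \<beta> q f (Z n \<omega>) $ h)\<^sup>2)"
proof -
  let ?e = "\<lambda>n h. \<integral>\<omega>. r n * (drift \<alpha> \<beta> q f (Z n \<omega>) $ h)\<^sup>2 \<partial>M"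
  note [measurable] = measurable_past_M[OF borel_measurable_drift_Z]
  have nonneg: "0 \<le> r n * (drift \<alpha> \<beta> q f (Z n \<omega>) $ h)\<^sup>2" for n h \<omega> using r_01 by simp
  have e_nonneg: "0 \<le> ?e n h" for n h using nonneg by (intro integral_nonneg_AE) auto
  have int: "integrable M (\<lambda>\<omega>. r n * (drift \<alpha> \<beta> q f (Z n \<omega>) $ h)\<^sup>2)" for n h
  proof (rule integrable_const_bound[of _ 1])
    show "AE \<omega> in M. norm (r n * (drift \<alpha> \<beta> q f (Z n \<omega>) $ h)\<^sup>2) \<le> 1"
    proof (rule AE_I2)
      fix \<omega> assume \<omega>: "\<omega> \<in> space M"
      have "(drift \<alpha> \<beta> q f (Z n \<omega>) $ h)\<^sup>2 \<le> 1"
        using drift_bound[OF \<omega>, of n h] by (simp add: abs_square_le_1)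
      then show "norm (r n * (drift \<alpha> \<beta> q f (Z n \<omega>) $ h)\<^sup>2) \<le> 1"
        using r_01[of n] by (simp add: abs_mult mult_le_one)
    qed
  qed measurable
  have "bounded (lyapunov ` cbox 0 1)"
    by (intro compact_imp_bounded compact_continuous_image continuous_on_lyapunov compact_cbox)
  then obtain C where C: "\<And>z. z \<in> cbox 0 1 \<Longrightarrow> \<bar>lyapunov z\<bar> \<le> C" by (auto simp: bounded_iff)
  have EC: "\<bar>\<integral>\<omega>. lyapunov (Z n \<omega>) \<partial>M\<bar> \<le> C" for n
  proof -
    have "\<bar>\<integral>\<omega>. lyapunov (Z n \<omega>) \<partial>M\<bar> \<le> (\<integral>\<omega>. \<bar>lyapunov (Z n \<omega>)\<bar> \<partial>M)"
      by (rule integral_abs_bound)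
    also have "\<dots> \<le> (\<integral>\<omega>. C \<partial>M)"
      by (rule integral_mono) (auto intro!: integrable_abs integrable_lyapunov C Z_in_cbox)
    finally show ?thesis by (simp add: prob_space)
  qed
  define R where "R = (\<Sum>n. (r n)\<^sup>2)"
  have r2: "summable (\<lambda>n. (r n)\<^sup>2)" by (rule summable_step_size_squares[OF r_lim r_01(1)])
  have "(\<Sum>n<m. \<Sum>h\<in>UNIV. ?e n h) \<le> (\<integral>\<omega>. lyapunov (Z 0 \<omega>) \<partial>M) - (\<integral>\<omega>. lyapunov (Z m \<omega>) \<partial>M)
      + real CARD('n) / 2 * (\<Sum>n<m. (r n)\<^sup>2)" for m
  proof (induction m)
    case (Suc m)
    then show ?case using expected_descent[of m] by (simp add: algebra_simps)
  qed simp
  also have "\<dots> m \<le> C + C + real CARD('n) / 2 * R" for m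
  proof -
    have "(\<Sum>n<m. (r n)\<^sup>2) \<le> R" unfolding R_def by (rule sum_le_suminf[OF r2]) auto
    then have "real CARD('n) / 2 * (\<Sum>n<m. (r n)\<^sup>2) \<le> real CARD('n) / 2 * R" by (intro mult_left_mono) auto
    then show ?thesis using EC[of 0] EC[of m] unfolding abs_le_iff by linarith
  qed
  finally have "(\<Sum>n<m. \<Sum>h\<in>UNIV. ?e n h) \<le> C + C + real CARD('n) / 2 * R" for m .
  then have "summable (\<lambda>n. \<Sum>h\<in>UNIV. ?e n h)"
    by (intro summableI_nonneg_bounded sum_nonneg e_nonneg)
  then have "summable (\<lambda>n. ?e n h)" for h
    by (rule summable_comparison_test'[of _ 0]) (use e_nonneg in \<open>auto intro!: member_le_sum\<close>)
  then have "AE \<omega> in M. summable (\<lambda>n. r n * (drift \<alpha> \<beta> q f (Z n \<omega>) $ h)\<^sup>2)" for h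
    by (intro AE_summable_of_summable_integral int nonneg)
  then show ?thesis by (simp add: AE_all_countable)
qed

lemma drift_step:
  assumes \<omega>: "\<omega> \<in> space M"
  shows "\<bar>drift \<alpha> \<beta> q f (Z (Suc n) \<omega>) $ h - drift \<alpha> \<beta> q f (Z n \<omega>) $ h\<bar> \<le> (2 + \<theta>) * r n"
proof -
  have "\<bar>mean (Z (Suc n) \<omega>) - mean (Z n \<omega>)\<bar> \<le> (\<Sum>h\<in>UNIV. \<bar>Z (Suc n) \<omega> $ h - Z n \<omega> $ h\<bar>) / real CARD('n)"
    unfolding mean_diff by (simp add: divide_right_mono sum_abs)
  also have "\<dots> \<le> (\<Sum>h\<in>(UNIV :: 'n set). r n) / real CARD('n)"
    by (intro divide_right_mono sum_mono Z_step[OF \<omega>]) auto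
  finally have "\<bar>mean (Z (Suc n) \<omega>) - mean (Z n \<omega>)\<bar> \<le> r n" by simp
  then have 1: "\<bar>\<alpha> * (mean (Z (Suc n) \<omega>) - mean (Z n \<omega>))\<bar> \<le> 1 * r n"
    unfolding abs_mult using \<alpha>_range by (intro mult_mono) auto
  have "\<bar>f (Z (Suc n) \<omega> $ h) - f (Z n \<omega> $ h)\<bar> \<le> \<theta> / 4 * \<bar>Z (Suc n) \<omega> $ h - Z n \<omega> $ h\<bar>"
    unfolding f_def by (rule logistic_Lipschitz[OF \<theta>_pos])
  also have "\<dots> \<le> \<theta> * r n" using Z_step[OF \<omega>, of n h] \<theta>_pos by (intro mult_mono) auto
  finally have 2: "\<bar>s * (f (Z (Suc n) \<omega> $ h) - f (Z n \<omega> $ h))\<bar> \<le> 1 * (\<theta> * r n)"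
    unfolding abs_mult using s_pos s_less_1 by (intro mult_mono) auto
  have "drift \<alpha> \<beta> q f (Z (Suc n) \<omega>) $ h - drift \<alpha> \<beta> q f (Z n \<omega>) $ h =
     \<alpha> * (mean (Z (Suc n) \<omega>) - mean (Z n \<omega>)) + s * (f (Z (Suc n) \<omega> $ h) - f (Z n \<omega> $ h))
      - (Z (Suc n) \<omega> $ h - Z n \<omega> $ h)"
    using succ_prob_diff[of "Z (Suc n) \<omega>" h "Z n \<omega>"] by (simp add: drift_nth)
  then show ?thesis using 1 2 Z_step[OF \<omega>, of n h] by (simp add: algebra_simps)
qed

lemma AE_drift_tendsto_0: "AE \<omega> in M. (\<lambda>n. drift \<alpha> \<beta> q f (Z n \<omega>)) \<longlonglongrightarrow> 0"
  using AE_summable_drift_squares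
proof (rule AE_mp, intro AE_I2 impI)
  fix \<omega> assume \<omega>: "\<omega> \<in> space M" and sum: "\<forall>h. summable (\<lambda>n. r n * (drift \<alpha> \<beta> q f (Z n \<omega>) $ h)\<^sup>2)"
  have "(\<lambda>n. drift \<alpha> \<beta> q f (Z n \<omega>) $ h) \<longlonglongrightarrow> 0" for h
    by (rule tendsto_0_of_summable_weighted_squares[OF r_01 summable_step_size_squares[OF r_lim r_01(1)]
          not_summable_step_size[OF r_lim] _ drift_step[OF \<omega>]])
      (use sum \<theta>_pos in auto)
  then show "(\<lambda>n. drift \<alpha> \<beta> q f (Z n \<omega>)) \<longlonglongrightarrow> 0" by (intro vec_tendstoI) simp
qed

lemma AE_tendsto_zero_point:
  assumes fin: "finite (zero_points \<alpha> \<beta> q f :: (real ^ 'n) set)"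
  shows "AE \<omega> in M. \<exists>z\<in>zero_points \<alpha> \<beta> q f. (\<lambda>n. Z n \<omega>) \<longlonglongrightarrow> z"
  using AE_drift_tendsto_0
proof (rule AE_mp, intro AE_I2 impI)
  fix \<omega> assume \<omega>: "\<omega> \<in> space M" and lim: "(\<lambda>n. drift \<alpha> \<beta> q f (Z n \<omega>)) \<longlonglongrightarrow> 0"
  have r0: "r \<longlonglongrightarrow> 0"
    using summable_LIMSEQ_zero[OF summable_step_size_squares[OF r_lim r_01(1)]]
    by (simp add: power_tendsto_0_iff)
  have "(\<lambda>n. (Z (Suc n) \<omega> - Z n \<omega>) $ h) \<longlonglongrightarrow> 0" for h
    by (rule Lim_null_comparison[OF _ r0]) (use Z_step[OF \<omega>] in simp)
  then have "(\<lambda>n. Z (Suc n) \<omega> - Z n \<omega>) \<longlonglongrightarrow> 0" by (intro vec_tendstoI) simp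
  then have step: "(\<lambda>n. dist (Z (Suc n) \<omega>) (Z n \<omega>)) \<longlonglongrightarrow> 0"
    unfolding dist_norm by (rule tendsto_norm_zero)
  have "\<exists>z\<in>cbox 0 1. drift \<alpha> \<beta> q f z = 0 \<and> (\<lambda>n. Z n \<omega>) \<longlonglongrightarrow> z"
    by (rule convergent_to_isolated_zero[OF compact_cbox continuous_on_drift _ Z_in_cbox[OF \<omega>] lim step])
      (use fin in \<open>simp add: zero_points_def\<close>)
  then show "\<exists>z\<in>zero_points \<alpha> \<beta> q f. (\<lambda>n. Z n \<omega>) \<longlonglongrightarrow> z" by (auto simp: zero_points_def)
qed

section \<open>Synchronized zeros, their stability, and the limit\<close>

abbreviation equilibrium :: "real \<Rightarrow> bool" where
  "equilibrium x \<equiv> s * lf x + \<beta> * q = (1 - \<alpha>) * x"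

lemma drift_scaleR_1: "drift \<alpha> \<beta> q f (x *\<^sub>R (1 :: real ^ 'n)) = 0 \<longleftrightarrow> equilibrium x"
  by (auto simp: drift_def mean_scaleR_1 f_def vec_eq_iff algebra_simps)

text \<open>At a zero each coordinate equals its own success probability, which is never 0 or
  1.\<close>

lemma zero_point_bounds:
  assumes "(z :: real ^ 'n) \<in> zero_points \<alpha> \<beta> q f" shows "0 < z $ h" "z $ h < 1"
proof -
  have z: "0 \<le> z $ h" "z $ h \<le> 1" for h using assms by (auto simp: zero_points_def mem_box_cart)
  have "drift \<alpha> \<beta> q f z $ h = 0" using assms by (simp add: zero_points_def)
  then have "z $ h = succ_prob z h" by (simp add: drift_nth)
  then show "0 < z $ h" "z $ h < 1" using succ_prob_01[OF z, of h] by auto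
qed

text \<open>The mean enters all coordinate equations through the same constant \<open>c\<close>,
  which lies in the range allowed by \<open>unique_zero\<close>. So all coordinates agree.\<close>

lemma zero_point_synchronized:
  assumes z: "(z :: real ^ 'n) \<in> zero_points \<alpha> \<beta> q f"
    and cond: "\<theta> / 4 \<le> 1 / s \<or> lf' 0 \<ge> 1 / s \<or> lf' 1 \<ge> 1 / s \<or>
      (\<exists>x1 x2. x1 < xs \<and> xs < x2 \<and> x2 < 1 \<and> lf' x1 = 1 / s \<and> lf' x2 = 1 / s \<and>
        (lf x1 \<ge> x1 / s \<or> lf x2 \<le> x2 / s - (\<alpha> + \<beta>) / s))"
    and nondegenerate: "\<not> decoupled_touching \<alpha> \<beta> q f xs"
  obtains x where "z = x *\<^sub>R 1" "0 < x" "x < 1" "equilibrium x"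
proof -
  define c where "c = \<alpha> * mean z + \<beta> * q"
  note b = zero_point_bounds[OF z]
  have mean_pos: "0 < mean z" using b(1) by (simp add: mean_eq sum_pos)
  have mean_less: "mean z < 1"
  proof -
    have "(\<Sum>h\<in>UNIV. z $ h) < (\<Sum>h\<in>(UNIV :: 'n set). 1)" using b(2) by (intro sum_strict_mono) auto
    then show ?thesis by (simp add: mean_eq)
  qed
  have eq: "s * lf (z $ h) + c = z $ h" for h
  proof -
    have "drift \<alpha> \<beta> q f z $ h = 0" using z by (simp add: zero_points_def)
    then show ?thesis by (simp add: drift_def c_def f_def)
  qed
  have c_pos: "0 < c"
    unfolding c_def using \<alpha>_range \<beta>_range \<alpha>\<beta>_range q_range mean_pos
    by (cases "\<alpha> = 0") (auto intro!: add_pos_nonneg)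
  have "\<alpha> * mean z \<le> \<alpha>" "\<beta> * q \<le> \<beta>"
    using \<alpha>_range \<beta>_range q_range mean_less by (auto simp: mult_left_le)
  then have c_le: "c \<le> 1 - s" by (simp add: c_def)
  have cond': "\<theta> / 4 \<le> 1 / s \<or> lf' 0 \<ge> 1 / s \<or> lf' 1 \<ge> 1 / s \<or>
      (\<exists>x1 x2. x1 < xs \<and> xs < x2 \<and> lf' x1 = 1 / s \<and> lf' x2 = 1 / s \<and>
        (lf x1 \<ge> x1 / s \<or> s * lf x2 + c < x2))"
  proof -
    \<comment> \<open>\<open>unique_zero\<close> needs a strict inequality. Equality would force
      \<open>c = \<alpha> + \<beta>\<close>; since \<open>mean z < 1\<close>, this means
      \<open>\<alpha> = 0\<close> and \<open>q = 1\<close>, and the tangency is exactly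
      \<open>decoupled_touching\<close>.\<close>
    have "s * lf x2 + c < x2" if x2: "xs < x2" "x2 < 1" "lf' x2 = 1 / s" "lf x2 \<le> x2 / s - (\<alpha> + \<beta>) / s" for x2
    proof (rule ccontr)
      assume "\<not> ?thesis"
      moreover have "s * lf x2 \<le> x2 - (\<alpha> + \<beta>)"
      proof -
        have "s * lf x2 \<le> s * (x2 / s - (\<alpha> + \<beta>) / s)" using x2(4) s_pos by (intro mult_left_mono) auto
        also have "\<dots> = x2 - (\<alpha> + \<beta>)" using s_pos by (simp add: right_diff_distrib)
        finally show ?thesis .
      qed
      ultimately have "\<alpha> + \<beta> \<le> c" and eq2: "c \<le> \<alpha> + \<beta> \<Longrightarrow> s * lf x2 = x2 - (\<alpha> + \<beta>)" by auto
      then have "\<alpha> * mean z = \<alpha>" "\<beta> * q = \<beta>"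
        using \<open>\<alpha> * mean z \<le> \<alpha>\<close> \<open>\<beta> * q \<le> \<beta>\<close> unfolding c_def by linarith+
      then have "\<alpha> = 0" "q = 1" using mean_less \<alpha>\<beta>_range by auto
      moreover have "lf x2 = x2 / s - (\<alpha> + \<beta>) / s"
      proof -
        have "lf x2 = s * lf x2 / s"
          using s_pos by (intro nonzero_mult_div_cancel_left[symmetric]) auto
        also have "s * lf x2 = x2 - (\<alpha> + \<beta>)" using c_le by (intro eq2) simp
        finally show ?thesis by (simp only: diff_divide_distrib)
      qed
      ultimately have "decoupled_touching \<alpha> \<beta> q f xs"
        using x2 unfolding decoupled_touching_def f_def deriv_logistic by auto
      then show False using nondegenerate by simp
    qed
    with cond show ?thesis by blast
  qed
  obtain h0 :: 'n where True by blast
  define x where "x = z $ h0"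
  have "z $ h = x" for h
    unfolding x_def
    by (rule unique_zero[OF _ _ eq eq c_pos c_le cond']) (use b[of h] b[of h0] in auto)
  then have zx: "z = x *\<^sub>R 1" by (simp add: vec_eq_iff)
  moreover have "equilibrium x"
    using z unfolding zx zero_points_def using drift_scaleR_1 by blast
  ultimately show thesis using that b[of h0] by (simp add: x_def)
qed

lemma has_derivative_drift_scaleR_1:
  "(drift \<alpha> \<beta> q f has_derivative (\<lambda>v :: real ^ 'n. \<chi> h. \<alpha> * mean v + s * (lf' x * v $ h) - v $ h)) (at (x *\<^sub>R 1))"
proof -
  have mean_bl: "bounded_linear (mean :: real ^ 'n \<Rightarrow> real)"
    unfolding mean_def[abs_def]
    by (intro bounded_linear_const_mult bounded_linear_sum bounded_linear_vec_nth)
  have "((\<lambda>z :: real ^ 'n. f (z $ h)) has_derivative (\<lambda>v. lf' x * v $ h)) (at (x *\<^sub>R 1))" for h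
  proof -
    have "(f has_derivative (\<lambda>t. lf' x * t)) (at ((x *\<^sub>R (1 :: real ^ 'n)) $ h))"
      using has_real_derivative_logistic[of \<theta> xs x UNIV] by (simp add: f_def has_field_derivative_def)
    from has_derivative_compose[OF bounded_linear_imp_has_derivative[OF bounded_linear_vec_nth] this]
    show ?thesis .
  qed
  then have comp: "((\<lambda>z :: real ^ 'n. \<alpha> * mean z + \<beta> * q + s * f (z $ h) - z $ h) has_derivative
      (\<lambda>v. \<alpha> * mean v + 0 + s * (lf' x * v $ h) - v $ h)) (at (x *\<^sub>R 1))" for h
    by (intro has_derivative_diff has_derivative_add has_derivative_mult_right has_derivative_const
        bounded_linear_imp_has_derivative[OF mean_bl] bounded_linear_imp_has_derivative[OF bounded_linear_vec_nth])
  show ?thesis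
    by (rule has_derivative_componentwise_within[THEN iffD2])
      (use comp in \<open>auto simp: Basis_vec_def inner_axis drift_def\<close>)
qed

text \<open>The point is interior to the cube, so the derivative within the cube is the ordinary one
  and is unique.\<close>

lemma jacobian_drift_scaleR_1:
  assumes "0 < x" "x < 1"
  shows "jacobian (drift \<alpha> \<beta> q f) (at (x *\<^sub>R 1) within cbox 0 1) *v v =
    (\<chi> h :: 'n. \<alpha> * mean v + s * (lf' x * v $ h) - v $ h)"
proof -
  let ?D = "\<lambda>v :: real ^ 'n. \<chi> h. \<alpha> * mean v + s * (lf' x * v $ h) - v $ h"
  have "x *\<^sub>R (1 :: real ^ 'n) \<in> interior (cbox 0 1)" using assms by (simp add: mem_box_cart)
  then have at: "at (x *\<^sub>R (1 :: real ^ 'n)) within cbox 0 1 = at (x *\<^sub>R 1)" by (rule at_within_interior)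
  have D: "(drift \<alpha> \<beta> q f has_derivative ?D) (at (x *\<^sub>R 1))" by (rule has_derivative_drift_scaleR_1)
  then have "drift \<alpha> \<beta> q f differentiable (at (x *\<^sub>R (1 :: real ^ 'n)))" by (auto simp: differentiable_def)
  then have "(drift \<alpha> \<beta> q f has_derivative (\<lambda>h. jacobian (drift \<alpha> \<beta> q f) (at (x *\<^sub>R 1)) *v h)) (at (x *\<^sub>R (1 :: real ^ 'n)))"
    by (simp only: jacobian_works)
  from has_derivative_unique[OF this D] show ?thesis unfolding at by meson
qed

text \<open>The synchronous direction \<open>1\<close> has eigenvalue
  \<open>s * lf' x + \<alpha> - 1\<close>, vectors of mean zero have \<open>s * lf' x - 1\<close>.
  As \<open>\<alpha>\<close> is nonnegative, the former decides.\<close>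

lemma stable_iff:
  assumes x: "0 < x" "x < 1" "equilibrium x"
  shows "x *\<^sub>R 1 \<in> (stable_zero_points \<alpha> \<beta> q f :: (real ^ 'n) set) \<longleftrightarrow> s * lf' x + \<alpha> \<le> 1"
proof -
  have zero: "x *\<^sub>R 1 \<in> (zero_points \<alpha> \<beta> q f :: (real ^ 'n) set)"
    using x by (simp add: zero_points_def drift_scaleR_1 mem_box_cart)
  have ev: "eigenvalue (jacobian (drift \<alpha> \<beta> q f) (at (x *\<^sub>R (1 :: real ^ 'n)) within cbox 0 1)) l \<longleftrightarrow>
     (\<exists>v :: real ^ 'n. v \<noteq> 0 \<and> (\<forall>h. \<alpha> * mean v + s * (lf' x * v $ h) - v $ h = l * v $ h))" for l
    unfolding eigenvalue_def jacobian_drift_scaleR_1[OF x(1,2)] by (simp add: vec_eq_iff)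
  show ?thesis
  proof
    assume "x *\<^sub>R 1 \<in> (stable_zero_points \<alpha> \<beta> q f :: (real ^ 'n) set)"
    moreover have "eigenvalue (jacobian (drift \<alpha> \<beta> q f) (at (x *\<^sub>R (1 :: real ^ 'n)) within cbox 0 1)) (s * lf' x + \<alpha> - 1)"
      unfolding ev
    proof (intro exI conjI allI)
      have "mean (1 :: real ^ 'n) = 1" using mean_scaleR_1[of 1] by simp
      then show "\<alpha> * mean (1 :: real ^ 'n) + s * (lf' x * (1 :: real ^ 'n) $ h) - (1 :: real ^ 'n) $ h
          = (s * lf' x + \<alpha> - 1) * (1 :: real ^ 'n) $ h" for h by simp
    qed simp
    ultimately show "s * lf' x + \<alpha> \<le> 1" unfolding stable_zero_points_def by force
  next
    assume le: "s * lf' x + \<alpha> \<le> 1"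
    have "l \<le> 0" if v: "v \<noteq> 0" "\<And>h. \<alpha> * mean v + s * (lf' x * v $ h) - v $ h = l * v $ h" for l and v :: "real ^ 'n"
    proof (cases "mean v = 0")
      case True
      obtain h where "v $ h \<noteq> 0" using v(1) by (auto simp: vec_eq_iff)
      moreover have "(s * lf' x - 1) * v $ h = l * v $ h" using v(2)[of h] True by (simp add: left_diff_distrib)
      ultimately have "l = s * lf' x - 1" by simp
      then show ?thesis using le \<alpha>_range by simp
    next
      case False
      \<comment> \<open>Adding up all coordinates turns the eigenvalue equation into a scalar one
        for the nonzero mean.\<close>
      have "(\<Sum>h\<in>UNIV. \<alpha> * mean v + (s * lf' x - 1 - l) * v $ h) = 0"
        using v(2) by (intro sum.neutral) (simp add: algebra_simps)
      then have "real CARD('n) * (\<alpha> * mean v) + (s * lf' x - 1 - l) * (\<Sum>h\<in>UNIV. v $ h) = 0"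
        by (simp add: sum.distrib sum_distrib_left)
      moreover have "(\<Sum>h\<in>UNIV. v $ h) = real CARD('n) * mean v" by (simp add: mean_eq)
      ultimately have "(real CARD('n) * mean v) * (\<alpha> + s * lf' x - 1 - l) = 0" by (simp add: algebra_simps)
      then have "l = \<alpha> + s * lf' x - 1" using False by simp
      then show ?thesis using le by simp
    qed
    then have "\<forall>l. eigenvalue (jacobian (drift \<alpha> \<beta> q f) (at (x *\<^sub>R (1 :: real ^ 'n)) within cbox 0 1)) l \<longrightarrow> l \<le> 0"
      unfolding ev by blast
    then show "x *\<^sub>R 1 \<in> (stable_zero_points \<alpha> \<beta> q f :: (real ^ 'n) set)"
      using zero by (simp add: stable_zero_points_def)
  qed
qed

lemma convergence_to_stable_zero_point:
  assumes cond: "\<theta> / 4 \<le> 1 / s \<or> lf' 0 \<ge> 1 / s \<or> lf' 1 \<ge> 1 / s \<or>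
      (\<exists>x1 x2. x1 < xs \<and> xs < x2 \<and> x2 < 1 \<and> lf' x1 = 1 / s \<and> lf' x2 = 1 / s \<and>
        (lf x1 \<ge> x1 / s \<or> lf x2 \<le> x2 / s - (\<alpha> + \<beta>) / s))"
    and nondegenerate: "\<not> decoupled_touching \<alpha> \<beta> q f xs"
  shows "\<exists>Zinf \<in> borel_measurable M.
      (AE \<omega> in M. (\<lambda>n. Z n \<omega>) \<longlonglongrightarrow> Zinf \<omega> *\<^sub>R 1 \<and>
        (\<lambda>n. (1 / real n) *\<^sub>R (\<Sum>k=1..n. I k \<omega>)) \<longlonglongrightarrow> Zinf \<omega> *\<^sub>R 1) \<and>
      (\<forall>\<omega>\<in>space M. Zinf \<omega> *\<^sub>R 1 \<in> (stable_zero_points \<alpha> \<beta> q f :: (real ^ 'n) set))"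
    and "finite (stable_zero_points \<alpha> \<beta> q f :: (real ^ 'n) set)"
    and "card (stable_zero_points \<alpha> \<beta> q f :: (real ^ 'n) set) \<le> 2"
proof -
  define E where "E = {x. 0 < x \<and> x < 1 \<and> equilibrium x}"
  define S where "S = {x \<in> E. s * lf' x + \<alpha> \<le> 1}"
  have fin_E: "finite E"
    by (rule finite_subset[OF _ finite_zeros[of "\<beta> * q" "1 - \<alpha>"]]) (auto simp: E_def)
  have sync: "\<exists>x\<in>E. z = x *\<^sub>R 1" if "z \<in> zero_points \<alpha> \<beta> q f" for z :: "real ^ 'n"
    using zero_point_synchronized[OF that cond nondegenerate] unfolding E_def by blast
  have stable_eq: "(stable_zero_points \<alpha> \<beta> q f :: (real ^ 'n) set) = (\<lambda>x. x *\<^sub>R 1) ` S"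
  proof (intro set_eqI iffI)
    fix z :: "real ^ 'n" assume z: "z \<in> stable_zero_points \<alpha> \<beta> q f"
    then obtain x where x: "x \<in> E" "z = x *\<^sub>R 1" using sync by (auto simp: stable_zero_points_def)
    then show "z \<in> (\<lambda>x. x *\<^sub>R 1) ` S" using z stable_iff[of x] by (auto simp: E_def S_def)
  next
    fix z :: "real ^ 'n" assume "z \<in> (\<lambda>x. x *\<^sub>R 1) ` S"
    then show "z \<in> stable_zero_points \<alpha> \<beta> q f" using stable_iff by (auto simp: E_def S_def)
  qed
  \<comment> \<open>Of three equilibria the middle one has \<open>s * lf' b > 1 - \<alpha>\<close>,
    the opposite of stability.\<close>
  have S: "finite S \<and> card S \<le> 2"
  proof (rule card_le_2_if_no_increasing_triple)
    fix a b c assume "a \<in> S" "b \<in> S" "c \<in> S" "a < b" "b < c"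
    then show False using middle_zero_unstable[of a b c "\<beta> * q" "1 - \<alpha>"] by (simp add: S_def E_def)
  qed
  then show "finite (stable_zero_points \<alpha> \<beta> q f :: (real ^ 'n) set)" unfolding stable_eq by simp
  show "card (stable_zero_points \<alpha> \<beta> q f :: (real ^ 'n) set) \<le> 2"
    unfolding stable_eq using S card_image_le le_trans by blast
  have fin: "finite (zero_points \<alpha> \<beta> q f :: (real ^ 'n) set)"
    by (rule finite_subset[of _ "(\<lambda>x. x *\<^sub>R 1) ` E"]) (use sync fin_E in auto)
  have "AE \<omega> in M. \<forall>x\<in>E - S. \<not> (\<lambda>n. Z n \<omega>) \<longlonglongrightarrow> x *\<^sub>R 1"
    by (intro AE_finite_allI AE_not_tendsto_unstable) (use fin_E in \<open>auto simp: E_def S_def\<close>)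
  with AE_tendsto_zero_point[OF fin]
  have lim: "AE \<omega> in M. \<exists>x\<in>S. (\<lambda>n. Z n \<omega>) \<longlonglongrightarrow> x *\<^sub>R 1"
  proof eventually_elim
    case (elim \<omega>)
    then obtain z where z: "z \<in> zero_points \<alpha> \<beta> q f" "(\<lambda>n. Z n \<omega>) \<longlonglongrightarrow> z" by blast
    then obtain x where "x \<in> E" "z = x *\<^sub>R 1" using sync by blast
    then show ?case using z elim(2) by blast
  qed
  \<comment> \<open>A stable equilibrium exists because the almost sure limit has to be one; it
    serves as the default value \<open>x0\<close>.\<close>
  have "S \<noteq> {}"
  proof
    assume "S = {}"
    then have "AE \<omega> in M. False" using lim by simp
    then show False by simp
  qed
  then obtain x0 where x0: "x0 \<in> S" by blast
  define Y where "Y \<omega> = lim (\<lambda>n. mean (Z n \<omega>))" for \<omega>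
  \<comment> \<open>Replacing the values outside \<open>S\<close> by \<open>x0\<close> makes the
    limit a stable zero for every outcome, not only almost surely. It stays measurable since
    \<open>S\<close> is finite.\<close>
  define Zinf where "Zinf \<omega> = (if Y \<omega> \<in> S then Y \<omega> else x0)" for \<omega>
  have mean_meas: "(mean :: real ^ 'n \<Rightarrow> real) \<in> borel_measurable borel"
    by (intro borel_measurable_continuous_onI continuous_on_mean)
  have [measurable]: "(\<lambda>\<omega>. mean (Z n \<omega>)) \<in> borel_measurable M" for n
    by (rule measurable_compose[OF measurable_past_M[OF borel_measurable_Z] mean_meas])
  have [measurable]: "Y \<in> borel_measurable M" unfolding Y_def by measurable
  have "S \<in> sets borel" using S by (intro borel_closed finite_imp_closed) simp
  then have [measurable]: "{\<omega> \<in> space M. Y \<omega> \<in> S} \<in> sets M" by measurable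
  have Zinf_meas: "Zinf \<in> borel_measurable M" unfolding Zinf_def by measurable
  have "AE \<omega> in M. (\<lambda>n. Z n \<omega>) \<longlonglongrightarrow> Zinf \<omega> *\<^sub>R 1 \<and>
        (\<lambda>n. (1 / real n) *\<^sub>R (\<Sum>k=1..n. I k \<omega>)) \<longlonglongrightarrow> Zinf \<omega> *\<^sub>R 1"
    using lim
  proof (rule AE_mp, intro AE_I2 impI)
    fix \<omega> assume \<omega>: "\<omega> \<in> space M" and "\<exists>x\<in>S. (\<lambda>n. Z n \<omega>) \<longlonglongrightarrow> x *\<^sub>R 1"
    then obtain x where x: "x \<in> S" "(\<lambda>n. Z n \<omega>) \<longlonglongrightarrow> x *\<^sub>R 1" by blast
    have "isCont mean (x *\<^sub>R (1 :: real ^ 'n))"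
      using continuous_on_mean[of "UNIV :: (real ^ 'n) set"] by (simp add: continuous_on_eq_continuous_at)
    from isCont_tendsto_compose[OF this x(2)] have "(\<lambda>n. mean (Z n \<omega>)) \<longlonglongrightarrow> x"
      by (simp add: mean_scaleR_1)
    then have "Y \<omega> = x" unfolding Y_def by (rule limI)
    then have Zx: "Zinf \<omega> = x" using x(1) by (simp add: Zinf_def)
    have "(\<lambda>n. ((1 / real n) *\<^sub>R (\<Sum>k=1..n. I k \<omega>)) $ h) \<longlonglongrightarrow> (x *\<^sub>R (1 :: real ^ 'n)) $ h" for h
    proof -
      have "(\<lambda>n. Z n \<omega> $ h) \<longlonglongrightarrow> (x *\<^sub>R (1 :: real ^ 'n)) $ h" by (rule tendsto_vec_nth[OF x(2)])
      moreover have "\<bar>I (Suc n) \<omega> $ h\<bar> \<le> 1" for n using I_range[OF \<omega>, of n h] by auto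
      ultimately have "(\<lambda>n. (1 / real n) * (\<Sum>k=1..n. I k \<omega> $ h)) \<longlonglongrightarrow> (x *\<^sub>R (1 :: real ^ 'n)) $ h"
        by (intro averages_tendsto_of_recursion[OF r_lim Z_Suc[OF \<omega>]])
      then show ?thesis by simp
    qed
    then have "(\<lambda>n. (1 / real n) *\<^sub>R (\<Sum>k=1..n. I k \<omega>)) \<longlonglongrightarrow> x *\<^sub>R 1" by (rule vec_tendstoI)
    with x(2) Zx show "(\<lambda>n. Z n \<omega>) \<longlonglongrightarrow> Zinf \<omega> *\<^sub>R 1 \<and>
        (\<lambda>n. (1 / real n) *\<^sub>R (\<Sum>k=1..n. I k \<omega>)) \<longlonglongrightarrow> Zinf \<omega> *\<^sub>R 1" by simp
  qed
  moreover have "Zinf \<omega> *\<^sub>R 1 \<in> (stable_zero_points \<alpha> \<beta> q f :: (real ^ 'n) set)" for \<omega>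
    unfolding stable_eq using x0 by (simp add: Zinf_def)
  ultimately show "\<exists>Zinf \<in> borel_measurable M.
      (AE \<omega> in M. (\<lambda>n. Z n \<omega>) \<longlonglongrightarrow> Zinf \<omega> *\<^sub>R 1 \<and>
        (\<lambda>n. (1 / real n) *\<^sub>R (\<Sum>k=1..n. I k \<omega>)) \<longlonglongrightarrow> Zinf \<omega> *\<^sub>R 1) \<and>
      (\<forall>\<omega>\<in>space M. Zinf \<omega> *\<^sub>R 1 \<in> (stable_zero_points \<alpha> \<beta> q f :: (real ^ 'n) set))"
    using Zinf_meas by blast
qed

end

theorem theorem3p6:
  fixes M :: "'a measure" and \<alpha> \<beta> q \<theta> xs :: real and f :: "real \<Rightarrow> real"
    and r :: "nat \<Rightarrow> real" and Z I :: "nat \<Rightarrow> 'a \<Rightarrow> real ^ 'n"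
  assumes f_def: "f = logistic \<theta> xs"
    and xs: "0 < xs" "xs < 1"
    and \<theta>: "\<theta> > 0"
    and model: "interacting_system M \<alpha> \<beta> q f r Z I"
    and conditions:
      "\<theta> / 4 \<le> 1 / (1 - \<alpha> - \<beta>) \<or>
       max (deriv f 0) (deriv f 1) \<ge> 1 / (1 - \<alpha> - \<beta>) \<or>
       (max (deriv f 0) (deriv f 1) < 1 / (1 - \<alpha> - \<beta>) \<and> 1 / (1 - \<alpha> - \<beta>) < \<theta> / 4 \<and>
        (\<exists>x1 x2. x1 \<in> {0<..<xs} \<and> x2 = 2 * xs - x1 \<and> x2 \<in> {xs<..<1} \<and>
           deriv f x1 = 1 / (1 - \<alpha> - \<beta>) \<and> deriv f x2 = 1 / (1 - \<alpha> - \<beta>) \<and>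
           (f x1 \<ge> x1 / (1 - \<alpha> - \<beta>) \<or>
            f x2 \<le> x2 / (1 - \<alpha> - \<beta>) - (\<alpha> + \<beta>) / (1 - \<alpha> - \<beta>))))"
    and nondegenerate: "\<not> decoupled_touching \<alpha> \<beta> q f xs"
  shows "(\<exists>Zinf \<in> borel_measurable M.
            (AE \<omega> in M.
               (\<lambda>n. Z n \<omega>) \<longlonglongrightarrow> Zinf \<omega> *\<^sub>R 1 \<and>
               (\<lambda>n. (1 / real n) *\<^sub>R (\<Sum>k=1..n. I k \<omega>)) \<longlonglongrightarrow> Zinf \<omega> *\<^sub>R 1) \<and>
            (\<forall>\<omega>\<in>space M. Zinf \<omega> *\<^sub>R 1 \<in> (stable_zero_points \<alpha> \<beta> q f :: (real ^ 'n) set))) \<and>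
         (stable_zero_points \<alpha> \<beta> q f :: (real ^ 'n) set) \<subseteq> {z. \<forall>h. 0 < z $ h \<and> z $ h < 1} \<and>
         finite (stable_zero_points \<alpha> \<beta> q f :: (real ^ 'n) set) \<and>
         card (stable_zero_points \<alpha> \<beta> q f :: (real ^ 'n) set) \<le> 2"
proof -
  interpret logistic_system M \<alpha> \<beta> q f r Z I \<theta> xs
    by (intro logistic_system.intro model logistic_system_axioms.intro f_def \<theta>)
  have cond: "\<theta> / 4 \<le> 1 / s \<or> lf' 0 \<ge> 1 / s \<or> lf' 1 \<ge> 1 / s \<or>
      (\<exists>x1 x2. x1 < xs \<and> xs < x2 \<and> x2 < 1 \<and> lf' x1 = 1 / s \<and> lf' x2 = 1 / s \<and>
        (lf x1 \<ge> x1 / s \<or> lf x2 \<le> x2 / s - (\<alpha> + \<beta>) / s))"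
    using conditions unfolding f_def deriv_logistic le_max_iff_disj greaterThanLessThan_iff by blast
  have "(stable_zero_points \<alpha> \<beta> q f :: (real ^ 'n) set) \<subseteq> {z. \<forall>h. 0 < z $ h \<and> z $ h < 1}"
    using zero_point_bounds by (auto simp: stable_zero_points_def)
  then show ?thesis using convergence_to_stable_zero_point[OF cond nondegenerate] by blast
qed

end
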